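(* The recoverable robust selection problem \textsc{RREC} under the continuous budgeted uncertainty set $\mathcal{U}^c$, i.e. the problem $$\min_{\mathbf{x}\in\Phi}\Big(\mathbf{C}\mathbf{x}+\max_{\mathbf{c}\in\mathcal{U}^c}\ \min_{\mathbf{y}\in\Phi^k_{\mathbf{x}}}\mathbf{c}\mathbf{y}\Big),$$ is solvable in polynomial time.
   Context: Let $[n]=\{1,\dots,n\}$ and $p\in[n]$. The input consists of $n$, $p$, a recovery parameter $k\in[p]\cup\{0\}$, a vector $\mathbf{C}=(C_1,\dots,C_n)$ of first-stage item costs, nonnegative item costs $\underline{c}_i\le\overline{c}_i$ with $d_i=\overline{c}_i-\underline{c}_i\ge 0$ for $i\in[n]$, and a budget $\Gamma\ge 0$. Products such as $\mathbf{c}\mathbf{y}$ denote $\sum_{i\in[n]}c_iy_i$. $\Phi=\{\mathbf{x}\in\{0,1\}^n:\sum_{i\in[n]}x_i=p\}$. For $\mathbf{x}\in\Phi$, $\Phi^k_{\mathbf{x}}=\{\mathbf{y}\in\{0,1\}^n:\sum_{i\in[n]}y_i=p,\ \sum_{i\in[n]}x_iy_i\ge p-k\}$. The continuous budgeted uncertainty set is $\mathcal{U}^c=\{(\underline{c}_i+\delta_i)_{i\in[n]}:\delta_i\in[0,d_i],\ \sum_{i\in[n]}\delta_i\le\Gamma\}$. *)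

theory Defs
  imports
    "HOL-Analysis.Analysis"
    "HOL-Library.Log_Nat"
    "HOL-Computational_Algebra.Polynomial"
begin

section \<open>Recoverable robust selection\<close>

definition selections :: "nat \<Rightarrow> nat \<Rightarrow> (nat \<Rightarrow> nat) set" where
  "selections n p = {x \<in> {1..n} \<rightarrow>\<^sub>E {0, 1}. (\<Sum>i = 1..n. x i) = p}"

definition recovery_selections :: "nat \<Rightarrow> nat \<Rightarrow> nat \<Rightarrow> (nat \<Rightarrow> nat) \<Rightarrow> (nat \<Rightarrow> nat) set" where
  "recovery_selections n p k x =
     {y \<in> {1..n} \<rightarrow>\<^sub>E {0, 1}. (\<Sum>i = 1..n. y i) = p \<and> (\<Sum>i = 1..n. x i * y i) \<ge> p - k}"

definition continuous_budgeted_set ::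
  "nat \<Rightarrow> (nat \<Rightarrow> real) \<Rightarrow> (nat \<Rightarrow> real) \<Rightarrow> real \<Rightarrow> (nat \<Rightarrow> real) set" where
  "continuous_budgeted_set n cl cu \<Gamma> =
     {(\<lambda>i\<in>{1..n}. cl i + \<delta> i) | \<delta>.
        (\<forall>i\<in>{1..n}. \<delta> i \<in> {0..cu i - cl i}) \<and> (\<Sum>i = 1..n. \<delta> i) \<le> \<Gamma>}"

definition item_cost :: "nat \<Rightarrow> (nat \<Rightarrow> real) \<Rightarrow> (nat \<Rightarrow> nat) \<Rightarrow> real" where
  "item_cost n c y = (\<Sum>i = 1..n. c i * real (y i))"

text \<open>The supremum below is a maximum for all admissible data, see
  \<open>rrec_adversary_attained\<close>.\<close>

definition rrec_cost ::
  "nat \<Rightarrow> nat \<Rightarrow> nat \<Rightarrow> (nat \<Rightarrow> real) \<Rightarrow> (nat \<Rightarrow> real) \<Rightarrow> (nat \<Rightarrow> real) \<Rightarrow> real \<Rightarrow> (nat \<Rightarrow> nat) \<Rightarrow> real"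
  where
  "rrec_cost n p k C cl cu \<Gamma> x =
     item_cost n C x +
     (SUP c\<in>continuous_budgeted_set n cl cu \<Gamma>. MIN y\<in>recovery_selections n p k x. item_cost n c y)"

definition rrec_opt ::
  "nat \<Rightarrow> nat \<Rightarrow> nat \<Rightarrow> (nat \<Rightarrow> real) \<Rightarrow> (nat \<Rightarrow> real) \<Rightarrow> (nat \<Rightarrow> real) \<Rightarrow> real \<Rightarrow> real" where
  "rrec_opt n p k C cl cu \<Gamma> = (MIN x\<in>selections n p. rrec_cost n p k C cl cu \<Gamma> x)"

lemma finite_selections: "finite (selections n p)"
  by (rule finite_subset[of _ "{1..n} \<rightarrow>\<^sub>E {0, 1}"]) (auto simp: selections_def intro!: finite_PiE)

lemma finite_recovery_selections: "finite (recovery_selections n p k x)"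
  by (rule finite_subset[of _ "{1..n} \<rightarrow>\<^sub>E {0, 1}"])
     (auto simp: recovery_selections_def intro!: finite_PiE)

lemma selections_nonempty:
  assumes "p \<le> n"
  shows "selections n p \<noteq> {}"
proof -
  let ?x = "\<lambda>i\<in>{1..n}. if i \<le> p then 1 else 0 :: nat"
  have "(\<Sum>i = 1..n. ?x i) = (\<Sum>i = 1..n. if i \<le> p then 1 else 0)"
    by simp
  also have "\<dots> = (\<Sum>i\<in>{i\<in>{1..n}. i \<le> p}. 1)"
    by (rule sum.inter_filter[symmetric]) simp
  also have "{i\<in>{1..n}. i \<le> p} = {1..p}"
    using assms by auto
  finally have "?x \<in> selections n p"
    by (auto simp: selections_def PiE_def)
  then show ?thesis by blast
qed

lemma self_in_recovery_selections:
  assumes "x \<in> selections n p"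
  shows "x \<in> recovery_selections n p k x"
proof -
  have "x i * x i = x i" if "i \<in> {1..n}" for i
    using assms that by (auto simp: selections_def PiE_def Pi_def)
  then have "(\<Sum>i = 1..n. x i * x i) = (\<Sum>i = 1..n. x i)"
    by (intro sum.cong) auto
  then show ?thesis
    using assms by (auto simp: selections_def recovery_selections_def)
qed

lemma continuous_on_Min_image:
  fixes f :: "'a :: topological_space \<Rightarrow> 'b \<Rightarrow> real"
  assumes "finite A" "A \<noteq> {}" "\<And>y. y \<in> A \<Longrightarrow> continuous_on S (\<lambda>c. f c y)"
  shows "continuous_on S (\<lambda>c. MIN y\<in>A. f c y)"
  using assms
proof (induction A rule: finite_ne_induct)
  case (singleton y)
  then show ?case by simp
next
  case (insert y A)
  have "(\<lambda>c. MIN y\<in>insert y A. f c y) = (\<lambda>c. min (f c y) (MIN y\<in>A. f c y))"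
    using insert.hyps by auto
  moreover have "continuous_on S (\<lambda>c. min (f c y) (MIN y\<in>A. f c y))"
    using insert by (intro continuous_on_min) auto
  ultimately show ?case by (simp only:)
qed

lemma rrec_adversary_attained:
  assumes "x \<in> selections n p" "\<Gamma> \<ge> 0" "\<And>i. i \<in> {1..n} \<Longrightarrow> cl i \<le> cu i"
  shows "\<exists>c\<in>continuous_budgeted_set n cl cu \<Gamma>.
           (MIN y\<in>recovery_selections n p k x. item_cost n c y) =
           (SUP c\<in>continuous_budgeted_set n cl cu \<Gamma>. MIN y\<in>recovery_selections n p k x. item_cost n c y)"
proof -
  let ?U = "continuous_budgeted_set n cl cu \<Gamma>"
  let ?D = "\<Pi>\<^sub>E i\<in>UNIV. if i \<in> {1..n} then {0..cu i - cl i} else {0 :: real}"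
  let ?D' = "?D \<inter> {\<delta>. (\<Sum>i = 1..n. \<delta> i) \<le> \<Gamma>}"
  let ?g = "\<lambda>\<delta> :: nat \<Rightarrow> real. \<lambda>i\<in>{1..n}. cl i + \<delta> i"
  have coord: "continuous_on S (\<lambda>\<delta> :: nat \<Rightarrow> real. \<delta> i)" for S i
    by (rule continuous_on_subset[OF continuous_on_product_coordinates subset_UNIV])
  have "compactin (product_topology (\<lambda>_. euclidean) UNIV) ?D"
    unfolding compactin_PiE by simp
  then have "compact ?D"
    unfolding euclidean_product_topology compactin_euclidean_iff .
  moreover have "closed {\<delta> :: nat \<Rightarrow> real. (\<Sum>i = 1..n. \<delta> i) \<le> \<Gamma>}"
    by (intro closed_Collect_le continuous_intros coord)
  ultimately have comp: "compact ?D'"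
    by (rule compact_Int_closed)
  have U: "?U = ?g ` ?D'"
  proof
    show "?U \<subseteq> ?g ` ?D'"
    proof
      fix c assume "c \<in> ?U"
      then obtain \<delta> where \<delta>: "c = ?g \<delta>" "\<forall>i\<in>{1..n}. \<delta> i \<in> {0..cu i - cl i}" "(\<Sum>i = 1..n. \<delta> i) \<le> \<Gamma>"
        by (auto simp: continuous_budgeted_set_def)
      let ?e = "\<lambda>i. if i \<in> {1..n} then \<delta> i else 0"
      have "?e \<in> ?D'" using \<delta> by (auto simp: PiE_def Pi_def)
      moreover have "c = ?g ?e" using \<delta>(1) by (auto simp: fun_eq_iff)
      ultimately show "c \<in> ?g ` ?D'" by (intro rev_image_eqI)
    qed
    show "?g ` ?D' \<subseteq> ?U"
    proof (rule image_subsetI)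
      fix \<delta> assume \<delta>: "\<delta> \<in> ?D'"
      have "\<delta> i \<in> {0..cu i - cl i}" if "i \<in> {1..n}" for i
      proof -
        have "\<delta> i \<in> (if i \<in> {1..n} then {0..cu i - cl i} else {0})"
          by (rule PiE_mem[OF IntD1[OF \<delta>] UNIV_I])
        then show ?thesis using that by simp
      qed
      then show "?g \<delta> \<in> ?U"
        unfolding continuous_budgeted_set_def using IntD2[OF \<delta>]
        by (intro CollectI exI[of _ \<delta>]) simp
    qed
  qed
  have ne: "?U \<noteq> {}"
  proof -
    have "?g (\<lambda>_. 0) \<in> ?U"
      unfolding continuous_budgeted_set_def using assms
      by (intro CollectI exI[of _ "\<lambda>_. 0"]) auto
    then show ?thesis by blast
  qed
  have "continuous_on ?D' ?g"
  proof (rule continuous_on_coordinatewise_then_product)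
    fix i
    show "continuous_on ?D' (\<lambda>\<delta>. ?g \<delta> i)"
    proof (cases "i \<in> {1..n}")
      case True
      then show ?thesis
        by (simp only: restrict_apply if_True) (intro continuous_on_add continuous_on_const coord)
    next
      case False
      then show ?thesis
        by (simp only: restrict_apply if_False) (rule continuous_on_const)
    qed
  qed
  then have compU: "compact ?U"
    unfolding U using comp by (rule compact_continuous_image)
  have "continuous_on ?U (\<lambda>c. MIN y\<in>recovery_selections n p k x. item_cost n c y)"
  proof (rule continuous_on_Min_image[OF finite_recovery_selections])
    show "recovery_selections n p k x \<noteq> {}"
      using self_in_recovery_selections[OF assms(1)] by blast
    show "continuous_on ?U (\<lambda>c. item_cost n c y)" for y
      unfolding item_cost_def
      by (intro continuous_on_sum continuous_on_mult continuous_on_const coord)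
  qed
  from continuous_attains_sup[OF compU ne this] obtain c where
    "c \<in> ?U" "\<forall>c'\<in>?U. (MIN y\<in>recovery_selections n p k x. item_cost n c' y)
       \<le> (MIN y\<in>recovery_selections n p k x. item_cost n c y)"
    by blast
  then show ?thesis
    by (intro bexI[of _ c] cSup_eq_maximum[symmetric]) auto
qed


section \<open>Random access machines with logarithmic cost\<close>

text \<open>
  Programs act on an unbounded memory of integer cells with indirect addressing. Every basic
  operation is charged the binary length of its operands, including the addresses used, so
  that polynomial time coincides with polynomial time on Turing machines.
\<close>

type_synonym memory = "int \<Rightarrow> int"

datatype binop = Plus | Minus | Times | Quotient

datatype expr = Lit int | Load expr | Op binop expr expr

datatype program =
    Skip
  | Store expr expr
  | Sequence program program
  | IfPositive expr program program
  | WhilePositive expr program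

text \<open>One bit is reserved for the sign, so the length is always positive.\<close>

definition bit_length :: "int \<Rightarrow> nat" where
  "bit_length z = floorlog 2 (nat \<bar>z\<bar>) + 1"

fun apply_op :: "binop \<Rightarrow> int \<Rightarrow> int \<Rightarrow> int" where
  "apply_op Plus a b = a + b"
| "apply_op Minus a b = a - b"
| "apply_op Times a b = a * b"
| "apply_op Quotient a b = a div b"

fun expr_val :: "expr \<Rightarrow> memory \<Rightarrow> int" where
  "expr_val (Lit z) s = z"
| "expr_val (Load e) s = s (expr_val e s)"
| "expr_val (Op f a b) s = apply_op f (expr_val a s) (expr_val b s)"

fun expr_time :: "expr \<Rightarrow> memory \<Rightarrow> nat" where
  "expr_time (Lit z) s = bit_length z"
| "expr_time (Load e) s =
     expr_time e s + bit_length (expr_val e s) + bit_length (s (expr_val e s))"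
| "expr_time (Op f a b) s =
     expr_time a s + expr_time b s + bit_length (expr_val a s) + bit_length (expr_val b s)"

text \<open>\<open>runs P s t s'\<close>: started in memory \<open>s\<close>, the program \<open>P\<close> halts after time \<open>t\<close> in memory \<open>s'\<close>.
  \<open>Store a e\<close> writes the value of \<open>e\<close> to the cell whose address is the value of \<open>a\<close>.\<close>

inductive runs :: "program \<Rightarrow> memory \<Rightarrow> nat \<Rightarrow> memory \<Rightarrow> bool" where
  Skip: "runs Skip s 1 s"
| Store: "runs (Store a e) s
     (expr_time a s + expr_time e s + bit_length (expr_val a s) + bit_length (expr_val e s))
     (s(expr_val a s := expr_val e s))"
| Sequence: "runs P s t s' \<Longrightarrow> runs Q s' t' s'' \<Longrightarrow> runs (Sequence P Q) s (t + t') s''"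
| IfTrue: "expr_val e s > 0 \<Longrightarrow> runs P s t s' \<Longrightarrow>
     runs (IfPositive e P Q) s (expr_time e s + bit_length (expr_val e s) + t) s'"
| IfFalse: "\<not> expr_val e s > 0 \<Longrightarrow> runs Q s t s' \<Longrightarrow>
     runs (IfPositive e P Q) s (expr_time e s + bit_length (expr_val e s) + t) s'"
| WhileFalse: "\<not> expr_val e s > 0 \<Longrightarrow>
     runs (WhilePositive e P) s (expr_time e s + bit_length (expr_val e s)) s"
| WhileTrue: "expr_val e s > 0 \<Longrightarrow> runs P s t s' \<Longrightarrow> runs (WhilePositive e P) s' t' s'' \<Longrightarrow>
     runs (WhilePositive e P) s (expr_time e s + bit_length (expr_val e s) + t + t') s''"

inductive_cases Skip_runsE: "runs Skip s t s'"
inductive_cases Store_runsE: "runs (Store a e) s t s'"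
inductive_cases Sequence_runsE: "runs (Sequence P Q) s t s'"
inductive_cases IfPositive_runsE: "runs (IfPositive e P Q) s t s'"
inductive_cases WhilePositive_runsE: "runs (WhilePositive e P) s t s'"

lemma runs_deterministic: "runs P s t s' \<Longrightarrow> runs P s u s'' \<Longrightarrow> u = t \<and> s'' = s'"
proof (induction arbitrary: u s'' rule: runs.induct)
  case Skip
  then show ?case by (auto elim: Skip_runsE)
next
  case Store
  then show ?case by (auto elim: Store_runsE)
next
  case Sequence
  from Sequence.prems show ?case
    by (rule Sequence_runsE) (use Sequence.IH in blast)
next
  case IfTrue
  from IfTrue.prems show ?case
    by (rule IfPositive_runsE) (use IfTrue.IH IfTrue.hyps in blast)+
next
  case IfFalse
  from IfFalse.prems show ?case
    by (rule IfPositive_runsE) (use IfFalse.IH IfFalse.hyps in blast)+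
next
  case WhileFalse
  from WhileFalse.prems show ?case
    by (rule WhilePositive_runsE) (use WhileFalse.hyps in blast)+
next
  case WhileTrue
  from WhileTrue.prems show ?case
    by (rule WhilePositive_runsE) (use WhileTrue.IH WhileTrue.hyps in blast)+
qed

text \<open>A list is passed in the cells \<open>1, 2, \<dots>\<close>, with its length in cell \<open>0\<close>.\<close>

definition input_memory :: "int list \<Rightarrow> memory" where
  "input_memory xs a =
     (if a = 0 then int (length xs)
      else if 1 \<le> a \<and> a \<le> int (length xs) then xs ! nat (a - 1)
      else 0)"

definition output_list :: "memory \<Rightarrow> int list" where
  "output_list s = map (\<lambda>j. s (int j)) [1..<nat (s 0) + 1]"

definition input_size :: "int list \<Rightarrow> nat" where
  "input_size xs = (\<Sum>z\<leftarrow>xs. bit_length z)"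

definition solvable_in_polynomial_time ::
  "'i set \<Rightarrow> ('i \<Rightarrow> int list) \<Rightarrow> ('i \<Rightarrow> int list \<Rightarrow> bool) \<Rightarrow> bool" where
  "solvable_in_polynomial_time instances encode solution \<longleftrightarrow>
     (\<exists>P :: program. \<exists>q :: nat poly. \<forall>I\<in>instances. \<exists>t s.
        runs P (input_memory (encode I)) t s \<and>
        t \<le> poly q (input_size (encode I)) \<and>
        solution I (output_list s))"


section \<open>RREC as a computational problem\<close>

text \<open>Only the values of the cost vectors at the indices \<open>1, \<dots>, num_items\<close> are relevant.\<close>

record rrec_instance =
  num_items :: nat
  num_selected :: nat
  recovery :: nat
  first_cost :: "nat \<Rightarrow> rat"
  lower_cost :: "nat \<Rightarrow> rat"
  upper_cost :: "nat \<Rightarrow> rat"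
  budget :: rat

definition rrec_instances :: "rrec_instance set" where
  "rrec_instances = {I.
     num_selected I \<in> {1..num_items I} \<and>
     recovery I \<in> {0..num_selected I} \<and>
     (\<forall>i\<in>{1..num_items I}. 0 \<le> lower_cost I i \<and> lower_cost I i \<le> upper_cost I i) \<and>
     0 \<le> budget I}"

definition encode_rat :: "rat \<Rightarrow> int list" where
  "encode_rat r = [fst (quotient_of r), snd (quotient_of r)]"

definition encode_vector :: "nat \<Rightarrow> (nat \<Rightarrow> rat) \<Rightarrow> int list" where
  "encode_vector n v = concat (map (\<lambda>i. encode_rat (v i)) [1..<n + 1])"

definition encode_rrec :: "rrec_instance \<Rightarrow> int list" where
  "encode_rrec I =
     [int (num_items I), int (num_selected I), int (recovery I)] @
     encode_rat (budget I) @
     encode_vector (num_items I) (first_cost I) @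
     encode_vector (num_items I) (lower_cost I) @
     encode_vector (num_items I) (upper_cost I)"

text \<open>A solution lists an optimal selection, followed by numerator and denominator of the
  optimal objective value.\<close>

definition rrec_solution :: "rrec_instance \<Rightarrow> int list \<Rightarrow> bool" where
  "rrec_solution I out \<longleftrightarrow>
     (let n = num_items I; p = num_selected I; k = recovery I;
          C = (\<lambda>i. real_of_rat (first_cost I i));
          cl = (\<lambda>i. real_of_rat (lower_cost I i));
          cu = (\<lambda>i. real_of_rat (upper_cost I i));
          \<Gamma> = real_of_rat (budget I)
      in \<exists>x\<in>selections n p. \<exists>a b :: int.
           out = map (\<lambda>i. int (x i)) [1..<n + 1] @ [a, b] \<and>
           rrec_cost n p k C cl cu \<Gamma> x = rrec_opt n p k C cl cu \<Gamma> \<and>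
           b > 0 \<and> real_of_int a / real_of_int b = rrec_opt n p k C cl cu \<Gamma>)"

end

theory Submission
  imports Defs
begin

text \<open>
  Dualising the adversary for a fixed first-stage selection turns the inner max-min problem into
  the minimum over \<open>\<pi> \<in> [0, 1]\<close> and fractional recovery solutions \<open>y\<close> of
  \<open>\<Sum> cl i * y i + \<Gamma> * \<pi> + \<Sum> (cu i - cl i) * max 0 (y i - \<pi>)\<close>. The dual has only two variables, the
  prices \<open>A \<le> B\<close> of items outside and inside the selection, and its objective is the minimum of
  two concave functions whose one-sided slopes are integers. The multiplier \<open>\<pi>\<close> is determined by
  balancing such slopes, so it can be taken of the form \<open>u / v\<close> with \<open>u \<le> v \<le> n\<close>, and then all \<open>y i\<close>
  are multiples of \<open>1 / v\<close>.

  For each \<open>(u, v)\<close> the joint choice of \<open>x i\<close> and \<open>j i = v * y i\<close> for all items is a multiple-choice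
  knapsack problem of polynomial size: item \<open>i\<close> has weight \<open>x * R^2 + j * R + x * (v - j)\<close>, and since
  no digit overflows in the radix \<open>R\<close>, a bound on the total weight expresses the cardinality and
  recovery constraints. All data are scaled to integers divisible by \<open>2^n * v\<close>; adding
  \<open>2^(i - 1)\<close> to the first-stage cost of item \<open>i\<close> records the selection in the low-order bits of the
  optimal value.
\<close>

section \<open>Duality for the adversarial problem\<close>

text \<open>The two concave functions arise as follows. For fixed prices, raising the cost of an
  item gains one unit of the dual per unit of budget until the cost meets the price or its upper
  bound. After optimising over the costs the dual is therefore min (h1 + \<Gamma>) h2, where h1 and
  h2 are \<open>dual_value\<close> for \<open>cl\<close> and \<open>cu\<close>. At a maximizer some
  convex combination of h1 and h2 has no feasible direction of ascent, and the weight of h1 is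
  \<pi>. Six integer directions suffice to express this; per item the slopes of h1 and h2 differ in
  the critical sense by at most one, whence the denominator bound n.

  The shape of the program is dictated by the machine model. Running times are derived only for
  loops with loop-free bodies, so nested iteration becomes one counter that is decoded into
  mixed-radix digits, and a table entry may refer to boundedly many earlier entries only. Reading
  the selection off the bits of the optimum replaces storing or retracing the choices.\<close>

definition threshold :: "(nat \<Rightarrow> nat) \<Rightarrow> 'a::comm_ring_1 \<Rightarrow> 'a \<Rightarrow> nat \<Rightarrow> 'a" where
  "threshold x A B i = A + (B - A) * of_nat (x i)"

text \<open>The linear programming dual of minimising the cost of y under total p, recovery bound p
  - k and 0 \<le> y \<le> 1: \<open>A\<close> belongs to the total, \<open>B - A\<close> to the
  recovery bound, and the multipliers of y \<le> 1 are eliminated into the positive parts.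
  \<open>threshold\<close> is polymorphic because it is evaluated at integer directions as
  well.\<close>

definition dual_value ::
  "nat \<Rightarrow> nat \<Rightarrow> nat \<Rightarrow> (nat \<Rightarrow> nat) \<Rightarrow> (nat \<Rightarrow> real) \<Rightarrow> real \<Rightarrow> real \<Rightarrow> real" where
  "dual_value n p k x c A B =
     real p * A + real (p - k) * (B - A) - (\<Sum>i = 1..n. max 0 (threshold x A B i - c i))"

text \<open>The vector \<open>j / v\<close> is a fractional recovery solution.\<close>

definition fractional_recovery :: "nat \<Rightarrow> nat \<Rightarrow> nat \<Rightarrow> (nat \<Rightarrow> nat) \<Rightarrow> nat \<Rightarrow> (nat \<Rightarrow> nat) set" where
  "fractional_recovery n p k x v =
     {j. (\<forall>i\<in>{1..n}. j i \<le> v) \<and> (\<Sum>i = 1..n. j i) = p * v \<and> (p - k) * v \<le> (\<Sum>i = 1..n. x i * j i)}"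

text \<open>The objective of the overview at \<pi> = u / v and y = j / v, multiplied by v, which
  then cancels. Equivalently, item i is bought in \<open>j i\<close> units, the first u of them at
  \<open>cl i\<close> and the others at \<open>cu i\<close>.\<close>

definition robust_value ::
  "nat \<Rightarrow> (nat \<Rightarrow> real) \<Rightarrow> (nat \<Rightarrow> real) \<Rightarrow> real \<Rightarrow> nat \<Rightarrow> (nat \<Rightarrow> nat) \<Rightarrow> real" where
  "robust_value n cl cu \<Gamma> u j =
     (\<Sum>i = 1..n. cl i * real (j i) + (cu i - cl i) * max 0 (real (j i) - real u)) + \<Gamma> * real u"

lemma selectionsD:
  assumes "x \<in> selections n p"
  shows "i \<in> {1..n} \<Longrightarrow> x i = 0 \<or> x i = 1" "(\<Sum>i = 1..n. x i) = p"
  using assms by (auto simp: selections_def PiE_def Pi_def)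

lemma sum_threshold:
  assumes "(\<Sum>i = 1..n. x i) = p"
  shows "(\<Sum>i = 1..n. threshold x A B i) = of_nat n * A + of_nat p * (B - A)"
proof -
  have "(\<Sum>i = 1..n. threshold x A B i) = of_nat n * A + (B - A) * of_nat (\<Sum>i = 1..n. x i)"
    by (simp add: threshold_def sum.distrib sum_distrib_left)
  then show ?thesis by (simp only: assms mult.commute)
qed

text \<open>Weak duality, scaled by v. \<open>A \<le> B\<close> gives the recovery bound a
  multiplier of the right sign, and \<open>j i \<le> v\<close> caps the surplus of item i by v times
  its positive part.\<close>

lemma dual_value_le:
  assumes j: "j \<in> fractional_recovery n p k x v" and "A \<le> B"
  shows "real v * dual_value n p k x c A B \<le> (\<Sum>i = 1..n. c i * real (j i))"
proof -
  let ?t = "threshold x A B"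
  have jv: "\<And>i. i \<in> {1..n} \<Longrightarrow> j i \<le> v" and sj: "(\<Sum>i = 1..n. j i) = p * v"
    and sx: "(p - k) * v \<le> (\<Sum>i = 1..n. x i * j i)"
    using j by (auto simp: fractional_recovery_def)
  have "(\<Sum>i = 1..n. ?t i * real (j i)) = A * real (\<Sum>i = 1..n. j i) + (B - A) * real (\<Sum>i = 1..n. x
      i * j i)"
  proof -
    have "(\<Sum>i = 1..n. ?t i * real (j i)) = (\<Sum>i = 1..n. A * real (j i) + (B - A) * real (x i * j i))"
      by (simp add: threshold_def algebra_simps)
    then show ?thesis by (simp add: sum.distrib sum_distrib_left)
  qed
  moreover have "(B - A) * real ((p - k) * v) \<le> (B - A) * real (\<Sum>i = 1..n. x i * j i)"
    using sx \<open>A \<le> B\<close> by (intro mult_left_mono) (auto simp only: of_nat_le_iff)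
  ultimately have "A * real (p * v) + (B - A) * real ((p - k) * v) \<le> (\<Sum>i = 1..n. ?t i * real (j i))"
    unfolding sj by linarith
  then have "A * (real p * real v) + (B - A) * (real (p - k) * real v) \<le> (\<Sum>i = 1..n. ?t i * real
      (j i))"
    by (simp only: of_nat_mult)
  moreover have "(\<Sum>i = 1..n. ?t i * real (j i) - real v * max 0 (?t i - c i)) \<le> (\<Sum>i = 1..n. c i *
      real (j i))"
  proof (rule sum_mono)
    fix i assume "i \<in> {1..n}"
    then have "real (j i) * (?t i - c i) \<le> real v * max 0 (?t i - c i)"
      using jv[of i] by (intro order.trans[OF mult_left_mono[of "?t i - c i" "max 0 (?t i - c
          i)"]] mult_right_mono) auto
    then show "?t i * real (j i) - real v * max 0 (?t i - c i) \<le> c i * real (j i)"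
      by (simp add: algebra_simps)
  qed
  ultimately show ?thesis
    by (simp add: dual_value_def sum_subtractf sum_distrib_left[symmetric] algebra_simps)
qed

section \<open>Right derivatives of the dual objective\<close>

definition slope :: "real \<Rightarrow> int \<Rightarrow> int" where
  "slope z w = (if z > 0 then w else if z < 0 then 0 else max 0 w)"

text \<open>The derivative of \<open>dual_value\<close> at (A, B) in direction (a, b). It is an
  integer because \<open>slope\<close> looks only at the sign of the gap between price and
  cost.\<close>

definition dual_slope ::
  "nat \<Rightarrow> nat \<Rightarrow> nat \<Rightarrow> (nat \<Rightarrow> nat) \<Rightarrow> (nat \<Rightarrow> real) \<Rightarrow> real \<Rightarrow> real \<Rightarrow> int \<Rightarrow> int \<Rightarrow> int" where
  "dual_slope n p k x c A B a b =
     int p * a + int (p - k) * (b - a) - (\<Sum>i = 1..n. slope (threshold x A B i - c i) (threshold x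
         a b i))"

text \<open>Piecewise linearity makes the first-order expansion exact for all small t > 0, so no
  error term has to be controlled in the optimality conditions.\<close>

lemma slope_eventually:
  "\<forall>\<^sub>F t in at_right 0. max 0 (z + t * real_of_int w) = max 0 z + t * real_of_int (slope z w)"
proof -
  have t0: "\<forall>\<^sub>F t in at_right (0::real). t > 0"
    by (simp add: eventually_at_right_less)
  have lim: "((\<lambda>t. z + t * real_of_int w) \<longlongrightarrow> z) (at_right 0)"
    by (auto intro!: tendsto_eq_intros)
  consider "z > 0" | "z < 0" | "z = 0" by linarith
  then show ?thesis
  proof cases
    case 1
    show ?thesis
      using order_tendstoD(1)[OF lim 1] by eventually_elim (use 1 in \<open>simp add: slope_def\<close>)
  next
    case 2
    show ?thesis
      using order_tendstoD(2)[OF lim 2] by eventually_elim (use 2 in \<open>simp add: slope_def\<close>)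
  next
    case 3
    show ?thesis
      using t0 by eventually_elim (use 3 in \<open>auto simp: slope_def max_def zero_le_mult_iff
          mult_le_0_iff\<close>)
  qed
qed

lemma dual_slope_eventually:
  "\<forall>\<^sub>F t in at_right 0. dual_value n p k x c (A + t * real_of_int a) (B + t * real_of_int b) =
     dual_value n p k x c A B + t * real_of_int (dual_slope n p k x c A B a b)"
proof -
  let ?z = "\<lambda>i. threshold x A B i - c i"
  have "\<forall>\<^sub>F t in at_right 0. \<forall>i\<in>{1..n}. max 0 (?z i + t * real_of_int (threshold x a b i)) =
      max 0 (?z i) + t * real_of_int (slope (?z i) (threshold x a b i))"
    by (intro eventually_ball_finite ballI slope_eventually) simp
  then show ?thesis
  proof eventually_elim
    case (elim t)
    have *: "threshold x (A + t * real_of_int a) (B + t * real_of_int b) i - c i =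
        ?z i + t * real_of_int (threshold x a b i)" for i
      by (simp add: threshold_def algebra_simps)
    have "(\<Sum>i = 1..n. max 0 (threshold x (A + t * real_of_int a) (B + t * real_of_int b) i - c i)) =
        (\<Sum>i = 1..n. max 0 (?z i) + t * real_of_int (slope (?z i) (threshold x a b i)))"
      unfolding * using elim by (intro sum.cong) auto
    then show ?case
      by (simp add: dual_value_def dual_slope_def sum.distrib sum_distrib_left algebra_simps)
  qed
qed

lemma slope_add_le:
  assumes "l \<ge> 0" "m \<ge> 0"
  shows "slope z (l * a + m * b) \<le> l * slope z a + m * slope z b"
proof -
  have "l * a \<le> l * max 0 a" "m * b \<le> m * max 0 b" "0 \<le> l * max 0 a" "0 \<le> m * max 0 b"
    using assms by (auto intro: mult_left_mono)
  then show ?thesis by (auto simp: slope_def)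
qed

text \<open>Directional derivatives of a concave function are superlinear under nonnegative
  combinations. Thus a combination of slopes of two directions is bounded by the slope of a single
  direction, to which the optimality condition of the maximizer applies.\<close>

lemma dual_slope_add_ge:
  assumes "l \<ge> 0" "m \<ge> 0"
  shows "l * dual_slope n p k x c A B a b + m * dual_slope n p k x c A B a' b' \<le>
     dual_slope n p k x c A B (l * a + m * a') (l * b + m * b')"
proof -
  let ?z = "\<lambda>i. threshold x A B i - c i"
  have "threshold x (l * a + m * a') (l * b + m * b') i = l * threshold x a b i + m * threshold x
      a' b' i" for i
    by (simp add: threshold_def algebra_simps)
  then have "(\<Sum>i = 1..n. slope (?z i) (threshold x (l * a + m * a') (l * b + m * b') i)) \<le>
      (\<Sum>i = 1..n. l * slope (?z i) (threshold x a b i) + m * slope (?z i) (threshold x a' b' i))"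
    by (intro sum_mono) (use slope_add_le[OF assms] in simp)
  then show ?thesis
    by (simp add: dual_slope_def sum.distrib sum_distrib_left algebra_simps)
qed

text \<open>Lifting negative prices to 0 leaves the positive parts alone, since costs are
  nonnegative. Above M every positive part is active, so an excess (a, b) with a \<le> b earns k a +
  (p - k) b but costs (n - p) a + p b, which is at least as much.\<close>

lemma dual_value_clamp_le:
  assumes x: "\<And>i. i \<in> {1..n} \<Longrightarrow> x i = 0 \<or> x i = 1" "(\<Sum>i = 1..n. x i) = p" and "k \<le> p" "p \<le> n"
    and c: "\<And>i. i \<in> {1..n} \<Longrightarrow> 0 \<le> c i \<and> c i \<le> M" and "A \<le> B"
  shows "dual_value n p k x c A B \<le> dual_value n p k x c (max 0 (min M A)) (max 0 (min M B))"
proof -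
  let ?A = "max 0 (min M A)" and ?B = "max 0 (min M B)"
  let ?a = "max 0 (A - M)" and ?b = "max 0 (B - M)"
  have M: "0 \<le> M" if "n > 0" using c[of 1] that by force
  show ?thesis
  proof (cases "n = 0")
    case True
    then show ?thesis using assms by (simp add: dual_value_def)
  next
    case False
    with M have M: "0 \<le> M" by simp
    have "(\<Sum>i = 1..n. max 0 (threshold x ?A ?B i - c i) + threshold x ?a ?b i) =
        (\<Sum>i = 1..n. max 0 (threshold x A B i - c i))"
    proof (rule sum.cong)
      fix i assume "i \<in> {1..n}"
      with x(1)[of i] c[of i] M
      show "max 0 (threshold x ?A ?B i - c i) + threshold x ?a ?b i = max 0 (threshold x A B i - c
          i)"
        by (auto simp: threshold_def max_def min_def)
    qed simp
    then have eq: "(\<Sum>i = 1..n. max 0 (threshold x A B i - c i)) =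
        (\<Sum>i = 1..n. max 0 (threshold x ?A ?B i - c i)) + (real n * ?a + real p * (?b - ?a))"
      using sum_threshold[OF x(2), of ?a ?b] by (simp only: sum.distrib)
    have k: "real p = real k + real (p - k)" and np: "real n = real p + real (n - p)"
      using assms by simp_all
    have "real k * A + real (p - k) * B - (real (n - p) * ?a + real p * ?b) \<le> real k * ?A + real
        (p - k) * ?B"
    proof -
      have 1: "A \<le> ?A + ?a" "B \<le> ?B + ?b" using M by auto
      have "real k * A \<le> real k * (?A + ?b)"
        using 1 \<open>A \<le> B\<close> by (intro mult_left_mono) auto
      moreover have "real (p - k) * B \<le> real (p - k) * (?B + ?b)"
        using 1 by (intro mult_left_mono) auto
      moreover have "0 \<le> real (n - p) * ?a" by simp
      ultimately show ?thesis unfolding k distrib_right distrib_left by linarith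
    qed
    then show ?thesis
      unfolding dual_value_def eq np k by (simp add: algebra_simps)
  qed
qed

text \<open>The cone of prices is not compact, but clamping moves every price pair into a triangle
  without lowering the objective, and there continuity yields a maximum. The sum of the upper costs
  serves as a common bound for all of them.\<close>

lemma dual_maximizer:
  assumes x: "\<And>i. i \<in> {1..n} \<Longrightarrow> x i = 0 \<or> x i = 1" "(\<Sum>i = 1..n. x i) = p" and "k \<le> p" "p \<le> n"
    and c: "\<And>i. i \<in> {1..n} \<Longrightarrow> 0 \<le> cl i \<and> cl i \<le> cu i"
  obtains A B where "A \<le> B" and
    "\<And>A' B'. A' \<le> B' \<Longrightarrow> min (dual_value n p k x cl A' B' + \<Gamma>) (dual_value n p k x cu A' B') \<le>
       min (dual_value n p k x cl A B + \<Gamma>) (dual_value n p k x cu A B)"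
proof -
  define M where "M = (\<Sum>i = 1..n. cu i)"
  have cu: "0 \<le> cu i" if "i \<in> {1..n}" for i using c[OF that] by simp
  have M: "cu i \<le> M" if "i \<in> {1..n}" for i
    unfolding M_def using that cu by (intro member_le_sum) auto
  have "0 \<le> M" unfolding M_def using cu by (intro sum_nonneg)
  let ?h = "\<lambda>A B. min (dual_value n p k x cl A B + \<Gamma>) (dual_value n p k x cu A B)"
  let ?T = "({0..M} \<times> {0..M}) \<inter> {z. fst z \<le> snd z}"
  have "compact ?T"
    by (intro compact_Int_closed compact_Times compact_Icc closed_Collect_le continuous_intros)
  moreover have "(0, 0) \<in> ?T" using \<open>0 \<le> M\<close> by simp
  moreover have "continuous_on ?T (\<lambda>z. ?h (fst z) (snd z))"
    unfolding dual_value_def threshold_def by (intro continuous_intros)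
  ultimately obtain z where z: "z \<in> ?T" "\<And>z'. z' \<in> ?T \<Longrightarrow> ?h (fst z') (snd z') \<le> ?h (fst z) (snd z)"
    using continuous_attains_sup[of ?T "\<lambda>z. ?h (fst z) (snd z)"] by blast
  have "?h A B \<le> ?h (fst z) (snd z)" if "A \<le> B" for A B
  proof -
    let ?A = "max 0 (min M A)" and ?B = "max 0 (min M B)"
    have "?h A B \<le> ?h ?A ?B"
      by (intro min.mono add_mono dual_value_clamp_le assms that order.refl)
        (use c M in \<open>force+\<close>)
    also have "\<dots> \<le> ?h (fst z) (snd z)"
      using z(2)[of "(?A, ?B)"] that \<open>0 \<le> M\<close> by (auto simp: max_def min_def)
    finally show ?thesis .
  qed
  with z(1) show thesis by (intro that[of "fst z" "snd z"]) auto
qed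


section \<open>First-order conditions at a dual maximizer\<close>

lemma eventually_at_right_combine:
  fixes h1 h2 d1 d2 :: real
  assumes "h1 < h2"
  shows "\<forall>\<^sub>F t in at_right 0. h1 + t * d1 < h2 + t * d2"
proof -
  have "((\<lambda>t. (h2 + t * d2) - (h1 + t * d1)) \<longlongrightarrow> h2 - h1) (at_right 0)"
    by (auto intro!: tendsto_eq_intros)
  from order_tendstoD(1)[OF this, of 0] assms show ?thesis by (auto elim: eventually_mono)
qed

text \<open>The disjunction on (a, b) says that a short step in this direction stays in the cone
  \<open>A \<le> B\<close>. A strictly smaller branch alone determines the minimum nearby; at a tie
  the minimum rises as soon as both branches rise.\<close>

lemma maximizer_slopes:
  assumes AB: "A \<le> B" and ab: "a \<le> b \<or> A < B"
    and max: "\<And>A' B'. A' \<le> B' \<Longrightarrow> min (dual_value n p k x cl A' B' + \<Gamma>) (dual_value n p k x cu A'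
        B') \<le>
       min (dual_value n p k x cl A B + \<Gamma>) (dual_value n p k x cu A B)"
  defines "h1 \<equiv> dual_value n p k x cl A B + \<Gamma>" and "h2 \<equiv> dual_value n p k x cu A B"
    and "d1 \<equiv> dual_slope n p k x cl A B a b" and "d2 \<equiv> dual_slope n p k x cu A B a b"
  shows "h1 < h2 \<Longrightarrow> d1 \<le> 0" "h2 < h1 \<Longrightarrow> d2 \<le> 0" "\<not> (d1 > 0 \<and> d2 > 0)"
proof -
  let ?A = "\<lambda>t. A + t * real_of_int a" and ?B = "\<lambda>t. B + t * real_of_int b"
  have t0: "\<forall>\<^sub>F t in at_right (0::real). t > 0"
    by (simp add: eventually_at_right_less)
  have le: "\<forall>\<^sub>F t in at_right 0. ?A t \<le> ?B t"
  proof (cases "A < B")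
    case True
    show ?thesis
      using eventually_at_right_combine[OF True, of "real_of_int a" "real_of_int b"]
      by eventually_elim simp
  next
    case False
    then have "A = B" "a \<le> b" using AB ab by auto
    with t0 show ?thesis by (auto elim!: eventually_mono intro!: mult_left_mono)
  qed
  have "\<forall>\<^sub>F t in at_right 0. t > 0 \<and> min (h1 + t * real_of_int d1) (h2 + t * real_of_int d2) \<le> min
      h1 h2"
    using t0 le dual_slope_eventually[of n p k x cl A a B b] dual_slope_eventually[of n p k x cu A
        a B b]
  proof eventually_elim
    case (elim t)
    then show ?case
      using max[OF elim(2)] by (simp add: h1_def h2_def d1_def d2_def add_ac)
  qed
  note ev = this
  show "d1 \<le> 0" if "h1 < h2"
  proof (rule ccontr)
    assume "\<not> d1 \<le> 0"
    have "\<forall>\<^sub>F t in at_right 0. t * real_of_int d1 \<le> 0 \<and> t > 0"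
      using ev eventually_at_right_combine[OF that, of "real_of_int d1" "real_of_int d2"]
      by eventually_elim (use that in auto)
    then obtain t where "t * real_of_int d1 \<le> 0" "t > 0"
      using eventually_happens'[OF trivial_limit_at_right_real] by blast
    with \<open>\<not> d1 \<le> 0\<close> show False by (simp add: mult_le_0_iff)
  qed
  show "d2 \<le> 0" if "h2 < h1"
  proof (rule ccontr)
    assume "\<not> d2 \<le> 0"
    have "\<forall>\<^sub>F t in at_right 0. t * real_of_int d2 \<le> 0 \<and> t > 0"
      using ev eventually_at_right_combine[OF that, of "real_of_int d2" "real_of_int d1"]
      by eventually_elim (use that in auto)
    then obtain t where "t * real_of_int d2 \<le> 0" "t > 0"
      using eventually_happens'[OF trivial_limit_at_right_real] by blast
    with \<open>\<not> d2 \<le> 0\<close> show False by (simp add: mult_le_0_iff)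
  qed
  show "\<not> (d1 > 0 \<and> d2 > 0)"
  proof
    assume d: "d1 > 0 \<and> d2 > 0"
    obtain t where t: "t > 0" "min (h1 + t * real_of_int d1) (h2 + t * real_of_int d2) \<le> min h1 h2"
      using eventually_happens'[OF trivial_limit_at_right_real ev] by blast
    have "t * real_of_int d1 > 0" "t * real_of_int d2 > 0" using t d by simp_all
    with t(2) show False by linarith
  qed
qed

text \<open>Helly's theorem on the line: each element of \<open>E\<close> restricts \<open>u / v\<close> to an interval, any two of these
  intervals meet, and the endpoints have denominators at most \<open>n\<close>.\<close>

lemma balancing_fraction:
  fixes E :: "(int \<times> int) set"
  assumes "finite E" "n \<ge> 1" and diff: "\<And>e. e \<in> E \<Longrightarrow> snd e - fst e \<le> int n"
    and nonpos: "\<And>e e' l m. e \<in> E \<Longrightarrow> e' \<in> E \<Longrightarrow> l \<ge> 0 \<Longrightarrow> m \<ge> 0 \<Longrightarrow>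
       \<not> (l * fst e + m * fst e' > 0 \<and> l * snd e + m * snd e' > 0)"
  obtains u v where "1 \<le> v" "v \<le> n" "u \<le> v"
    "\<forall>e\<in>E. int u * fst e + int (v - u) * snd e \<le> 0"
proof (cases "\<forall>e\<in>E. snd e \<le> 0")
  case True
  \<comment> \<open>No second slope is positive, so all weight can go to the second function: u = 0
    and v = 1.\<close>
  then show thesis using assms(2) by (intro that[of 1 0]) auto
next
  case False
  define F where "F = {e\<in>E. snd e > 0}"
  \<comment> \<open>An element with positive second slope demands u / v to be at least this
    quotient. The largest demand is taken as u / v, with numerator and denominator
    unreduced.\<close>
  let ?f = "\<lambda>e. real_of_int (snd e) / real_of_int (snd e - fst e)"
  have F: "finite (?f ` F)" "?f ` F \<noteq> {}" using False assms(1) by (fastforce simp: F_def)+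
  from Max_in[OF F] obtain m where m: "m \<in> F" "Max (?f ` F) = ?f m" by auto
  have mx: "?f e \<le> ?f m" if "e \<in> F" for e
    using Max_ge[OF F(1), of "?f e"] that m(2) by auto
  have neg: "fst e \<le> 0" if "e \<in> F" for e
    using nonpos[of e e 1 0] that by (auto simp: F_def)
  obtain e1 e2 where e12: "m = (e1, e2)" by fastforce
  have e: "e2 > 0" "e1 \<le> 0" "(e1, e2) \<in> E" using m neg[OF m(1)] by (auto simp: F_def e12)
  have uv: "int (nat e2) = e2" "int (nat (e2 - e1) - nat e2) = - e1" using e by auto
  show thesis
  proof (rule that)
    show "1 \<le> nat (e2 - e1)" "nat e2 \<le> nat (e2 - e1)" using e by auto
    show "nat (e2 - e1) \<le> n" using diff[OF e(3)] by simp
    show "\<forall>d\<in>E. int (nat e2) * fst d + int (nat (e2 - e1) - nat e2) * snd d \<le> 0"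
    proof
      fix d assume d: "d \<in> E"
      obtain d1 d2 where d12: "d = (d1, d2)" by fastforce
      have "e2 * d1 - e1 * d2 \<le> 0"
      proof (cases "d2 > 0")
        case True
        then have dF: "d \<in> F" using d by (simp add: F_def d12)
        have "d1 \<le> 0" using neg[OF dF] by (simp add: d12)
        then have "real_of_int d2 * real_of_int (e2 - e1) \<le> real_of_int e2 * real_of_int (d2 - d1)"
          using mx[OF dF] e True by (simp add: d12 e12 field_simps)
        then show ?thesis by (simp only: of_int_mult[symmetric] of_int_le_iff) (simp add:
            algebra_simps)
      next
        case d2: False
        show ?thesis
        proof (cases "d1 > 0")
          case False
          then show ?thesis using e d2 mult_nonneg_nonpos[of e2 d1] mult_nonpos_nonpos[of e1 d2]
              by linarith
        next
          case True
          show ?thesis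
          proof (rule ccontr)
            assume "\<not> ?thesis"
            \<comment> \<open>With these two multipliers both coordinates of the combination equal
              e2 * d1 - e1 * d2, so positivity of that number contradicts the hypothesis on
              pairs.\<close>
            then have "(d1 - d2) * e1 + (e2 - e1) * d1 > 0 \<and> (d1 - d2) * e2 + (e2 - e1) * d2 > 0"
              by (simp add: algebra_simps)
            moreover have "d1 - d2 \<ge> 0" "e2 - e1 \<ge> 0" using True d2 e by auto
            ultimately show False
              using nonpos[OF e(3) d, of "d1 - d2" "e2 - e1"] by (simp add: d12)
          qed
        qed
      qed
      then show "int (nat e2) * fst d + int (nat (e2 - e1) - nat e2) * snd d \<le> 0"
        unfolding uv d12 by simp
    qed
  qed
qed

section \<open>Complementary slackness and strong duality\<close>

lemma sum_interpolation:
  fixes lo hi :: "'a \<Rightarrow> nat"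
  assumes "finite I" "\<And>i. i \<in> I \<Longrightarrow> lo i \<le> hi i" "sum lo I \<le> s" "s \<le> sum hi I"
  shows "\<exists>j. (\<forall>i\<in>I. lo i \<le> j i \<and> j i \<le> hi i) \<and> sum j I = s"
  using assms
proof (induction I arbitrary: s rule: finite_induct)
  case (insert a I)
  \<comment> \<open>The most that \<open>a\<close> can take while the lower bounds of the other
    indices remain affordable.\<close>
  define r where "r = min (hi a) (s - sum lo I)"
  have le: "sum lo I \<le> sum hi I" using insert.prems by (intro sum_mono) auto
  have "lo a \<le> r" "r \<le> hi a" "r \<le> s" "sum lo I \<le> s - r" "s - r \<le> sum hi I"
    using insert.prems(1)[of a] insert.prems(2,3) insert.hyps le by (auto simp: r_def)
  moreover from this insert.IH[of "s - r"] insert.prems obtain j where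
    "\<forall>i\<in>I. lo i \<le> j i \<and> j i \<le> hi i" "sum j I = s - r" by auto
  moreover have "sum (j(a := r)) I = sum j I"
    using insert.hyps by (intro sum.cong) auto
  ultimately show ?case
    using insert.hyps by (intro exI[of _ "j(a := r)"]) auto
qed auto


text \<open>Complementary slackness for u * h1 + (v - u) * h2. Item i consists of u units of cost
  \<open>cl i\<close> and v - u units of cost \<open>cu i\<close>; units cheaper than the price must
  be bought, units at the price may be. This is the interval from \<open>lo i\<close> to
  \<open>hi i\<close>, and the slope conditions say that it can be filled to the required
  totals.\<close>

lemma balanced_recovery:
  assumes x: "\<And>i. i \<in> {1..n} \<Longrightarrow> x i = 0 \<or> x i = 1" "(\<Sum>i = 1..n. x i) = p" and "k \<le> p"
    and c: "\<And>i. i \<in> {1..n} \<Longrightarrow> cl i \<le> cu i" and "A \<le> B" "u \<le> v"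
    and slopes: "\<And>a b. (a, b) \<in> {(-1, 0), (1, 0), (0, -1), (0, 1), (1, 1), (-1, -1)} \<Longrightarrow> a \<le> b \<or> A <
        B \<Longrightarrow>
       int u * dual_slope n p k x cl A B a b + int (v - u) * dual_slope n p k x cu A B a b \<le> 0"
  obtains j where "j \<in> fractional_recovery n p k x v"
    "robust_value n cl cu \<Gamma> u j =
       real u * (dual_value n p k x cl A B + \<Gamma>) + real (v - u) * dual_value n p k x cu A B"
proof -
  let ?t = "threshold x A B"
  define lo where "lo = (\<lambda>i. (if cl i < ?t i then u else 0) + (if cu i < ?t i then v - u else 0))"
  define hi where "hi = (\<lambda>i. (if cl i \<le> ?t i then u else 0) + (if cu i \<le> ?t i then v - u else 0))"
  define N where "N = {i\<in>{1..n}. x i = 0}"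
  define X where "X = {i\<in>{1..n}. x i = 1}"
  have split: "sum f {1..n} = sum f N + sum f X" for f :: "nat \<Rightarrow> 'b::comm_monoid_add"
  proof -
    have "{1..n} = N \<union> X" unfolding N_def X_def using x(1) by blast
    moreover have "N \<inter> X = {}" "finite N" "finite X" by (auto simp: N_def X_def)
    ultimately show ?thesis by (simp add: sum.union_disjoint)
  qed
  have fin: "finite N" "finite X" by (auto simp: N_def X_def)
  have lohi: "lo i \<le> hi i" "hi i \<le> v" for i using \<open>u \<le> v\<close> by (auto simp: lo_def hi_def)
  have loN: "sum lo N \<le> sum hi N" and loX: "sum lo X \<le> sum hi X"
    by (intro sum_mono lohi)+
  \<comment> \<open>The combined slope of the positive parts of item i when its price moves by w: a
    rising price activates the units in \<open>hi i\<close>, a falling one deactivates those in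
    \<open>lo i\<close>.\<close>
  define G where "G = (\<lambda>(w::int) i. if w = 1 then int (hi i) else if w = -1 then - int (lo i) else
      (0::int))"
  have G: "int u * slope (?t i - cl i) w + int (v - u) * slope (?t i - cu i) w = G w i"
    if "w \<in> {-1, 0, 1}" for w i
    using that \<open>u \<le> v\<close> by (auto simp: slope_def G_def lo_def hi_def)
  have comb: "int u * dual_slope n p k x cl A B a b + int (v - u) * dual_slope n p k x cu A B a b =
      int v * (int p * a + int (p - k) * (b - a)) - (sum (G a) N + sum (G b) X)"
    if "a \<in> {-1, 0, 1}" "b \<in> {-1, 0, 1}" for a b
  proof -
    have G_sum: "(\<Sum>i = 1..n. int u * slope (?t i - cl i) (threshold x a b i) +
        int (v - u) * slope (?t i - cu i) (threshold x a b i)) = sum (G a) N + sum (G b) X"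
    proof -
      have "threshold x a b i = a" if "i \<in> N" for i using that by (simp add: N_def threshold_def)
      moreover have "threshold x a b i = b" if "i \<in> X" for i using that by (simp add: X_def
          threshold_def)
      ultimately show ?thesis
        unfolding split by (intro arg_cong2[of _ _ _ _ "(+)"] sum.cong) (simp_all only: G that)
    qed
    have v: "int v = int u + int (v - u)" using \<open>u \<le> v\<close> by simp
    have "q * (r - s) + q' * (r - s') = (q + q') * r - (q * s + q' * s')" for q q' r s s' :: int
      by (simp add: algebra_simps)
    then show ?thesis
      unfolding dual_slope_def G_sum[symmetric] sum.distrib sum_distrib_left[symmetric] v .
  qed
  have kp: "int (p - k) = int p - int k" using \<open>k \<le> p\<close> by simp
  have G1: "sum (G (-1)) Y = - int (sum lo Y)" "sum (G 0) Y = 0" "sum (G 1) Y = int (sum hi Y)"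
      for Y
    by (simp_all add: G_def sum_negf)
  \<comment> \<open>Each direction gives one inequality. The four used here and below satisfy a
    \<le> b, so they are available at every maximizer.\<close>
  have "int (sum lo N) \<le> int k * int v"
    using slopes[of "-1" 0] comb[of "-1" 0] by (simp add: G1 kp algebra_simps)
  then have c1: "sum lo N \<le> k * v" by (simp only: of_nat_mult[symmetric] of_nat_le_iff)
  have "int (p - k) * int v \<le> int (sum hi X)"
    using slopes[of 0 1] comb[of 0 1] by (simp add: G1 algebra_simps)
  then have c2: "(p - k) * v \<le> sum hi X" by (simp only: of_nat_mult[symmetric] of_nat_le_iff)
  have "int p * int v \<le> int (sum hi N + sum hi X)"
    using slopes[of 1 1] comb[of 1 1] by (simp add: G1 algebra_simps)
  then have c3: "p * v \<le> sum hi N + sum hi X" by (simp only: of_nat_mult[symmetric] of_nat_le_iff)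
  have "int (sum lo N + sum lo X) \<le> int p * int v"
    using slopes[of "-1" "-1"] comb[of "-1" "-1"] by (simp add: G1 algebra_simps)
  then have c4: "sum lo N + sum lo X \<le> p * v" by (simp only: of_nat_mult[symmetric] of_nat_le_iff)
  have pv: "p * v = k * v + (p - k) * v" using \<open>k \<le> p\<close> by (simp add: add_mult_distrib[symmetric])
  \<comment> \<open>For \<open>A < B\<close> the recovery bound has a positive multiplier and must
    be tight; exactly then the directions (1, 0) and (0, -1) are feasible and provide the two
    missing inequalities.\<close>
  obtain sN sX where s: "sN + sX = p * v" "(p - k) * v \<le> sX" "sum lo N \<le> sN" "sN \<le> sum hi N"
    "sum lo X \<le> sX" "sX \<le> sum hi X" "A < B \<Longrightarrow> sX = (p - k) * v"
  proof (cases "A < B")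
    case True
    have "int k * int v \<le> int (sum hi N)"
      using slopes[of 1 0] comb[of 1 0] True by (simp add: G1 kp algebra_simps)
    then have "k * v \<le> sum hi N" by (simp only: of_nat_mult[symmetric] of_nat_le_iff)
    moreover have "int (sum lo X) \<le> int (p - k) * int v"
      using slopes[of 0 "-1"] comb[of 0 "-1"] True by (simp add: G1 algebra_simps)
    then have "sum lo X \<le> (p - k) * v" by (simp only: of_nat_mult[symmetric] of_nat_le_iff)
    ultimately show ?thesis using c1 c2 pv by (intro that[of "k * v" "(p - k) * v"]) auto
  next
    case False
    \<comment> \<open>For \<open>A = B\<close> the split is free: X takes as much as its own bound
      and the lower bound of N permit.\<close>
    define sX where "sX = min (sum hi X) (p * v - sum lo N)"
    show ?thesis
      by (rule that[of "p * v - sX" sX]) (use False c1 c2 c3 c4 pv loN loX in \<open>auto simp: sX_def\<close>)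
  qed
  obtain jN where jN: "\<And>i. i \<in> N \<Longrightarrow> lo i \<le> jN i \<and> jN i \<le> hi i" "sum jN N = sN"
    using sum_interpolation[OF fin(1) lohi(1) s(3,4)] by blast
  obtain jX where jX: "\<And>i. i \<in> X \<Longrightarrow> lo i \<le> jX i \<and> jX i \<le> hi i" "sum jX X = sX"
    using sum_interpolation[OF fin(2) lohi(1) s(5,6)] by blast
  define j where "j = (\<lambda>i. if x i = 0 then jN i else jX i)"
  have jN': "sum j N = sN" unfolding jN(2)[symmetric] by (rule sum.cong) (auto simp: j_def N_def)
  have jX': "sum j X = sX" unfolding jX(2)[symmetric] by (rule sum.cong) (auto simp: j_def X_def)
  have j: "lo i \<le> j i" "j i \<le> hi i" if "i \<in> {1..n}" for i
    using that x(1)[OF that] jN(1)[of i] jX(1)[of i] by (auto simp: j_def N_def X_def)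
  have sj: "(\<Sum>i = 1..n. j i) = p * v" unfolding split jN' jX' by (rule s(1))
  have sxj: "(\<Sum>i = 1..n. x i * j i) = sX"
  proof -
    have "(\<Sum>i\<in>N. x i * j i) = 0" by (simp add: N_def)
    moreover have "(\<Sum>i\<in>X. x i * j i) = sX" unfolding jX'[symmetric] by (rule sum.cong) (auto simp:
        X_def)
    ultimately show ?thesis unfolding split by simp
  qed
  show thesis
  proof
    show "j \<in> fractional_recovery n p k x v"
      using j lohi order.trans sj sxj s(2) unfolding fractional_recovery_def by blast
    \<comment> \<open>Between \<open>lo i\<close> and \<open>hi i\<close> the bought units cost
      their price minus the full dual surplus, so no duality gap remains at item i.\<close>
    have "cl i * real (j i) + (cu i - cl i) * max 0 (real (j i) - real u) =
        ?t i * real (j i) - (real u * max 0 (?t i - cl i) + real (v - u) * max 0 (?t i - cu i))"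
      if i: "i \<in> {1..n}" for i
    proof -
      consider "?t i < cl i" | "?t i = cl i" "cl i < cu i" | "cl i < ?t i" "?t i < cu i"
        | "cl i < cu i" "?t i = cu i" | "cu i < ?t i" | "cl i = ?t i" "cu i = ?t i"
        using c[OF i] by linarith
      then show ?thesis
        using j[OF i] c[OF i] \<open>u \<le> v\<close>
        by cases (auto simp: lo_def hi_def max_def of_nat_diff algebra_simps split: if_splits)
    qed
    then have "robust_value n cl cu \<Gamma> u j = (\<Sum>i = 1..n. ?t i * real (j i) -
        (real u * max 0 (?t i - cl i) + real (v - u) * max 0 (?t i - cu i))) + \<Gamma> * real u"
      unfolding robust_value_def by (intro arg_cong2[of _ _ _ _ "(+)"] sum.cong) auto
    also have "\<dots> = (\<Sum>i = 1..n. ?t i * real (j i)) - (real u * (\<Sum>i = 1..n. max 0 (?t i - cl i)) +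
        real (v - u) * (\<Sum>i = 1..n. max 0 (?t i - cu i))) + \<Gamma> * real u"
      by (simp only: sum_subtractf sum.distrib sum_distrib_left)
    also have "(\<Sum>i = 1..n. ?t i * real (j i)) = A * (real p * real v) + (B - A) * (real (p - k) *
        real v)"
    proof -
      have "(\<Sum>i = 1..n. ?t i * real (j i)) = (\<Sum>i = 1..n. A * real (j i) + (B - A) * real (x i * j
          i))"
        by (simp add: threshold_def algebra_simps)
      also have "\<dots> = A * real (\<Sum>i = 1..n. j i) + (B - A) * real (\<Sum>i = 1..n. x i * j i)"
        by (simp add: sum.distrib sum_distrib_left)
      also have "(B - A) * real (\<Sum>i = 1..n. x i * j i) = (B - A) * real ((p - k) * v)"
        using s(7) \<open>A \<le> B\<close> unfolding sxj by (cases "A < B") auto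
      finally show ?thesis unfolding sj by (simp only: of_nat_mult)
    qed
    also have "real v = real u + real (v - u)" using \<open>u \<le> v\<close> by simp
    finally show "robust_value n cl cu \<Gamma> u j =
       real u * (dual_value n p k x cl A B + \<Gamma>) + real (v - u) * dual_value n p k x cu A B"
      by (simp add: dual_value_def algebra_simps)
  qed
qed

text \<open>This gap of one per item is the source of the bound v \<le> n: summed over the items it
  bounds the denominators in \<open>balancing_fraction\<close>.\<close>

lemma slope_bounds:
  assumes "cl \<le> cu" "w \<in> {-1, 0, 1}"
  shows "slope (z - cl) w - slope (z - cu) w \<le> 1"
  using assms by (auto simp: slope_def)

text \<open>The balanced combination of the two branches has equal primal and dual values, and its
  weights make the combination collapse to the minimum of the branches. The last clause is
  integrality: for a single cost vector the denominator is 1, so the primal solution is a 0/1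
  vector.\<close>

lemma strong_duality:
  assumes x: "\<And>i. i \<in> {1..n} \<Longrightarrow> x i = 0 \<or> x i = 1" "(\<Sum>i = 1..n. x i) = p" and "k \<le> p" "p \<le> n" "1 \<le> n"
    and c: "\<And>i. i \<in> {1..n} \<Longrightarrow> 0 \<le> cl i \<and> cl i \<le> cu i"
  obtains A B u v j where "A \<le> B" "1 \<le> v" "v \<le> n" "u \<le> v" "j \<in> fractional_recovery n p k x v"
    "robust_value n cl cu \<Gamma> u j =
       real v * min (dual_value n p k x cl A B + \<Gamma>) (dual_value n p k x cu A B)"
    "\<Gamma> = 0 \<Longrightarrow> (\<And>i. i \<in> {1..n} \<Longrightarrow> cl i = cu i) \<Longrightarrow> v = 1 \<and> u = 0"
proof -
  obtain A B where AB: "A \<le> B" and mx: "\<And>A' B'. A' \<le> B' \<Longrightarrow>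
      min (dual_value n p k x cl A' B' + \<Gamma>) (dual_value n p k x cu A' B') \<le>
      min (dual_value n p k x cl A B + \<Gamma>) (dual_value n p k x cu A B)"
    by (rule dual_maximizer[where \<Gamma> = \<Gamma>, OF x \<open>k \<le> p\<close> \<open>p \<le> n\<close> c])
      (assumption | rule that)+
  let ?h1 = "dual_value n p k x cl A B + \<Gamma>" and ?h2 = "dual_value n p k x cu A B"
  define D :: "(int \<times> int) set" where
    "D = {(-1, 0), (1, 0), (0, -1), (0, 1), (1, 1), (-1, -1)} \<inter> {(a, b). a \<le> b \<or> A < B}"
  have D: "a \<le> b \<or> A < B" "a \<in> {-1, 0, 1}" "b \<in> {-1, 0, 1}" if "(a, b) \<in> D" for a b
    using that by (auto simp: D_def)
  have "finite D" by (simp add: D_def)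
  let ?d1 = "dual_slope n p k x cl A B" and ?d2 = "dual_slope n p k x cu A B"
  have sl: "?h1 < ?h2 \<Longrightarrow> ?d1 a b \<le> 0" "?h2 < ?h1 \<Longrightarrow> ?d2 a b \<le> 0"
    "\<not> (?d1 a b > 0 \<and> ?d2 a b > 0)" if "a \<le> b \<or> A < B" for a b
  proof -
    note max_slopes = maximizer_slopes[where \<Gamma> = \<Gamma> and n = n and p = p and k = k and x = x
        and cl = cl and cu = cu, OF AB that]
    show "?h1 < ?h2 \<Longrightarrow> ?d1 a b \<le> 0" by (rule max_slopes(1)) (rule mx)
    show "?h2 < ?h1 \<Longrightarrow> ?d2 a b \<le> 0" by (rule max_slopes(2)) (rule mx)
    show "\<not> (?d1 a b > 0 \<and> ?d2 a b > 0)" by (rule max_slopes(3)) (rule mx)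
  qed
  have "\<exists>u v. 1 \<le> v \<and> v \<le> n \<and> u \<le> v \<and>
      (\<forall>a b. (a, b) \<in> D \<longrightarrow> int u * ?d1 a b + int (v - u) * ?d2 a b \<le> 0) \<and>
      real u * ?h1 + real (v - u) * ?h2 = real v * min ?h1 ?h2 \<and>
      (\<Gamma> = 0 \<longrightarrow> (\<forall>i\<in>{1..n}. cl i = cu i) \<longrightarrow> v = 1 \<and> u = 0)"
  \<comment> \<open>If the branches coincide as functions, every weight balances them; 0 / 1 is
    chosen to obtain an integral solution.\<close>
  proof (cases "\<Gamma> = 0 \<and> (\<forall>i\<in>{1..n}. cl i = cu i)")
    case True
    then have eq: "dual_value n p k x cl A' B' = dual_value n p k x cu A' B'"
      "dual_slope n p k x cl A B a b = dual_slope n p k x cu A B a b" for A' B' a b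
      by (simp_all add: dual_value_def dual_slope_def)
    have "?d2 a b \<le> 0" if "(a, b) \<in> D" for a b
      using sl(3)[OF D(1)[OF that]] by (simp add: eq)
    with True \<open>1 \<le> n\<close> show ?thesis
      by - (rule exI[of _ 0], rule exI[of _ 1], auto simp: eq)
  next
    case ne: False
    \<comment> \<open>A strictly smaller branch receives all the weight, with v = 1. Only a tie
      calls for a proper fraction.\<close>
    consider "?h1 < ?h2" | "?h2 < ?h1" | "?h1 = ?h2" by linarith
    then show ?thesis
    proof cases
      case 1
      have "?d1 a b \<le> 0" if "(a, b) \<in> D" for a b
        using sl(1)[OF D(1)[OF that] 1] .
      with ne 1 \<open>1 \<le> n\<close> show ?thesis
        by - (rule exI[of _ 1], rule exI[of _ 1], auto)
    next
      case 2
      have "?d2 a b \<le> 0" if "(a, b) \<in> D" for a b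
        using sl(2)[OF D(1)[OF that] 2] .
      with ne 2 \<open>1 \<le> n\<close> show ?thesis
        by - (rule exI[of _ 0], rule exI[of _ 1], auto)
    next
      case 3
      let ?E = "(\<lambda>(a, b). (?d1 a b, ?d2 a b)) ` D"
      have fin: "finite ?E" using \<open>finite D\<close> by (rule finite_imageI)
      have diff: "snd e - fst e \<le> int n" if "e \<in> ?E" for e
      proof -
        from that obtain a b where ab: "(a, b) \<in> D" "e = (?d1 a b, ?d2 a b)" by auto
        have "(\<Sum>i = 1..n. slope (threshold x A B i - cl i) (threshold x a b i) -
            slope (threshold x A B i - cu i) (threshold x a b i)) \<le> (\<Sum>i = 1..n. 1)"
        proof (rule sum_mono)
          fix i assume i: "i \<in> {1..n}"
          have "threshold x a b i = a \<or> threshold x a b i = b"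
            using x(1)[OF i] by (auto simp: threshold_def)
          then have "threshold x a b i \<in> {-1, 0, 1}" using D(2,3)[OF ab(1)] by metis
          then show "slope (threshold x A B i - cl i) (threshold x a b i) -
            slope (threshold x A B i - cu i) (threshold x a b i) \<le> 1"
            using c[OF i] by (intro slope_bounds) auto
        qed
        then show ?thesis by (simp add: ab(2) dual_slope_def sum_subtractf)
      qed
      have nonpos: "\<not> (l * fst e + m * fst e' > 0 \<and> l * snd e + m * snd e' > 0)"
        if e: "e \<in> ?E" "e' \<in> ?E" and lm: "l \<ge> 0" "m \<ge> 0" for e e' l m
      proof -
        from e obtain a b a' b' where ab: "(a, b) \<in> D" "e = (?d1 a b, ?d2 a b)"
          "(a', b') \<in> D" "e' = (?d1 a' b', ?d2 a' b')" by auto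
        \<comment> \<open>Nonnegative combinations of feasible directions are feasible, so the tie
          condition also holds for the combined direction, outside the finite list.\<close>
        have "l * a + m * a' \<le> l * b + m * b' \<or> A < B"
          using D(1)[OF ab(1)] D(1)[OF ab(3)] lm by (auto intro!: add_mono mult_left_mono)
        from sl(3)[OF this] show ?thesis
          using dual_slope_add_ge[OF lm, of n p k x cl A B a b a' b']
            dual_slope_add_ge[OF lm, of n p k x cu A B a b a' b']
          unfolding ab(2,4) fst_conv snd_conv by linarith
      qed
      obtain u v where uv: "1 \<le> v" "v \<le> n" "u \<le> v"
        "\<forall>e\<in>?E. int u * fst e + int (v - u) * snd e \<le> 0"
        by (rule balancing_fraction[OF fin \<open>1 \<le> n\<close> diff nonpos]) (assumption | rule that)+
      have "int u * ?d1 a b + int (v - u) * ?d2 a b \<le> 0" if "(a, b) \<in> D" for a b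
        using bspec[OF uv(4) imageI[OF that]] by simp
      moreover have "real u * ?h1 + real (v - u) * ?h2 = real v * min ?h1 ?h2"
        using 3 uv(3) by (simp add: of_nat_diff algebra_simps)
      ultimately show ?thesis using uv(1-3) ne by blast
    qed
  qed
  then obtain u v where uv: "1 \<le> v" "v \<le> n" "u \<le> v"
    "\<forall>a b. (a, b) \<in> D \<longrightarrow> int u * ?d1 a b + int (v - u) * ?d2 a b \<le> 0"
    "real u * ?h1 + real (v - u) * ?h2 = real v * min ?h1 ?h2"
    "\<Gamma> = 0 \<longrightarrow> (\<forall>i\<in>{1..n}. cl i = cu i) \<longrightarrow> v = 1 \<and> u = 0"
    by (elim exE conjE) (rule that)
  have slopes: "int u * ?d1 a b + int (v - u) * ?d2 a b \<le> 0"
    if "(a, b) \<in> {(-1, 0), (1, 0), (0, -1), (0, 1), (1, 1), (-1, -1)}" "a \<le> b \<or> A < B" for a b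
    using uv(4) that unfolding D_def by blast
  obtain j where "j \<in> fractional_recovery n p k x v"
    "robust_value n cl cu \<Gamma> u j = real u * ?h1 + real (v - u) * ?h2"
    by (rule balanced_recovery[OF x \<open>k \<le> p\<close> _ AB uv(3) slopes]) (use c in auto)
  with AB uv show thesis by (intro that[of A B v u j]) auto
qed


section \<open>The robust cost as a minimum over fractional recovery solutions\<close>

lemma integral_recovery:
  assumes x: "x \<in> selections n p" and "k \<le> p" "p \<le> n" "1 \<le> n"
    and c: "\<And>i. i \<in> {1..n} \<Longrightarrow> 0 \<le> c i" and j: "j \<in> fractional_recovery n p k x v"
  shows "\<exists>y\<in>recovery_selections n p k x. real v * item_cost n c y \<le> (\<Sum>i = 1..n. c i * real (j i))"
proof -
  \<comment> \<open>With equal lower and upper costs and zero budget, strong duality is integrality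
    of the recovery polytope: y has denominator 1 and attains a dual value that bounds every
    fractional solution from below.\<close>
  obtain A B u v' y where y: "A \<le> B" "y \<in> fractional_recovery n p k x v'"
    "robust_value n c c 0 u y = real v' * min (dual_value n p k x c A B + 0) (dual_value n p k x c
        A B)"
    "v' = 1"
    by (rule strong_duality[of n x p k c c 0]) (use selectionsD[OF x] assms in auto)
  \<comment> \<open>Recovery selections are extensional functions, whereas
    \<open>fractional_recovery\<close> leaves the values outside {1..n} open.\<close>
  let ?y = "restrict y {1..n}"
  have "?y \<in> recovery_selections n p k x"
    using y(2) unfolding y(4) recovery_selections_def fractional_recovery_def
    by (auto simp: PiE_def Pi_def le_Suc_eq)
  moreover have "real v * item_cost n c ?y \<le> (\<Sum>i = 1..n. c i * real (j i))"
    using dual_value_le[OF j \<open>A \<le> B\<close>, of c] y(3,4) by (simp add: robust_value_def item_cost_def)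
  ultimately show ?thesis by blast
qed

lemma recovery_selections_fractional:
  "y \<in> recovery_selections n p k x \<Longrightarrow> y \<in> fractional_recovery n p k x 1"
  unfolding recovery_selections_def fractional_recovery_def by (force simp: PiE_def Pi_def)

text \<open>Since j i \<le> u + max 0 (j i - u), an increase \<open>\<delta> i\<close> is paid on at
  most u units, which the budget covers, and on the excess, where it is at most
  \<open>cu i - cl i\<close>.\<close>

lemma adversary_le_robust_value:
  assumes x: "x \<in> selections n p" and "k \<le> p" "p \<le> n" "1 \<le> n" "1 \<le> v"
    and cost: "\<And>i. i \<in> {1..n} \<Longrightarrow> 0 \<le> cl i \<and> cl i \<le> cu i"
    and j: "j \<in> fractional_recovery n p k x v"
    and c: "c \<in> continuous_budgeted_set n cl cu \<Gamma>"
  shows "(MIN y\<in>recovery_selections n p k x. item_cost n c y) \<le> robust_value n cl cu \<Gamma> u j / real v"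
proof -
  from c obtain \<delta> where \<delta>: "\<And>i. i \<in> {1..n} \<Longrightarrow> c i = cl i + \<delta> i"
    "\<And>i. i \<in> {1..n} \<Longrightarrow> 0 \<le> \<delta> i \<and> \<delta> i \<le> cu i - cl i" "(\<Sum>i = 1..n. \<delta> i) \<le> \<Gamma>"
    by (auto simp: continuous_budgeted_set_def)
  obtain y where y: "y \<in> recovery_selections n p k x"
    "real v * item_cost n c y \<le> (\<Sum>i = 1..n. c i * real (j i))"
    using integral_recovery[OF x assms(2-4) _ j, of c] cost \<delta> by (metis add_nonneg_nonneg)
  have "(\<Sum>i = 1..n. c i * real (j i)) \<le>
      (\<Sum>i = 1..n. (cl i * real (j i) + (cu i - cl i) * max 0 (real (j i) - real u)) + real u * \<delta> i)"
  proof (rule sum_mono)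
    fix i assume i: "i \<in> {1..n}"
    have "\<delta> i * real (j i) \<le> \<delta> i * (max 0 (real (j i) - real u) + real u)"
      using \<delta>(2)[OF i] by (intro mult_left_mono) auto
    also have "\<dots> \<le> (cu i - cl i) * max 0 (real (j i) - real u) + real u * \<delta> i"
      using \<delta>(2)[OF i] mult_right_mono[of "\<delta> i" "cu i - cl i" "max 0 (real (j i) - real u)"]
      by (simp add: algebra_simps)
    finally show "c i * real (j i) \<le>
        (cl i * real (j i) + (cu i - cl i) * max 0 (real (j i) - real u)) + real u * \<delta> i"
      using \<delta>(1)[OF i] by (simp add: algebra_simps)
  qed
  also have "\<dots> = (\<Sum>i = 1..n. cl i * real (j i) + (cu i - cl i) * max 0 (real (j i) - real u)) +
      real u * (\<Sum>i = 1..n. \<delta> i)"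
    by (simp only: sum.distrib sum_distrib_left)
  also have "\<dots> \<le> robust_value n cl cu \<Gamma> u j"
    using mult_left_mono[OF \<delta>(3), of "real u"] by (simp add: robust_value_def mult.commute)
  finally have "item_cost n c y \<le> robust_value n cl cu \<Gamma> u j / real v"
    using y(2) \<open>1 \<le> v\<close> by (simp add: field_simps)
  moreover have "(MIN y\<in>recovery_selections n p k x. item_cost n c y) \<le> item_cost n c y"
    using y(1) by (intro Min_le) (auto intro: finite_recovery_selections)
  ultimately show ?thesis by linarith
qed

text \<open>A worst-case cost vector is built from the optimal prices. Each useful increase raises
  the dual by its own amount, so the dual value at c is the minimum of both branches, and weak
  duality for c bounds every recovery selection.\<close>

lemma adversary_ge_robust_value:
  assumes x: "x \<in> selections n p" and "k \<le> p" "p \<le> n" "1 \<le> n" "0 \<le> \<Gamma>"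
    and cost: "\<And>i. i \<in> {1..n} \<Longrightarrow> 0 \<le> cl i \<and> cl i \<le> cu i"
  obtains u v j c where "1 \<le> v" "v \<le> n" "u \<le> v" "j \<in> fractional_recovery n p k x v"
    "c \<in> continuous_budgeted_set n cl cu \<Gamma>"
    "robust_value n cl cu \<Gamma> u j / real v \<le> (MIN y\<in>recovery_selections n p k x. item_cost n c y)"
proof -
  obtain A B u v j where uv: "A \<le> B" "1 \<le> v" "v \<le> n" "u \<le> v" "j \<in> fractional_recovery n p k x v"
    and val: "robust_value n cl cu \<Gamma> u j =
       real v * min (dual_value n p k x cl A B + \<Gamma>) (dual_value n p k x cu A B)"
    by (rule strong_duality[of n x p k cl cu \<Gamma>]) (use selectionsD[OF x] assms in auto)
  let ?t = "threshold x A B"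
  define t where "t = (\<lambda>i. max 0 (?t i - cl i))"
  \<comment> \<open>The largest useful increase: above the price a rise gains nothing, above
    \<open>cu i\<close> it is forbidden.\<close>
  define m where "m = (\<lambda>i. min (t i) (cu i - cl i))"
  \<comment> \<open>If the budget is too small, all increases shrink by a common factor, so that
    exactly the minimum of \<Gamma> and the total is spent. In the second branch the divisor exceeds
    \<Gamma> and is therefore positive.\<close>
  define \<theta> where "\<theta> = (if sum m {1..n} \<le> \<Gamma> then 1 else \<Gamma> / sum m {1..n})"
  have m0: "0 \<le> m i" if "i \<in> {1..n}" for i using cost[OF that] by (simp add: m_def t_def)
  have \<theta>: "0 \<le> \<theta>" "\<theta> \<le> 1" "\<theta> * sum m {1..n} = min \<Gamma> (sum m {1..n})"
    using \<open>0 \<le> \<Gamma>\<close> by (auto simp: \<theta>_def)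
  define c where "c = (\<lambda>i\<in>{1..n}. cl i + \<theta> * m i)"
  have \<theta>m: "0 \<le> \<theta> * m i" "\<theta> * m i \<le> m i" if "i \<in> {1..n}" for i
    using \<theta>(1,2) m0[OF that] by (auto intro: mult_left_le_one_le)
  have "(\<Sum>i = 1..n. \<theta> * m i) \<le> \<Gamma>"
    unfolding sum_distrib_left[symmetric] \<theta>(3) by simp
  moreover have "\<theta> * m i \<le> cu i - cl i" if "i \<in> {1..n}" for i
    using \<theta>m(2)[OF that] by (simp add: m_def)
  ultimately have "c \<in> continuous_budgeted_set n cl cu \<Gamma>"
    unfolding continuous_budgeted_set_def c_def using \<theta>m(1)
    by (intro CollectI exI[of _ "\<lambda>i. \<theta> * m i"]) auto
  have "(\<Sum>i = 1..n. max 0 (?t i - c i)) = (\<Sum>i = 1..n. t i - \<theta> * m i)"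
  proof (rule sum.cong)
    fix i assume i: "i \<in> {1..n}"
    show "max 0 (?t i - c i) = t i - \<theta> * m i"
      using \<theta>m[OF i] i by (auto simp: c_def m_def t_def max_def split: if_splits)
  qed simp
  also have "\<dots> = sum t {1..n} - min \<Gamma> (sum m {1..n})"
    by (simp only: sum_subtractf sum_distrib_left[symmetric] \<theta>(3))
  finally have "dual_value n p k x c A B = min (dual_value n p k x cl A B + \<Gamma>)
      (dual_value n p k x cl A B + sum m {1..n})"
    by (simp add: dual_value_def t_def)
  also have "dual_value n p k x cl A B + sum m {1..n} = dual_value n p k x cu A B"
  proof -
    have "(\<Sum>i = 1..n. t i - m i) = (\<Sum>i = 1..n. max 0 (?t i - cu i))"
    proof (rule sum.cong)
      fix i assume "i \<in> {1..n}"
      then show "t i - m i = max 0 (?t i - cu i)"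
        using cost[of i] by (auto simp: t_def m_def max_def min_def)
    qed simp
    then show ?thesis by (simp add: dual_value_def sum_subtractf t_def)
  qed
  finally have dv: "dual_value n p k x c A B = robust_value n cl cu \<Gamma> u j / real v"
    using val uv(2) by simp
  have "robust_value n cl cu \<Gamma> u j / real v \<le> (MIN y\<in>recovery_selections n p k x. item_cost n c y)"
  proof (rule Min.boundedI)
    show "finite ((item_cost n c) ` recovery_selections n p k x)"
      by (intro finite_imageI finite_recovery_selections)
    show "item_cost n c ` recovery_selections n p k x \<noteq> {}"
      using self_in_recovery_selections[OF x] by blast
    fix a assume "a \<in> item_cost n c ` recovery_selections n p k x"
    then obtain y where "y \<in> recovery_selections n p k x" "a = item_cost n c y" by blast
    then show "robust_value n cl cu \<Gamma> u j / real v \<le> a"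
      using dual_value_le[OF recovery_selections_fractional uv(1), of y n p k x c]
      by (simp add: dv item_cost_def)
  qed
  with uv \<open>c \<in> _\<close> show thesis by (intro that[of v u j c]) auto
qed

lemma rrec_cost_le:
  assumes x: "x \<in> selections n p" and "k \<le> p" "p \<le> n" "1 \<le> n" "0 \<le> \<Gamma>" "1 \<le> v"
    and cost: "\<And>i. i \<in> {1..n} \<Longrightarrow> 0 \<le> cl i \<and> cl i \<le> cu i"
    and j: "j \<in> fractional_recovery n p k x v"
  shows "rrec_cost n p k C cl cu \<Gamma> x \<le> item_cost n C x + robust_value n cl cu \<Gamma> u j / real v"
proof -
  \<comment> \<open>The cost vector obtained here shows that the supremum is taken over a nonempty
    set.\<close>
  obtain c where "c \<in> continuous_budgeted_set n cl cu \<Gamma>"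
    by (rule adversary_ge_robust_value[OF assms(1-5) cost])
  then have "(SUP c\<in>continuous_budgeted_set n cl cu \<Gamma>. MIN y\<in>recovery_selections n p k x.
      item_cost n c y)
      \<le> robust_value n cl cu \<Gamma> u j / real v"
    by (intro cSUP_least adversary_le_robust_value[OF assms(1-4,6) cost j]) auto
  then show ?thesis by (simp add: rrec_cost_def)
qed

lemma rrec_cost_attained:
  assumes x: "x \<in> selections n p" and "k \<le> p" "p \<le> n" "1 \<le> n" "0 \<le> \<Gamma>"
    and cost: "\<And>i. i \<in> {1..n} \<Longrightarrow> 0 \<le> cl i \<and> cl i \<le> cu i"
  obtains u v j where "1 \<le> v" "v \<le> n" "u \<le> v" "j \<in> fractional_recovery n p k x v"
    "rrec_cost n p k C cl cu \<Gamma> x = item_cost n C x + robust_value n cl cu \<Gamma> u j / real v"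
proof -
  obtain u v j c where uv: "1 \<le> v" "v \<le> n" "u \<le> v" "j \<in> fractional_recovery n p k x v"
    and c: "c \<in> continuous_budgeted_set n cl cu \<Gamma>"
    "robust_value n cl cu \<Gamma> u j / real v \<le> (MIN y\<in>recovery_selections n p k x. item_cost n c y)"
    by (rule adversary_ge_robust_value[OF assms(1-5) cost])
  have "bdd_above ((\<lambda>c. MIN y\<in>recovery_selections n p k x. item_cost n c y) `
      continuous_budgeted_set n cl cu \<Gamma>)"
    using adversary_le_robust_value[OF assms(1-4) uv(1) cost uv(4)]
    by (intro bdd_aboveI2)
  from cSUP_upper[OF c(1) this] c(2)
  have "item_cost n C x + robust_value n cl cu \<Gamma> u j / real v \<le> rrec_cost n p k C cl cu \<Gamma> x"
    by (simp add: rrec_cost_def)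
  with rrec_cost_le[OF assms(1-5) uv(1) cost uv(4)] have
    "rrec_cost n p k C cl cu \<Gamma> x = item_cost n C x + robust_value n cl cu \<Gamma> u j / real v"
    by (intro antisym)
  with uv show thesis by (intro that)
qed


section \<open>Exact multiple-choice knapsack\<close>

text \<open>Row \<open>i\<close>, capacity \<open>w\<close>: entry \<open>e\<close> is the minimum over the choices \<open>0, \<dots>, e\<close> for item \<open>i\<close>, so that
  every entry depends on at most two earlier ones. The value \<open>big\<close> stands for infeasibility.\<close>

context
  fixes big :: int and base :: "nat \<Rightarrow> int" and weight :: "nat \<Rightarrow> nat"
    and last_choice :: nat and cost :: "nat \<Rightarrow> nat \<Rightarrow> int"
begin

fun knapsack :: "nat \<Rightarrow> nat \<Rightarrow> nat \<Rightarrow> int" where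
  "knapsack 0 w e = base w"
| "knapsack (Suc i) w e = min
     (if e \<le> last_choice \<and> weight e \<le> w
      then knapsack i (w - weight e) last_choice + cost (Suc i) e else big)
     (case e of 0 \<Rightarrow> big | Suc e' \<Rightarrow> knapsack (Suc i) w e')"

lemma knapsack_le_choice:
  assumes "e \<le> e'" "e \<le> last_choice" "weight e \<le> w"
  shows "knapsack (Suc i) w e' \<le> knapsack i (w - weight e) last_choice + cost (Suc i) e"
  using assms(1)
proof (induction e' rule: dec_induct)
  case base
  then show ?case using assms(2,3) by simp
next
  case (step e')
  then show ?case by (auto simp: min_le_iff_disj)
qed

lemma knapsack_cases:
  "knapsack (Suc i) w e = big \<or>
   (\<exists>e' \<le> last_choice. weight e' \<le> w \<and>
      knapsack (Suc i) w e = knapsack i (w - weight e') last_choice + cost (Suc i) e')"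
  by (induction e) (auto simp: min_def)

declare knapsack.simps(2) [simp del]

lemma knapsack_le:
  assumes "\<And>l. l \<in> {1..i} \<Longrightarrow> f l \<le> last_choice" "(\<Sum>l = 1..i. weight (f l)) \<le> w"
  shows "knapsack i w last_choice \<le> base (w - (\<Sum>l = 1..i. weight (f l))) + (\<Sum>l = 1..i. cost l (f
      l))"
  using assms
proof (induction i arbitrary: w)
  case (Suc i)
  have "knapsack (Suc i) w last_choice \<le>
      knapsack i (w - weight (f (Suc i))) last_choice + cost (Suc i) (f (Suc i))"
    using Suc.prems by (intro knapsack_le_choice) auto
  also have "knapsack i (w - weight (f (Suc i))) last_choice \<le>
      base (w - weight (f (Suc i)) - (\<Sum>l = 1..i. weight (f l))) + (\<Sum>l = 1..i. cost l (f l))"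
    using Suc.prems by (intro Suc.IH) auto
  finally show ?case by (simp add: algebra_simps)
qed simp

text \<open>An infeasible entry need not equal \<open>big\<close>: the costs of later items are
  added to it and may be negative. Hence the infeasible alternative is stated with a loss of X per
  item.\<close>

lemma knapsack_attained:
  assumes "\<And>l e. l \<in> {1..i} \<Longrightarrow> e \<le> last_choice \<Longrightarrow> \<bar>cost l e\<bar> \<le> X"
  shows "knapsack i w last_choice \<ge> big - int i * X \<or>
     (\<exists>f. (\<forall>l\<in>{1..i}. f l \<le> last_choice) \<and> (\<Sum>l = 1..i. weight (f l)) \<le> w \<and>
       knapsack i w last_choice = base (w - (\<Sum>l = 1..i. weight (f l))) + (\<Sum>l = 1..i. cost l (f l)))"
  using assms
proof (induction i arbitrary: w)
  case (Suc i)
  have X: "0 \<le> X" using Suc.prems[of 1 0] by force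
  consider "knapsack (Suc i) w last_choice = big"
    | e where "e \<le> last_choice" "weight e \<le> w"
      "knapsack (Suc i) w last_choice = knapsack i (w - weight e) last_choice + cost (Suc i) e"
    using knapsack_cases by metis
  then show ?case
  proof cases
    case 1
    then show ?thesis using X by simp
  next
    case (2 e)
    have ce: "\<bar>cost (Suc i) e\<bar> \<le> X" using Suc.prems[of "Suc i" e] 2 by simp
    have "knapsack i (w - weight e) last_choice \<ge> big - int i * X \<or>
      (\<exists>f. (\<forall>l\<in>{1..i}. f l \<le> last_choice) \<and> (\<Sum>l = 1..i. weight (f l)) \<le> w - weight e \<and>
       knapsack i (w - weight e) last_choice =
         base (w - weight e - (\<Sum>l = 1..i. weight (f l))) + (\<Sum>l = 1..i. cost l (f l)))"
      by (rule Suc.IH) (use Suc.prems in auto)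
    then show ?thesis
    proof
      assume "knapsack i (w - weight e) last_choice \<ge> big - int i * X"
      moreover have "int (Suc i) * X = int i * X + X" by (simp add: algebra_simps)
      ultimately show ?thesis unfolding 2(3) using ce by (intro disjI1) linarith
    next
      assume "\<exists>f. (\<forall>l\<in>{1..i}. f l \<le> last_choice) \<and> (\<Sum>l = 1..i. weight (f l)) \<le> w - weight e \<and>
       knapsack i (w - weight e) last_choice =
         base (w - weight e - (\<Sum>l = 1..i. weight (f l))) + (\<Sum>l = 1..i. cost l (f l))"
      then obtain f where f: "\<forall>l\<in>{1..i}. f l \<le> last_choice" "(\<Sum>l = 1..i. weight (f l)) \<le> w -
          weight e"
       "knapsack i (w - weight e) last_choice =
         base (w - weight e - (\<Sum>l = 1..i. weight (f l))) + (\<Sum>l = 1..i. cost l (f l))" by blast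
      let ?f = "f(Suc i := e)"
      have "(\<Sum>l = 1..i. weight (?f l)) = (\<Sum>l = 1..i. weight (f l))"
        "(\<Sum>l = 1..i. cost l (?f l)) = (\<Sum>l = 1..i. cost l (f l))"
        by (intro sum.cong; simp)+
      with f 2 show ?thesis
        by (intro disjI2 exI[of _ ?f]) (auto simp: le_Suc_eq algebra_simps)
    qed
  qed
qed auto

lemma abs_knapsack_le:
  assumes "\<And>l e. l \<in> {1..i} \<Longrightarrow> e \<le> last_choice \<Longrightarrow> \<bar>cost l e\<bar> \<le> X"
    and "\<And>w. \<bar>base w\<bar> \<le> Y" "\<bar>big\<bar> \<le> Y"
  shows "\<bar>knapsack i w e\<bar> \<le> Y + int i * X"
  using assms
proof (induction i arbitrary: w e)
  case (Suc i)
  have X: "0 \<le> X" using Suc.prems(1)[of 1 0] by force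
  consider "knapsack (Suc i) w e = big"
    | e' where "e' \<le> last_choice"
      "knapsack (Suc i) w e = knapsack i (w - weight e') last_choice + cost (Suc i) e'"
    using knapsack_cases by metis
  then show ?case
  proof cases
    case 1
    have "0 \<le> int (Suc i) * X" using X by simp
    then show ?thesis unfolding 1 using Suc.prems(3) by linarith
  next
    case (2 e')
    have "\<bar>cost (Suc i) e'\<bar> \<le> X" using Suc.prems(1)[of "Suc i" e'] 2 by simp
    moreover have "\<bar>knapsack i (w - weight e') last_choice\<bar> \<le> Y + int i * X"
      by (rule Suc.IH) (use Suc.prems in auto)
    ultimately show ?thesis using 2 by (simp add: algebra_simps)
  qed
qed simp

end


section \<open>Polynomial-time programs\<close>

text \<open>All cells are bounded, not just those in use, so that a \<open>Load\<close> is bounded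
  whatever its address.\<close>

definition bounded_memory :: "nat \<Rightarrow> memory \<Rightarrow> bool" where
  "bounded_memory B s \<longleftrightarrow> (\<forall>a. \<bar>s a\<bar> < 2 ^ B)"

lemma bit_length_le:
  assumes "\<bar>z\<bar> < 2 ^ B"
  shows "bit_length z \<le> B + 1"
proof -
  have "nat \<bar>z\<bar> < 2 ^ B"
    using assms by (simp add: nat_less_iff)
  then have "floorlog 2 (nat \<bar>z\<bar>) \<le> B"
    by (intro floorlog_leI) auto
  then show ?thesis
    by (simp add: bit_length_def)
qed

lemma abs_less_power_bit_length: "\<bar>z\<bar> < 2 ^ bit_length z"
proof -
  have "nat \<bar>z\<bar> < 2 ^ floorlog 2 (nat \<bar>z\<bar>)"
    by (rule floorlog_leD[OF order.refl]) simp
  also have "\<dots> \<le> 2 ^ bit_length z"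
    by (intro power_increasing) (auto simp: bit_length_def)
  finally show ?thesis
    by (simp add: nat_less_iff)
qed

lemma abs_div_le: "\<bar>a div b\<bar> \<le> \<bar>a :: int\<bar>"
proof -
  have pos: "\<bar>x div y\<bar> \<le> \<bar>x\<bar>" if "y > 0" for x y :: int
  proof (cases "x \<ge> 0")
    case True
    then have "x div y \<le> x div 1" using that by (intro zdiv_mono2) auto
    with True that show ?thesis by (simp add: pos_imp_zdiv_nonneg_iff)
  next
    case False
    then have "x div 1 \<le> x div y" using that by (intro zdiv_mono2_neg) auto
    moreover have "x div y < 0" using False that by (simp add: pos_imp_zdiv_neg_iff)
    ultimately show ?thesis by simp
  qed
  consider "b = 0" | "b > 0" | "b < 0" by linarith
  then show ?thesis
  proof cases
    case 3
    then have "\<bar>(- a) div (- b)\<bar> \<le> \<bar>- a\<bar>" by (intro pos) simp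
    then show ?thesis by simp
  qed (auto intro: pos)
qed

lemma abs_apply_op_less:
  assumes "\<bar>a\<bar> < 2 ^ m" "\<bar>b\<bar> < 2 ^ n"
  shows "\<bar>apply_op f a b\<bar> < 2 ^ (m + n + 1)"
proof -
  have 1: "(2::int) ^ m \<le> 2 ^ (m + n)" "(2::int) ^ n \<le> 2 ^ (m + n)"
    by (auto intro: power_increasing)
  have 2: "(2::int) ^ (m + n + 1) = 2 * 2 ^ (m + n)" by simp
  have 3: "\<bar>a * b\<bar> < 2 ^ (m + n)"
    unfolding abs_mult power_add using assms by (intro mult_strict_mono') auto
  have 4: "\<bar>a div b\<bar> \<le> \<bar>a\<bar>" by (rule abs_div_le)
  show ?thesis
    unfolding 2
  proof (cases f)
    case Plus
    have "\<bar>a + b\<bar> < 2 * 2 ^ (m + n)" using assms 1 by linarith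
    then show "\<bar>apply_op f a b\<bar> < 2 * 2 ^ (m + n)" by (simp only: Plus apply_op.simps)
  next
    case Minus
    have "\<bar>a - b\<bar> < 2 * 2 ^ (m + n)" using assms 1 by linarith
    then show "\<bar>apply_op f a b\<bar> < 2 * 2 ^ (m + n)" by (simp only: Minus apply_op.simps)
  next
    case Times
    have "\<bar>a * b\<bar> < 2 * 2 ^ (m + n)" using 3 by linarith
    then show "\<bar>apply_op f a b\<bar> < 2 * 2 ^ (m + n)" by (simp only: Times apply_op.simps)
  next
    case Quotient
    have "\<bar>a div b\<bar> < 2 * 2 ^ (m + n)" using assms(1) 1 4 by linarith
    then show "\<bar>apply_op f a b\<bar> < 2 * 2 ^ (m + n)" by (simp only: Quotient apply_op.simps)
  qed
qed

text \<open>A fixed expression performs a fixed number of operations, each of which at most adds the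
  bit lengths of its operands plus one. So value length and time are linear in B, with a factor that
  depends on the expression alone.\<close>

lemma expr_bounds:
  "\<exists>K>0. \<forall>s B. 1 \<le> B \<longrightarrow> bounded_memory B s \<longrightarrow>
     \<bar>expr_val e s\<bar> < 2 ^ (K * B) \<and> expr_time e s \<le> K * B"
proof (induction e)
  case (Lit z)
  have "\<bar>z\<bar> < 2 ^ (bit_length z * B)" if "1 \<le> B" for B
    by (rule less_le_trans[OF abs_less_power_bit_length]) (use that in \<open>auto intro:
        power_increasing\<close>)
  moreover have "bit_length z > 0" by (simp add: bit_length_def)
  ultimately show ?case
    by (intro exI[of _ "bit_length z"]) auto
next
  case (Load e)
  then obtain K where K: "K > 0" "\<And>s B. 1 \<le> B \<Longrightarrow> bounded_memory B s \<Longrightarrow>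
     \<bar>expr_val e s\<bar> < 2 ^ (K * B) \<and> expr_time e s \<le> K * B" by blast
  have "\<bar>expr_val (Load e) s\<bar> < 2 ^ ((2 * K + 3) * B) \<and> expr_time (Load e) s \<le> (2 * K + 3) * B"
    if B: "1 \<le> B" "bounded_memory B s" for s B
  proof
    have c: "\<bar>s (expr_val e s)\<bar> < 2 ^ B" using B by (auto simp: bounded_memory_def)
    also have "(2::int) ^ B \<le> 2 ^ ((2 * K + 3) * B)"
      by (rule power_increasing) auto
    finally show "\<bar>expr_val (Load e) s\<bar> < 2 ^ ((2 * K + 3) * B)" by simp
    show "expr_time (Load e) s \<le> (2 * K + 3) * B"
      using K(2)[OF B] bit_length_le[OF c] bit_length_le[of "expr_val e s" "K * B"] B
      by (simp add: algebra_simps)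
  qed
  then show ?case by (intro exI[of _ "2 * K + 3"]) auto
next
  case (Op f a b)
  then obtain K K' where K: "K > 0" "\<And>s B. 1 \<le> B \<Longrightarrow> bounded_memory B s \<Longrightarrow>
     \<bar>expr_val a s\<bar> < 2 ^ (K * B) \<and> expr_time a s \<le> K * B"
    and K': "K' > 0" "\<And>s B. 1 \<le> B \<Longrightarrow> bounded_memory B s \<Longrightarrow>
     \<bar>expr_val b s\<bar> < 2 ^ (K' * B) \<and> expr_time b s \<le> K' * B" by blast
  have "\<bar>expr_val (Op f a b) s\<bar> < 2 ^ ((2 * K + 2 * K' + 2) * B) \<and>
        expr_time (Op f a b) s \<le> (2 * K + 2 * K' + 2) * B"
    if B: "1 \<le> B" "bounded_memory B s" for s B
  proof
    have "\<bar>expr_val (Op f a b) s\<bar> < 2 ^ (K * B + K' * B + 1)"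
      using K(2)[OF B] K'(2)[OF B] by (simp only: expr_val.simps abs_apply_op_less)
    also have "\<dots> \<le> 2 ^ ((2 * K + 2 * K' + 2) * B)"
      using B by (intro power_increasing) (auto simp: algebra_simps)
    finally show "\<bar>expr_val (Op f a b) s\<bar> < 2 ^ ((2 * K + 2 * K' + 2) * B)" .
    show "expr_time (Op f a b) s \<le> (2 * K + 2 * K' + 2) * B"
      using K(2)[OF B] K'(2)[OF B] bit_length_le[of "expr_val a s" "K * B"]
        bit_length_le[of "expr_val b s" "K' * B"] B
      by (simp add: algebra_simps)
  qed
  then show ?case by (intro exI[of _ "2 * K + 2 * K' + 2"]) auto
qed

section \<open>Time bounds for loop-free programs and for single loops\<close>

fun loop_free :: "program \<Rightarrow> bool" where
  "loop_free Skip = True"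
| "loop_free (Store a e) = True"
| "loop_free (Sequence P Q) = (loop_free P \<and> loop_free Q)"
| "loop_free (IfPositive e P Q) = (loop_free P \<and> loop_free Q)"
| "loop_free (WhilePositive e P) = False"

text \<open>A denotational semantics for loop-free programs; the clause for
  \<open>WhilePositive\<close> is a default that makes the function total.\<close>

fun effect :: "program \<Rightarrow> memory \<Rightarrow> memory" where
  "effect Skip s = s"
| "effect (Store a e) s = s(expr_val a s := expr_val e s)"
| "effect (Sequence P Q) s = effect Q (effect P s)"
| "effect (IfPositive e P Q) s = (if expr_val e s > 0 then effect P s else effect Q s)"
| "effect (WhilePositive e P) s = s"

lemma bounded_memory_mono: "bounded_memory B s \<Longrightarrow> B \<le> B' \<Longrightarrow> bounded_memory B' s"
  unfolding bounded_memory_def by (meson less_le_trans one_le_numeral power_increasing)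

lemma bounded_memory_update:
  "bounded_memory B s \<Longrightarrow> \<bar>v\<bar> < 2 ^ B \<Longrightarrow> bounded_memory B (s(a := v))"
  by (simp add: bounded_memory_def)

lemma loop_free_runs:
  assumes "loop_free P"
  shows "\<exists>K>0. \<forall>s B. 1 \<le> B \<longrightarrow> bounded_memory B s \<longrightarrow>
     bounded_memory (K * B) (effect P s) \<and> (\<exists>t \<le> K * B. runs P s t (effect P s))"
  using assms
proof (induction P)
  case Skip
  then show ?case
    using runs.Skip by (intro exI[of _ 1]) (auto intro!: exI[of _ 1])
next
  case (Store a e)
  obtain K where K: "K > 0" "\<And>s B. 1 \<le> B \<Longrightarrow> bounded_memory B s \<Longrightarrow>
     \<bar>expr_val a s\<bar> < 2 ^ (K * B) \<and> expr_time a s \<le> K * B" using expr_bounds[of a] by blast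
  obtain K' where K': "K' > 0" "\<And>s B. 1 \<le> B \<Longrightarrow> bounded_memory B s \<Longrightarrow>
     \<bar>expr_val e s\<bar> < 2 ^ (K' * B) \<and> expr_time e s \<le> K' * B" using expr_bounds[of e] by blast
  let ?K = "2 * K + 2 * K' + 2"
  have main: "bounded_memory (?K * B) (effect (Store a e) s) \<and> (\<exists>t \<le> ?K * B. runs (Store a e) s t
      (effect (Store a e) s))"
    if B: "1 \<le> B" "bounded_memory B s" for s B
  proof
    have "\<bar>expr_val e s\<bar> < 2 ^ (K' * B)" using K'(2)[OF B] by blast
    also have "(2::int) ^ (K' * B) \<le> 2 ^ (?K * B)" by (rule power_increasing) (auto simp:
        algebra_simps)
    finally show "bounded_memory (?K * B) (effect (Store a e) s)"
      using bounded_memory_mono[OF B(2), of "?K * B"] by (auto intro: bounded_memory_update)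
    have "expr_time a s + expr_time e s + bit_length (expr_val a s) + bit_length (expr_val e s) \<le>
        ?K * B"
      using K(2)[OF B] K'(2)[OF B] bit_length_le[of "expr_val a s" "K * B"]
        bit_length_le[of "expr_val e s" "K' * B"] B
      by (simp add: algebra_simps)
    then show "\<exists>t \<le> ?K * B. runs (Store a e) s t (effect (Store a e) s)"
      unfolding effect.simps using runs.Store by blast
  qed
  show ?case
  proof (rule exI[of _ ?K], intro conjI allI impI)
    fix s B
    assume B: "1 \<le> B" "bounded_memory B s"
    show "bounded_memory (?K * B) (effect (Store a e) s)"
      using main[OF B] by (rule conjunct1)
    show "\<exists>t \<le> ?K * B. runs (Store a e) s t (effect (Store a e) s)"
      using main[OF B] by (rule conjunct2)
  qed simp
next
  case (Sequence P Q)
  then obtain K where K: "K > 0" "\<And>s B. 1 \<le> B \<Longrightarrow> bounded_memory B s \<Longrightarrow>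
     bounded_memory (K * B) (effect P s) \<and> (\<exists>t \<le> K * B. runs P s t (effect P s))" by auto
  from Sequence obtain K' where K': "K' > 0" "\<And>s B. 1 \<le> B \<Longrightarrow> bounded_memory B s \<Longrightarrow>
     bounded_memory (K' * B) (effect Q s) \<and> (\<exists>t \<le> K' * B. runs Q s t (effect Q s))" by auto
  \<comment> \<open>Q starts in a memory whose bit length has already grown to K * B, hence the
    product.\<close>
  let ?K = "K + K' * K"
  have "bounded_memory (?K * B) (effect (Sequence P Q) s) \<and>
     (\<exists>t \<le> ?K * B. runs (Sequence P Q) s t (effect (Sequence P Q) s))"
    if B: "1 \<le> B" "bounded_memory B s" for s B
  proof -
    have "1 \<le> K * B" using K(1) B(1) by simp
    then obtain t' where t': "bounded_memory (K' * (K * B)) (effect Q (effect P s))"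
      "t' \<le> K' * (K * B)" "runs Q (effect P s) t' (effect Q (effect P s))"
      using K'(2)[of "K * B" "effect P s"] K(2)[OF B] by blast
    obtain t where t: "t \<le> K * B" "runs P s t (effect P s)"
      using K(2)[OF B] by blast
    have "bounded_memory (?K * B) (effect Q (effect P s))"
      using t'(1) by (rule bounded_memory_mono) (simp add: algebra_simps)
    moreover have "t + t' \<le> ?K * B" using t(1) t'(2) by (simp add: algebra_simps)
    moreover have "runs (Sequence P Q) s (t + t') (effect Q (effect P s))"
      by (rule runs.Sequence[OF t(2) t'(3)])
    ultimately show ?thesis unfolding effect.simps by blast
  qed
  then show ?case using K(1) by (intro exI[of _ ?K]) auto
next
  case (IfPositive e P Q)
  then obtain K where K: "K > 0" "\<And>s B. 1 \<le> B \<Longrightarrow> bounded_memory B s \<Longrightarrow>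
     bounded_memory (K * B) (effect P s) \<and> (\<exists>t \<le> K * B. runs P s t (effect P s))" by auto
  from IfPositive obtain K' where K': "K' > 0" "\<And>s B. 1 \<le> B \<Longrightarrow> bounded_memory B s \<Longrightarrow>
     bounded_memory (K' * B) (effect Q s) \<and> (\<exists>t \<le> K' * B. runs Q s t (effect Q s))" by auto
  obtain K2 where K2: "K2 > 0" "\<And>s B. 1 \<le> B \<Longrightarrow> bounded_memory B s \<Longrightarrow>
     \<bar>expr_val e s\<bar> < 2 ^ (K2 * B) \<and> expr_time e s \<le> K2 * B" using expr_bounds[of e] by blast
  let ?K = "K + K' + 2 * K2 + 1"
  have "bounded_memory (?K * B) (effect (IfPositive e P Q) s) \<and>
     (\<exists>t \<le> ?K * B. runs (IfPositive e P Q) s t (effect (IfPositive e P Q) s))"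
    if B: "1 \<le> B" "bounded_memory B s" for s B
  proof -
    let ?t = "expr_time e s + bit_length (expr_val e s)"
    have t: "?t \<le> (2 * K2 + 1) * B"
      using K2(2)[OF B] bit_length_le[of "expr_val e s" "K2 * B"] B by (simp add: algebra_simps)
    show ?thesis
    proof (cases "expr_val e s > 0")
      case True
      from K(2)[OF B] obtain t' where t': "bounded_memory (K * B) (effect P s)" "t' \<le> K * B"
        "runs P s t' (effect P s)" by blast
      have "?t + t' \<le> ?K * B" using t t'(2) by (simp add: algebra_simps)
      moreover have "bounded_memory (?K * B) (effect P s)"
        using t'(1) by (rule bounded_memory_mono) (simp add: algebra_simps)
      moreover have "runs (IfPositive e P Q) s (?t + t') (effect P s)"
        by (rule runs.IfTrue[OF True t'(3)])
      ultimately show ?thesis unfolding effect.simps using True by auto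
    next
      case False
      from K'(2)[OF B] obtain t' where t': "bounded_memory (K' * B) (effect Q s)" "t' \<le> K' * B"
        "runs Q s t' (effect Q s)" by blast
      have "?t + t' \<le> ?K * B" using t t'(2) by (simp add: algebra_simps)
      moreover have "bounded_memory (?K * B) (effect Q s)"
        using t'(1) by (rule bounded_memory_mono) (simp add: algebra_simps)
      moreover have "runs (IfPositive e P Q) s (?t + t') (effect Q s)"
        by (rule runs.IfFalse[OF False t'(3)])
      ultimately show ?thesis unfolding effect.simps using False by auto
    qed
  qed
  then show ?case using K(1) by (intro exI[of _ ?K]) auto
qed simp

text \<open>The bound B is required of every intermediate memory. Iterating the growth factor of
  \<open>loop_free_runs\<close> would only give bit lengths exponential in the number of
  rounds.\<close>

lemma while_runs:
  assumes "loop_free P"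
  shows "\<exists>K. \<forall>N B s. 1 \<le> B \<longrightarrow>
     (\<forall>k \<le> N. bounded_memory B ((effect P ^^ k) s)) \<longrightarrow>
     (\<forall>k < N. expr_val e ((effect P ^^ k) s) > 0) \<longrightarrow>
     \<not> expr_val e ((effect P ^^ N) s) > 0 \<longrightarrow>
     (\<exists>t \<le> K * B * (N + 1). runs (WhilePositive e P) s t ((effect P ^^ N) s))"
proof -
  obtain K1 where K1: "K1 > 0" "\<And>s B. 1 \<le> B \<Longrightarrow> bounded_memory B s \<Longrightarrow>
     bounded_memory (K1 * B) (effect P s) \<and> (\<exists>t \<le> K1 * B. runs P s t (effect P s))"
    using loop_free_runs[OF assms] by blast
  obtain K2 where K2: "K2 > 0" "\<And>s B. 1 \<le> B \<Longrightarrow> bounded_memory B s \<Longrightarrow>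
     \<bar>expr_val e s\<bar> < 2 ^ (K2 * B) \<and> expr_time e s \<le> K2 * B" using expr_bounds[of e] by blast
  define K where "K = K1 + 2 * K2 + 1"
  let ?g = "\<lambda>s. expr_time e s + bit_length (expr_val e s)"
  have main: "\<exists>t \<le> K * B * (N + 1). runs (WhilePositive e P) s t ((effect P ^^ N) s)"
    if B: "1 \<le> B" and "\<forall>k \<le> N. bounded_memory B ((effect P ^^ k) s)"
      "\<forall>k < N. expr_val e ((effect P ^^ k) s) > 0" "\<not> expr_val e ((effect P ^^ N) s) > 0" for N B s
    using that(2-)
  proof (induction N arbitrary: s)
    case 0
    have "?g s \<le> (2 * K2 + 1) * B"
      using K2(2)[OF B, of s] bit_length_le[of "expr_val e s" "K2 * B"] B 0(1)[rule_format, of 0]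
          by (simp add: algebra_simps)
    also have "\<dots> \<le> K * B * (0 + 1)" by (simp add: K_def)
    finally have "?g s \<le> K * B * (0 + 1)" .
    moreover have "runs (WhilePositive e P) s (?g s) s"
      using 0(3) by (intro runs.WhileFalse) simp
    ultimately show ?case by auto
  next
    case (Suc N)
    have b: "bounded_memory B s" using Suc.prems(1)[rule_format, of 0] by simp
    have g: "?g s \<le> (2 * K2 + 1) * B"
      using K2(2)[OF B b] bit_length_le[of "expr_val e s" "K2 * B"] B by (simp add: algebra_simps)
    have pos: "expr_val e s > 0" using Suc.prems(2)[rule_format, of 0] by simp
    have sh: "(effect P ^^ k) (effect P s) = (effect P ^^ Suc k) s" for k
      by (simp add: funpow_swap1)
    have "\<exists>t \<le> K * B * (N + 1). runs (WhilePositive e P) (effect P s) t ((effect P ^^ N) (effect P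
        s))"
    proof (rule Suc.IH)
      show "\<forall>k \<le> N. bounded_memory B ((effect P ^^ k) (effect P s))"
        using Suc.prems(1)[rule_format, of "Suc k" for k] by (simp add: sh del: funpow.simps)
      show "\<forall>k < N. expr_val e ((effect P ^^ k) (effect P s)) > 0"
        using Suc.prems(2)[rule_format, of "Suc k" for k] by (simp add: sh del: funpow.simps)
      show "\<not> expr_val e ((effect P ^^ N) (effect P s)) > 0"
        unfolding sh using Suc.prems(3) .
    qed
    then obtain t where t: "t \<le> K * B * (N + 1)"
      "runs (WhilePositive e P) (effect P s) t ((effect P ^^ Suc N) s)" unfolding sh by blast
    from K1(2)[OF B b] obtain t1 where t1: "t1 \<le> K1 * B" "runs P s t1 (effect P s)" by blast
    have "runs (WhilePositive e P) s (?g s + t1 + t) ((effect P ^^ Suc N) s)"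
      by (rule runs.WhileTrue[OF pos t1(2) t(2)])
    moreover have "?g s + t1 + t \<le> K * B * (Suc N + 1)"
      using g t1(1) t(1) by (simp add: K_def algebra_simps)
    ultimately show ?case by blast
  qed
  show ?thesis
  proof (rule exI[of _ K], intro allI impI)
    fix N B s
    assume "1 \<le> B" "\<forall>k \<le> N. bounded_memory B ((effect P ^^ k) s)"
      "\<forall>k < N. expr_val e ((effect P ^^ k) s) > 0" "\<not> expr_val e ((effect P ^^ N) s) > 0"
    then show "\<exists>t \<le> K * B * (N + 1). runs (WhilePositive e P) s t ((effect P ^^ N) s)"
      by (rule main)
  qed
qed

section \<open>Polynomial bounds and total-correctness triples\<close>

definition poly_bounded :: "(nat \<Rightarrow> nat) \<Rightarrow> bool" where
  "poly_bounded f \<longleftrightarrow> (\<exists>q. \<forall>x. f x \<le> poly q x)"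

lemma poly_bounded_const: "poly_bounded (\<lambda>_. c)"
  unfolding poly_bounded_def by (rule exI[of _ "[:c:]"]) simp

lemma poly_bounded_id: "poly_bounded (\<lambda>x. x)"
  unfolding poly_bounded_def by (rule exI[of _ "[:0, 1:]"]) simp

lemma poly_bounded_add: "poly_bounded f \<Longrightarrow> poly_bounded g \<Longrightarrow> poly_bounded (\<lambda>x. f x + g x)"
  unfolding poly_bounded_def by (metis add_mono poly_add)

lemma poly_bounded_mult: "poly_bounded f \<Longrightarrow> poly_bounded g \<Longrightarrow> poly_bounded (\<lambda>x. f x * g x)"
  unfolding poly_bounded_def by (metis mult_le_mono poly_mult)

lemma poly_bounded_power: "poly_bounded f \<Longrightarrow> poly_bounded (\<lambda>x. f x ^ k)"
proof (induction k)
  case 0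
  then show ?case using poly_bounded_const[of 1] by simp
next
  case (Suc k)
  then show ?case using poly_bounded_mult[of f "\<lambda>x. f x ^ k"] by simp
qed

lemmas poly_bounded_intros =
  poly_bounded_const poly_bounded_id poly_bounded_add poly_bounded_mult poly_bounded_power

text \<open>The instance is a ghost variable: the program is fixed and f is chosen before I, so the
  triple is uniform over all instances.\<close>

definition poly_triple ::
  "('i \<Rightarrow> nat) \<Rightarrow> ('i \<Rightarrow> memory \<Rightarrow> bool) \<Rightarrow> program \<Rightarrow> ('i \<Rightarrow> memory \<Rightarrow> bool) \<Rightarrow> bool" where
  "poly_triple sz Pre P Post \<longleftrightarrow>
     (\<exists>f. poly_bounded f \<and> (\<forall>I s. Pre I s \<longrightarrow> (\<exists>t s'. runs P s t s' \<and> t \<le> f (sz I) \<and> Post I s')))"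

lemma poly_tripleI:
  assumes "poly_bounded f" "\<And>I s. Pre I s \<Longrightarrow> \<exists>t s'. runs P s t s' \<and> t \<le> f (sz I) \<and> Post I s'"
  shows "poly_triple sz Pre P Post"
  using assms unfolding poly_triple_def by (intro exI[of _ f] conjI) simp_all

lemma poly_triple_sequence:
  assumes "poly_triple sz Pre P Mid" "poly_triple sz Mid Q Post"
  shows "poly_triple sz Pre (Sequence P Q) Post"
proof -
  from assms obtain f g where fg: "poly_bounded f" "poly_bounded g"
    "\<And>I s. Pre I s \<Longrightarrow> \<exists>t s'. runs P s t s' \<and> t \<le> f (sz I) \<and> Mid I s'"
    "\<And>I s. Mid I s \<Longrightarrow> \<exists>t s'. runs Q s t s' \<and> t \<le> g (sz I) \<and> Post I s'"
    unfolding poly_triple_def by metis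
  have "\<exists>t s'. runs (Sequence P Q) s t s' \<and> t \<le> f (sz I) + g (sz I) \<and> Post I s'"
    if "Pre I s" for I s
    using fg(3)[OF that] fg(4)[of I] by (meson add_mono runs.Sequence)
  with poly_bounded_add[OF fg(1,2)] show ?thesis
    unfolding poly_triple_def by blast
qed

lemma poly_triple_loop_free:
  assumes "loop_free P" "poly_bounded B"
    and "\<And>I s. Pre I s \<Longrightarrow> bounded_memory (B (sz I)) s \<and> Post I (effect P s)"
  shows "poly_triple sz Pre P Post"
proof -
  obtain K where K: "\<And>s B. 1 \<le> B \<Longrightarrow> bounded_memory B s \<Longrightarrow>
     (\<exists>t \<le> K * B. runs P s t (effect P s))"
    using loop_free_runs[OF assms(1)] by blast
  let ?f = "\<lambda>x. K * (B x + 1)"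
  have main: "\<exists>t s'. runs P s t s' \<and> t \<le> ?f (sz I) \<and> Post I s'" if "Pre I s" for I s
  proof -
    have "bounded_memory (B (sz I) + 1) s"
      using assms(3)[OF that] by (auto intro: bounded_memory_mono)
    from K[OF _ this] assms(3)[OF that] show ?thesis by auto
  qed
  have "poly_bounded ?f"
    by (intro poly_bounded_intros assms(2))
  from this main show ?thesis by (rule poly_tripleI)
qed

text \<open>The invariant is indexed by the number of completed rounds, and the guard is shown to
  fail exactly after \<open>N I\<close> of them, so termination and the iteration count come from
  the same argument.\<close>

lemma poly_triple_while:
  assumes "loop_free P" "poly_bounded B" "poly_bounded M"
    and "\<And>I s. Pre I s \<Longrightarrow> Inv I 0 s \<and> N I \<le> M (sz I)"
    and "\<And>I k s. Inv I k s \<Longrightarrow> k \<le> N I \<Longrightarrow> bounded_memory (B (sz I)) s"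
    and "\<And>I k s. Inv I k s \<Longrightarrow> k < N I \<Longrightarrow> expr_val e s > 0 \<and> Inv I (Suc k) (effect P s)"
    and "\<And>I s. Inv I (N I) s \<Longrightarrow> \<not> expr_val e s > 0 \<and> Post I s"
  shows "poly_triple sz Pre (WhilePositive e P) Post"
proof -
  from while_runs[OF assms(1), of e] obtain K where K: "\<forall>N B s. 1 \<le> B \<longrightarrow>
     (\<forall>k \<le> N. bounded_memory B ((effect P ^^ k) s)) \<longrightarrow>
     (\<forall>k < N. expr_val e ((effect P ^^ k) s) > 0) \<longrightarrow>
     \<not> expr_val e ((effect P ^^ N) s) > 0 \<longrightarrow>
     (\<exists>t \<le> K * B * (N + 1). runs (WhilePositive e P) s t ((effect P ^^ N) s))" ..
  let ?f = "\<lambda>x. K * (B x + 1) * (M x + 1)"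
  have main: "\<exists>t s'. runs (WhilePositive e P) s t s' \<and> t \<le> ?f (sz I) \<and> Post I s'" if pre: "Pre I
      s" for I s
  proof -
    have inv: "Inv I k ((effect P ^^ k) s)" if "k \<le> N I" for k
      using that
    proof (induction k)
      case 0
      then show ?case using assms(4)[OF pre] by simp
    next
      case (Suc k)
      then show ?case using assms(6)[of I k] by simp
    qed
    have "\<exists>t \<le> K * (B (sz I) + 1) * (N I + 1). runs (WhilePositive e P) s t ((effect P ^^ N I) s)"
    proof (rule K[THEN spec, THEN spec, THEN spec, THEN mp, THEN mp, THEN mp, THEN mp])
      show "\<forall>k \<le> N I. bounded_memory (B (sz I) + 1) ((effect P ^^ k) s)"
      proof (intro allI impI)
        fix k assume k: "k \<le> N I"
        show "bounded_memory (B (sz I) + 1) ((effect P ^^ k) s)"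
          by (rule bounded_memory_mono[OF assms(5)[OF inv[OF k] k]]) simp
      qed
      show "\<forall>k < N I. 0 < expr_val e ((effect P ^^ k) s)"
      proof (intro allI impI)
        fix k assume k: "k < N I"
        show "0 < expr_val e ((effect P ^^ k) s)"
          using assms(6)[OF inv k] k by simp
      qed
      show "\<not> 0 < expr_val e ((effect P ^^ N I) s)"
        using assms(7)[OF inv] by simp
    qed simp
    moreover have "K * (B (sz I) + 1) * (N I + 1) \<le> ?f (sz I)"
      using assms(4)[OF pre] by (intro mult_le_mono) auto
    ultimately show ?thesis using assms(7)[OF inv] by (meson order.refl order.trans)
  qed
  have "poly_bounded ?f"
    by (intro poly_bounded_intros assms(2,3))
  from this main show ?thesis by (rule poly_tripleI)
qed


section \<open>Encoding and scaling of instances\<close>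

text \<open>One numbering of all rationals in their order in the encoding, so that a single loop can
  treat budget and costs alike.\<close>

definition instance_value :: "rrec_instance \<Rightarrow> nat \<Rightarrow> rat" where
  "instance_value I l =
     (if l = 0 then budget I
      else if l \<le> num_items I then first_cost I l
      else if l \<le> 2 * num_items I then lower_cost I (l - num_items I)
      else upper_cost I (l - 2 * num_items I))"

definition numer :: "rrec_instance \<Rightarrow> nat \<Rightarrow> int" where
  "numer I l = fst (quotient_of (instance_value I l))"

definition denom :: "rrec_instance \<Rightarrow> nat \<Rightarrow> int" where
  "denom I l = snd (quotient_of (instance_value I l))"

abbreviation value_count :: "rrec_instance \<Rightarrow> nat" where
  "value_count I \<equiv> 3 * num_items I + 1"

lemma map_upt_shift: "map f [a + m..<b + m] = map (\<lambda>i. f (i + m)) [a..<b]"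
  by (rule nth_equalityI) (auto simp: add_ac simp del: upt_Suc)

lemma encode_rrec_eq:
  "encode_rrec I = [int (num_items I), int (num_selected I), int (recovery I)] @
     concat (map (\<lambda>l. [numer I l, denom I l]) [0..<value_count I])"
proof -
  let ?n = "num_items I" and ?e = "\<lambda>l. [numer I l, denom I l]"
  have app: "[a..<c] = [a..<b] @ [b..<c]" if "a \<le> b" "b \<le> c" for a b c :: nat
    using upt_add_eq_append[of a b "c - b"] that by simp
  have "[0..<value_count I] = 0 # [1..<value_count I]"
    by (simp add: upt_rec[of 0] del: upt_Suc)
  also have "\<dots> = 0 # [1..<?n + 1] @ [1 + ?n..<?n + 1 + ?n] @ [1 + 2 * ?n..<?n + 1 + 2 * ?n]"
    using app[of 1 "?n + 1" "value_count I"] app[of "1 + ?n" "1 + 2 * ?n" "value_count I"]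
    by (simp add: mult_2 add.assoc numeral_3_eq_3 del: upt_Suc)
  finally have "[0..<value_count I] = 0 # [1..<?n + 1] @ [1 + ?n..<?n + 1 + ?n] @ [1 + 2 * ?n..<?n
      + 1 + 2 * ?n]" .
  then have "concat (map ?e [0..<value_count I]) = ?e 0 @ concat (map ?e [1..<?n + 1]) @
      concat (map (\<lambda>i. ?e (i + ?n)) [1..<?n + 1]) @ concat (map (\<lambda>i. ?e (i + 2 * ?n)) [1..<?n + 1])"
    by (simp only: map_append list.map concat_append concat.simps map_upt_shift)
  moreover have "map ?e [1..<?n + 1] = map (\<lambda>i. encode_rat (first_cost I i)) [1..<?n + 1]"
    by (auto simp: numer_def denom_def instance_value_def encode_rat_def simp del: upt_Suc)
  moreover have "map (\<lambda>i. ?e (i + ?n)) [1..<?n + 1] = map (\<lambda>i. encode_rat (lower_cost I i))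
      [1..<?n + 1]"
    by (auto simp: numer_def denom_def instance_value_def encode_rat_def simp del: upt_Suc)
  moreover have "map (\<lambda>i. ?e (i + 2 * ?n)) [1..<?n + 1] = map (\<lambda>i. encode_rat (upper_cost I i))
      [1..<?n + 1]"
    by (auto simp: numer_def denom_def instance_value_def encode_rat_def simp del: upt_Suc)
  moreover have "?e 0 = encode_rat (budget I)"
    by (simp add: numer_def denom_def instance_value_def encode_rat_def)
  ultimately show ?thesis
    by (simp only: encode_rrec_def encode_vector_def)
qed

lemma nth_concat_pairs:
  assumes "l < m"
  shows "concat (map (\<lambda>l. [f l, g l]) [0..<m]) ! (2 * l) = f l"
    and "concat (map (\<lambda>l. [f l, g l]) [0..<m]) ! (2 * l + 1) = g l"
  using assms
proof (induction m)
  case (Suc m)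
  have len: "length (concat (map (\<lambda>l. [f l, g l]) [0..<m])) = 2 * m"
    by (induction m) auto
  {
    case 1
    then show ?case using Suc.IH(1) len by (cases "l = m") (auto simp: nth_append)
  next
    case 2
    then show ?case using Suc.IH(2) len by (cases "l = m") (auto simp: nth_append)
  }
qed auto

lemma length_encode_rrec: "length (encode_rrec I) = 5 + 6 * num_items I"
  by (simp add: encode_rrec_def encode_vector_def encode_rat_def length_concat comp_def
      sum_list_triv del: upt_Suc)

text \<open>Cell 0 holds the length and cells 1 to 3 the integer parameters, so the fraction with
  index l starts at 4 + 2 * l: numerators have even addresses and denominators odd ones.\<close>

lemma input_memory_rrec:
  fixes I :: rrec_instance
  defines "s \<equiv> input_memory (encode_rrec I)"
  shows "s 1 = int (num_items I)" "s 2 = int (num_selected I)" "s 3 = int (recovery I)"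
    and "l < value_count I \<Longrightarrow> s (4 + 2 * int l) = numer I l"
    and "l < value_count I \<Longrightarrow> s (5 + 2 * int l) = denom I l"
    and "a < 0 \<Longrightarrow> s a = 0"
proof -
  let ?xs = "concat (map (\<lambda>l. [numer I l, denom I l]) [0..<value_count I])"
  have pos: "s (int j + 1) = encode_rrec I ! j" if "j < 5 + 6 * num_items I" for j
    using that by (simp add: s_def input_memory_def length_encode_rrec)
  have tail: "s (int j + 4) = ?xs ! j" if "j < 2 * value_count I" for j
    using pos[of "j + 3"] that by (simp add: encode_rrec_eq add.commute del: upt_Suc)
  show "s 1 = int (num_items I)" "s 2 = int (num_selected I)" "s 3 = int (recovery I)"
    using pos[of 0] pos[of 1] pos[of 2] by (simp_all add: encode_rrec_eq del: upt_Suc)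
  show "s (4 + 2 * int l) = numer I l" if "l < value_count I"
    using tail[of "2 * l"] nth_concat_pairs(1)[OF that, of "numer I" "denom I"] that
    by (simp add: add.commute del: upt_Suc)
  show "s (5 + 2 * int l) = denom I l" if "l < value_count I"
    using tail[of "2 * l + 1"] nth_concat_pairs(2)[OF that, of "numer I" "denom I"] that
    by (simp add: add.commute del: upt_Suc)
  show "s a = 0" if "a < 0" using that by (simp add: s_def input_memory_def)
qed

section \<open>Sizes, the common denominator and a common cost bound\<close>

definition instance_size :: "rrec_instance \<Rightarrow> nat" where
  "instance_size I = input_size (encode_rrec I)"

lemma length_le_input_size: "length xs \<le> input_size xs"
  by (induction xs) (auto simp: input_size_def bit_length_def)

lemma member_le_input_size: "z \<in> set xs \<Longrightarrow> bit_length z \<le> input_size xs"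
  unfolding input_size_def by (intro member_le_sum_list) auto

lemma num_items_le_size: "5 + 6 * num_items I \<le> instance_size I"
  using length_le_input_size[of "encode_rrec I"] by (simp add: instance_size_def length_encode_rrec)

lemma value_count_le_size: "value_count I \<le> instance_size I"
  using num_items_le_size[of I] by linarith

lemma num_items_le: "num_items I \<le> instance_size I"
  using num_items_le_size[of I] by linarith

lemma denom_pos: "denom I l > 0"
  by (simp add: denom_def quotient_of_denom_pos')

lemma instance_value_eq: "instance_value I l = of_int (numer I l) / of_int (denom I l)"
  unfolding numer_def denom_def by (intro quotient_of_div) simp

text \<open>Three tasks share one product: \<open>denom I l\<close> clears denominators, the factors
  l + 1 build a factorial divisible by every v \<le> n, and the factors 2 leave room for the n bits
  that record the selection.\<close>

definition scale_upto :: "rrec_instance \<Rightarrow> nat \<Rightarrow> int" where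
  "scale_upto I m = (\<Prod>l<m. denom I l * (int l + 1) * 2)"

abbreviation scale :: "rrec_instance \<Rightarrow> int" where
  "scale I \<equiv> scale_upto I (value_count I)"

definition scaled :: "rrec_instance \<Rightarrow> nat \<Rightarrow> int" where
  "scaled I l = (numer I l * scale I) div denom I l"

lemma scale_upto_pos: "scale_upto I m > 0"
  unfolding scale_upto_def by (intro prod_pos) (auto simp: denom_pos)

lemma scale_upto_Suc: "scale_upto I (Suc m) = scale_upto I m * denom I m * (int m + 1) * 2"
  by (simp add: scale_upto_def algebra_simps)

lemma scale_factor:
  "scale_upto I m = (\<Prod>l<m. denom I l) * fact m * 2 ^ m"
  by (induction m) (simp_all add: scale_upto_Suc scale_upto_def[of I 0] algebra_simps)

text \<open>Scaling the value with index l cancels only its own denominator, so the factorial and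
  the power of two survive together in every scaled value.\<close>

lemma scaled_factor:
  assumes "l < value_count I"
  obtains r where "scaled I l = r * fact (value_count I) * 2 ^ value_count I"
proof -
  have "(\<Prod>l<value_count I. denom I l) = denom I l * (\<Prod>l'\<in>{..<value_count I} - {l}. denom I l')"
    using assms by (intro prod.remove) auto
  then have eq: "numer I l * scale I = denom I l * (numer I l * (\<Prod>l'\<in>{..<value_count I} - {l}.
      denom I l') *
      fact (value_count I) * 2 ^ value_count I)"
    unfolding scale_factor by (simp only: mult_ac)
  have "denom I l \<noteq> 0" using denom_pos[of I l] by simp
  then have "scaled I l = numer I l * (\<Prod>l'\<in>{..<value_count I} - {l}. denom I l') *
      fact (value_count I) * 2 ^ value_count I"
    unfolding scaled_def eq by (rule nonzero_mult_div_cancel_left)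
  then show thesis by (rule that)
qed

lemma scaled_eq:
  assumes "l < value_count I"
  shows "real_of_int (scaled I l) = real_of_rat (instance_value I l) * real_of_int (scale I)"
proof -
  have "denom I l dvd denom I l * (int l + 1) * 2" by simp
  also have "\<dots> dvd scale I"
    unfolding scale_upto_def using assms by (intro dvd_prodI[of _ l]) auto
  finally have "denom I l dvd numer I l * scale I" by simp
  then have "real_of_int (scaled I l) = real_of_int (numer I l * scale I) / real_of_int (denom I l)"
    unfolding scaled_def by (rule real_of_int_div)
  then show ?thesis
    by (simp add: instance_value_eq of_rat_divide)
qed


lemma rrec_instancesD:
  assumes "I \<in> rrec_instances"
  shows "1 \<le> num_items I" "1 \<le> num_selected I" "num_selected I \<le> num_items I"
    and "recovery I \<le> num_selected I" "0 \<le> budget I"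
    and "i \<in> {1..num_items I} \<Longrightarrow> 0 \<le> lower_cost I i \<and> lower_cost I i \<le> upper_cost I i"
  using assms by (auto simp: rrec_instances_def)

lemma int_less_power_size: "m \<le> instance_size I \<Longrightarrow> int m < 2 ^ instance_size I"
  by (metis less_exp of_nat_less_iff of_nat_numeral of_nat_power order_le_less_trans)

lemma member_less_power_size:
  assumes "z \<in> set (encode_rrec I)"
  shows "\<bar>z\<bar> < 2 ^ instance_size I"
proof -
  have "(2::int) ^ bit_length z \<le> 2 ^ instance_size I"
    unfolding instance_size_def using assms by (intro power_increasing member_le_input_size) auto
  moreover have "\<bar>z\<bar> < 2 ^ bit_length z" by (rule abs_less_power_bit_length)
  ultimately show ?thesis by linarith
qed

lemma value_less_power_size:
  assumes "l < value_count I"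
  shows "\<bar>numer I l\<bar> < 2 ^ instance_size I" "\<bar>denom I l\<bar> < 2 ^ instance_size I"
proof -
  have "numer I l \<in> set (encode_rrec I) \<and> denom I l \<in> set (encode_rrec I)"
    unfolding encode_rrec_eq using assms by (auto simp del: upt_Suc)
  then show "\<bar>numer I l\<bar> < 2 ^ instance_size I" "\<bar>denom I l\<bar> < 2 ^ instance_size I"
    by (blast intro: member_less_power_size)+
qed

text \<open>Each round multiplies by three numbers of at most \<open>instance_size I\<close> bits.
  The scale thus has quadratically many bits and is affordable under logarithmic cost.\<close>

lemma scale_upto_le:
  assumes "m \<le> value_count I"
  shows "scale_upto I m \<le> 2 ^ (3 * instance_size I * m)"
  using assms
proof (induction m)
  case 0
  then show ?case by (simp add: scale_upto_def)
next
  case (Suc m)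
  let ?L = "instance_size I"
  have L: "1 \<le> ?L" using num_items_le_size[of I] by linarith
  have "denom I m \<le> 2 ^ ?L" using value_less_power_size(2)[of m I] Suc.prems by simp
  moreover have "int m + 1 \<le> 2 ^ ?L"
    using int_less_power_size[of "m + 1" I] num_items_le_size[of I] Suc.prems by simp
  moreover have "(2::int) \<le> 2 ^ ?L" using L power_increasing[OF L, of "2::int"] by simp
  ultimately have "denom I m * (int m + 1) * 2 \<le> 2 ^ ?L * 2 ^ ?L * 2 ^ ?L"
    using denom_pos[of I m] by (intro mult_mono) auto
  with Suc denom_pos[of I m]
  have "scale_upto I m * (denom I m * (int m + 1) * 2) \<le> 2 ^ (3 * ?L * m) * (2 ^ ?L * 2 ^ ?L * 2 ^
      ?L)"
    by (intro mult_mono[of "scale_upto I m"]) auto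
  then show ?case
    by (simp add: scale_upto_Suc power_add[symmetric] algebra_simps)
qed

lemma scale_le:
  assumes "m \<le> value_count I"
  shows "scale_upto I m \<le> 2 ^ (3 * instance_size I ^ 2)"
proof -
  have "m \<le> instance_size I" using assms num_items_le_size[of I] by linarith
  then have "3 * instance_size I * m \<le> 3 * instance_size I ^ 2"
    by (simp add: power2_eq_square)
  then have "(2::int) ^ (3 * instance_size I * m) \<le> 2 ^ (3 * instance_size I ^ 2)"
    by (rule power_increasing) simp
  with scale_upto_le[OF assms] show ?thesis by linarith
qed

lemma scaled_less:
  assumes "l < value_count I"
  shows "\<bar>scaled I l\<bar> < 2 ^ (3 * instance_size I ^ 2 + instance_size I)"
proof -
  have "\<bar>scaled I l\<bar> \<le> \<bar>numer I l\<bar> * scale I"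
    using abs_div_le[of "numer I l * scale I" "denom I l"] scale_upto_pos[of I "value_count I"]
    by (simp add: scaled_def abs_mult)
  also have "\<dots> \<le> \<bar>numer I l\<bar> * 2 ^ (3 * instance_size I ^ 2)"
    by (intro mult_left_mono scale_le) auto
  also have "\<dots> < 2 ^ instance_size I * 2 ^ (3 * instance_size I ^ 2)"
    by (intro mult_strict_right_mono value_less_power_size assms) auto
  finally show ?thesis by (simp add: power_add mult.commute)
qed

text \<open>A bound on all absolute values, computed without branching: integers satisfy |z| \<le>
  z^2. The summand \<open>scale I\<close> makes it positive and at least 2^n, so it also dominates
  the recorded bits.\<close>

definition big_upto :: "rrec_instance \<Rightarrow> nat \<Rightarrow> int" where
  "big_upto I m = scale I + (\<Sum>l<m. scaled I l ^ 2)"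

abbreviation cost_bound :: "rrec_instance \<Rightarrow> int" where
  "cost_bound I \<equiv> big_upto I (value_count I)"

lemma big_upto_Suc: "big_upto I (Suc m) = big_upto I m + scaled I m ^ 2"
  by (simp add: big_upto_def)

lemma abs_scaled_le:
  assumes "l < value_count I"
  shows "\<bar>scaled I l\<bar> \<le> cost_bound I"
proof -
  have "\<bar>scaled I l\<bar> \<le> scaled I l ^ 2"
    by (metis abs_le_square_iff abs_power2 linorder_le_cases abs_ge_zero order.trans power2_abs
        self_le_power zero_less_numeral int_one_le_iff_zero_less order_le_less zero_le_power2)
  also have "\<dots> \<le> (\<Sum>l<value_count I. scaled I l ^ 2)"
    using assms by (intro member_le_sum) auto
  also have "\<dots> \<le> cost_bound I"
    using scale_upto_pos[of I "value_count I"] by (simp add: big_upto_def)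
  finally show ?thesis .
qed

lemma power_num_items_le: "2 ^ num_items I \<le> cost_bound I"
proof -
  have "(2::int) ^ num_items I \<le> 2 ^ value_count I" by (intro power_increasing) auto
  also have "\<dots> \<le> scale I"
  proof -
    have "1 \<le> (\<Prod>l<value_count I. denom I l) * fact (value_count I)"
    proof -
      have "(\<Prod>l<value_count I. denom I l) * fact (value_count I) > 0"
        by (intro mult_pos_pos prod_pos) (auto simp: denom_pos)
      then show ?thesis by linarith
    qed
    then show ?thesis unfolding scale_factor by (intro mult_le_cancel_right1[THEN iffD2]) auto
  qed
  also have "\<dots> \<le> cost_bound I" by (simp add: big_upto_def sum_nonneg del: sum.lessThan_Suc)
  finally show ?thesis .
qed

lemma cost_bound_less:
  assumes "m \<le> value_count I"
  shows "\<bar>big_upto I m\<bar> < 2 ^ (6 * instance_size I ^ 2 + 3 * instance_size I + 1)"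
proof -
  let ?L = "instance_size I"
  have sq: "scaled I l ^ 2 \<le> 2 ^ (6 * ?L ^ 2 + 2 * ?L)" if "l < value_count I" for l
  proof -
    have "\<bar>scaled I l\<bar> ^ 2 \<le> (2 ^ (3 * ?L ^ 2 + ?L)) ^ 2"
      using scaled_less[OF that] by (intro power_mono) auto
    then show ?thesis by (simp add: power_mult[symmetric] algebra_simps)
  qed
  have "(\<Sum>l<m. scaled I l ^ 2) \<le> (\<Sum>l<m. 2 ^ (6 * ?L ^ 2 + 2 * ?L))"
    using assms by (intro sum_mono sq) auto
  also have "\<dots> = int m * 2 ^ (6 * ?L ^ 2 + 2 * ?L)" by simp
  also have "\<dots> < 2 ^ ?L * 2 ^ (6 * ?L ^ 2 + 2 * ?L)"
    using assms num_items_le_size[of I] by (intro mult_strict_right_mono int_less_power_size) auto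
  also have "\<dots> = 2 ^ (6 * ?L ^ 2 + 3 * ?L)" by (simp add: power_add[symmetric])
  finally have 1: "(\<Sum>l<m. scaled I l ^ 2) < 2 ^ (6 * ?L ^ 2 + 3 * ?L)" .
  have "scale I \<le> 2 ^ (3 * ?L ^ 2)" by (rule scale_le) simp
  also have "(2::int) ^ (3 * ?L ^ 2) \<le> 2 ^ (6 * ?L ^ 2 + 3 * ?L)" by (rule power_increasing) auto
  finally have "big_upto I m < 2 * 2 ^ (6 * ?L ^ 2 + 3 * ?L)" using 1 by (simp add: big_upto_def)
  moreover have "0 \<le> big_upto I m"
    using scale_upto_pos[of I "value_count I"] by (auto simp: big_upto_def intro!:
        add_nonneg_nonneg sum_nonneg)
  ultimately show ?thesis by simp
qed


section \<open>Reading and scaling the input\<close>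

abbreviation add_expr (infixl "\<oplus>" 65) where "a \<oplus> b \<equiv> Op Plus a b"
abbreviation sub_expr (infixl "\<ominus>" 65) where "a \<ominus> b \<equiv> Op Minus a b"
abbreviation mul_expr (infixl "\<otimes>" 70) where "a \<otimes> b \<equiv> Op Times a b"
abbreviation div_expr (infixl "\<oslash>" 70) where "a \<oslash> b \<equiv> Op Quotient a b"
abbreviation cell :: "int \<Rightarrow> expr" where "cell a \<equiv> Load (Lit a)"
abbreviation assign :: "int \<Rightarrow> expr \<Rightarrow> program" where "assign a e \<equiv> Store (Lit a) e"

primrec block :: "program list \<Rightarrow> program" where
  "block [] = Skip"
| "block (P # Ps) = Sequence P (block Ps)"

text \<open>One word length for the whole computation. With L the input size it must exceed 6 L^2 +
  5 L + 6 for the penalised table entries and 15 L + 10 for table indices; the other quantities are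
  shorter.\<close>

definition memory_bound :: "nat \<Rightarrow> nat" where
  "memory_bound L = 20 * (L + 1) ^ 2"

lemma poly_bounded_memory_bound: "poly_bounded memory_bound"
  unfolding memory_bound_def by (intro poly_bounded_intros)

lemma power_le_memory_bound:
  assumes "\<bar>z\<bar> < 2 ^ m" "m \<le> memory_bound L"
  shows "\<bar>z\<bar> < (2::int) ^ memory_bound L"
  using assms(1) power_increasing[OF assms(2), of "2::int"] by linarith

lemma size_le_memory_bound: "L \<le> memory_bound L"
  by (simp add: memory_bound_def power2_eq_square)

abbreviation word_bound :: "rrec_instance \<Rightarrow> int" where
  "word_bound I \<equiv> 2 ^ memory_bound (instance_size I)"

abbreviation word_bounded :: "rrec_instance \<Rightarrow> memory \<Rightarrow> bool" where
  "word_bounded I s \<equiv> bounded_memory (memory_bound (instance_size I)) s"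

definition header :: "rrec_instance \<Rightarrow> memory \<Rightarrow> bool" where
  "header I s \<longleftrightarrow> I \<in> rrec_instances \<and> word_bounded I s \<and>
     s 1 = int (num_items I) \<and> s 2 = int (num_selected I) \<and> s 3 = int (recovery I)"

lemma loop_triple:
  assumes "loop_free P" "poly_bounded M" "\<And>I. N I \<le> M (instance_size I)"
    and "\<And>I k s. Inv I k s \<Longrightarrow> word_bounded I s"
    and "\<And>I k s. Inv I k s \<Longrightarrow> k < N I \<Longrightarrow> expr_val e s > 0 \<and> Inv I (Suc k) (effect P s)"
    and "\<And>I s. Inv I (N I) s \<Longrightarrow> \<not> expr_val e s > 0"
  shows "poly_triple instance_size (\<lambda>I. Inv I 0) (WhilePositive e P) (\<lambda>I. Inv I (N I))"
  by (rule poly_triple_while[where Inv = Inv and N = N, OF assms(1) poly_bounded_memory_bound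
      assms(2)])
    (use assms(3-6) in auto)

text \<open>
  Non-negative cells keep the input layout. The scratch cells are: \<open>-1\<close> loop counter, \<open>-2\<close> scale,
  \<open>-3\<close> sum of squares, later the penalty, \<open>-4\<close> power of two, later a choice weight, \<open>-5\<close> radix,
  \<open>-6\<close> stride, \<open>-7\<close> table size, \<open>-8\<close> to \<open>-12\<close> the decoded table index \<open>e, w, u, v, i\<close>,
  \<open>-13\<close> candidate entry, \<open>-14\<close> and \<open>-15\<close> the choice \<open>x, j\<close>, \<open>-16\<close> the number of items plus one,
  \<open>-17\<close> the number of items, \<open>-18\<close> the excess of \<open>j\<close> over \<open>u\<close>, \<open>-19\<close> running minimum. Table entry \<open>q\<close>
  is in cell \<open>-100 - q\<close>.
\<close>

definition scale_init :: program where
  "scale_init = block [assign (-2) (Lit 1), assign (-1) (Lit 0)]"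

definition scale_body :: program where
  "scale_body = block
     [assign (-2) (cell (-2) \<otimes> Load (Lit 5 \<oplus> Lit 2 \<otimes> cell (-1)) \<otimes> (cell (-1) \<oplus> Lit 1) \<otimes> Lit 2),
      assign (-1) (cell (-1) \<oplus> Lit 1)]"

definition values_guard :: expr where
  "values_guard = Lit 3 \<otimes> cell 1 \<oplus> Lit 1 \<ominus> cell (-1)"

definition scale_inv :: "rrec_instance \<Rightarrow> nat \<Rightarrow> memory \<Rightarrow> bool" where
  "scale_inv I m s \<longleftrightarrow> header I s \<and> s (-1) = int m \<and> m \<le> value_count I \<and> s (-2) = scale_upto I m \<and>
     (\<forall>l < value_count I. s (4 + 2 * int l) = numer I l \<and> s (5 + 2 * int l) = denom I l)"

lemma header_update:
  assumes "header I s" "a \<notin> {1, 2, 3}" "\<bar>v\<bar> < word_bound I"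
  shows "header I (s(a := v))"
  using assms by (auto simp: header_def intro: bounded_memory_update)

lemma counter_bound:
  assumes "m \<le> instance_size I"
  shows "\<bar>int m\<bar> < word_bound I"
proof -
  have "\<bar>int m\<bar> < 2 ^ instance_size I" using int_less_power_size[OF assms] by simp
  then show ?thesis
    by (rule power_le_memory_bound) (simp add: memory_bound_def power2_eq_square)
qed

lemma scale_bound:
  assumes "m \<le> value_count I"
  shows "\<bar>scale_upto I m\<bar> < word_bound I"
proof -
  have "\<bar>scale_upto I m\<bar> < 2 ^ (3 * instance_size I ^ 2 + 1)"
    using scale_le[OF assms] scale_upto_pos[of I m] by simp
  then show ?thesis
    by (rule power_le_memory_bound) (simp add: memory_bound_def power2_eq_square)
qed

lemma scale_step:
  assumes "scale_inv I m s" "m < value_count I"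
  shows "expr_val values_guard s > 0 \<and> scale_inv I (Suc m) (effect scale_body s)"
proof -
  have d: "s (5 + 2 * int m) = denom I m" using assms by (simp add: scale_inv_def)
  have e: "effect scale_body s = s(-2 := scale_upto I (Suc m), -1 := int (Suc m))"
    using assms d by (simp add: scale_inv_def scale_body_def scale_upto_Suc add.commute)
  have "\<bar>scale_upto I (Suc m)\<bar> < word_bound I"
    using assms by (intro scale_bound) simp
  moreover have "\<bar>int (Suc m)\<bar> < word_bound I"
    using assms num_items_le_size[of I] by (intro counter_bound) simp
  ultimately have "header I (effect scale_body s)"
    unfolding e using assms by (intro header_update) (auto simp: scale_inv_def)
  then show ?thesis
    using assms unfolding e by (auto simp: scale_inv_def values_guard_def header_def)
qed

lemma header_bounded: "header I s \<Longrightarrow> word_bounded I s"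
  by (simp add: header_def)

lemma input_bounded:
  assumes "I \<in> rrec_instances"
  shows "header I (input_memory (encode_rrec I))"
proof -
  have "\<bar>input_memory (encode_rrec I) a\<bar> < 2 ^ instance_size I" for a
  proof -
    have "input_memory (encode_rrec I) a \<in> set (encode_rrec I) \<or>
        input_memory (encode_rrec I) a = int (length (encode_rrec I)) \<or> input_memory (encode_rrec
            I) a = 0"
      by (auto simp: input_memory_def)
    then show ?thesis
      using member_less_power_size[of _ I] int_less_power_size[of "length (encode_rrec I)" I]
        length_le_input_size[of "encode_rrec I"] by (auto simp: instance_size_def)
  qed
  then have "\<bar>input_memory (encode_rrec I) a\<bar> < word_bound I" for a
    using size_le_memory_bound by (rule power_le_memory_bound)
  then show ?thesis
    using assms input_memory_rrec(1-3)[of I] by (simp add: header_def bounded_memory_def)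
qed

definition start :: "rrec_instance \<Rightarrow> memory \<Rightarrow> bool" where
  "start I s \<longleftrightarrow> I \<in> rrec_instances \<and> s = input_memory (encode_rrec I)"

lemma scale_init_triple: "poly_triple instance_size start scale_init (\<lambda>I s. scale_inv I 0 s)"
proof (rule poly_triple_loop_free[OF _ poly_bounded_memory_bound])
  show "loop_free scale_init" by (simp add: scale_init_def)
  fix I s assume "start I s"
  then have I: "I \<in> rrec_instances" "s = input_memory (encode_rrec I)" by (auto simp: start_def)
  have h: "header I s" using input_bounded[OF I(1)] I(2) by simp
  have "header I (effect scale_init s)"
    unfolding scale_init_def using h counter_bound[of 0 I] counter_bound[of 1 I]
        num_items_le_size[of I]
    by (auto intro!: header_update)
  moreover have "s (4 + 2 * int l) = numer I l" "s (5 + 2 * int l) = denom I l" if "l <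
      value_count I" for l
    using input_memory_rrec(4,5)[OF that] I(2) by simp_all
  ultimately show "word_bounded I s \<and> scale_inv I 0 (effect scale_init s)"
    using header_bounded[OF h] by (auto simp: scale_inv_def scale_init_def scale_upto_def)
qed

lemma scale_triple:
  "poly_triple instance_size (\<lambda>I. scale_inv I 0) (WhilePositive values_guard scale_body) (\<lambda>I.
      scale_inv I (value_count I))"
  by (rule loop_triple[where Inv = scale_inv and N = value_count,
        OF _ poly_bounded_id value_count_le_size _ scale_step]) (auto simp: scale_body_def
            scale_inv_def values_guard_def header_def)

section \<open>Clearing the denominators in memory\<close>

definition scaling_init :: program where
  "scaling_init = block [assign (-1) (Lit 0), assign (-3) (cell (-2))]"

definition scaling_body :: program where
  "scaling_body = block
     [Store (Lit 4 \<oplus> Lit 2 \<otimes> cell (-1))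
        (Load (Lit 4 \<oplus> Lit 2 \<otimes> cell (-1)) \<otimes> cell (-2) \<oslash> Load (Lit 5 \<oplus> Lit 2 \<otimes> cell (-1))),
      assign (-3) (cell (-3) \<oplus>
        Load (Lit 4 \<oplus> Lit 2 \<otimes> cell (-1)) \<otimes> Load (Lit 4 \<oplus> Lit 2 \<otimes> cell (-1))),
      assign (-1) (cell (-1) \<oplus> Lit 1)]"

definition scaling_inv :: "rrec_instance \<Rightarrow> nat \<Rightarrow> memory \<Rightarrow> bool" where
  "scaling_inv I m s \<longleftrightarrow> header I s \<and> s (-1) = int m \<and> m \<le> value_count I \<and> s (-2) = scale I \<and>
     s (-3) = big_upto I m \<and>
     (\<forall>l < value_count I. s (4 + 2 * int l) = (if l < m then scaled I l else numer I l) \<and>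
        s (5 + 2 * int l) = denom I l)"

text \<open>Overwriting a numerator in place leaves all denominators intact.\<close>

lemma even_odd_neq: "4 + 2 * int l \<noteq> 5 + 2 * int m" "5 + 2 * int m \<noteq> 4 + 2 * int l"
  by presburger+

lemma big_bound:
  assumes "m \<le> value_count I"
  shows "\<bar>big_upto I m\<bar> < word_bound I"
  using cost_bound_less[OF assms]
  by (rule power_le_memory_bound) (simp add: memory_bound_def power2_eq_square)

lemma scaled_bound:
  assumes "l < value_count I"
  shows "\<bar>scaled I l\<bar> < word_bound I"
  using scaled_less[OF assms]
  by (rule power_le_memory_bound) (simp add: memory_bound_def power2_eq_square)

lemma scaling_init_triple:
  "poly_triple instance_size (\<lambda>I s. scale_inv I (value_count I) s) scaling_init (\<lambda>I s. scaling_inv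
      I 0 s)"
proof (rule poly_triple_loop_free[OF _ poly_bounded_memory_bound])
  show "loop_free scaling_init" by (simp add: scaling_init_def)
  fix I s assume inv: "scale_inv I (value_count I) s"
  then have h: "header I s" and d: "s (-2) = scale I" by (auto simp: scale_inv_def)
  have "header I (s(-1 := 0, -3 := scale I))"
    using h counter_bound[of 0 I] scale_bound[of "value_count I" I] by (auto intro!: header_update)
  then show "word_bounded I s \<and> scaling_inv I 0 (effect scaling_init s)"
    using header_bounded[OF h] inv d
    by (auto simp: scaling_inv_def scale_inv_def scaling_init_def big_upto_def)
qed

lemma scaling_step:
  assumes "scaling_inv I m s" "m < value_count I"
  shows "expr_val values_guard s > 0 \<and> scaling_inv I (Suc m) (effect scaling_body s)"
proof -
  have v: "s (5 + 2 * int m) = denom I m" "s (4 + 2 * int m) = numer I m"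
    using assms by (auto simp: scaling_inv_def)
  have e: "effect scaling_body s =
      s(4 + 2 * int m := scaled I m, -3 := big_upto I (Suc m), -1 := int (Suc m))"
    using assms v
    by (simp add: scaling_inv_def scaling_body_def big_upto_Suc scaled_def power2_eq_square
        add.commute)
  have "header I (effect scaling_body s)"
    unfolding e using assms counter_bound[of "Suc m" I] value_count_le_size[of I]
      scaled_bound[of m I] big_bound[of "Suc m" I]
    by (intro header_update) (auto simp: scaling_inv_def)
  then show ?thesis
    using assms unfolding e by (auto simp: scaling_inv_def values_guard_def header_def even_odd_neq)
qed

lemma scaling_triple:
  "poly_triple instance_size (\<lambda>I. scaling_inv I 0) (WhilePositive values_guard scaling_body) (\<lambda>I.
      scaling_inv I (value_count I))"
  by (rule loop_triple[where Inv = scaling_inv and N = value_count,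
        OF _ poly_bounded_id value_count_le_size _ scaling_step]) (auto simp: scaling_body_def
            scaling_inv_def values_guard_def header_def)

section \<open>Recording the selection in low-order bits\<close>

definition mask_init :: program where
  "mask_init = block [assign (-1) (Lit 0), assign (-4) (Lit 1)]"

definition items_guard :: expr where
  "items_guard = cell 1 \<ominus> cell (-1)"

text \<open>The offset is 6 rather than 4 because index 0 is the budget: in round m the first-stage
  cost of item m + 1 is changed.\<close>

definition mask_body :: program where
  "mask_body = block
     [Store (Lit 6 \<oplus> Lit 2 \<otimes> cell (-1)) (Load (Lit 6 \<oplus> Lit 2 \<otimes> cell (-1)) \<oplus> cell (-4)),
      assign (-4) (cell (-4) \<otimes> Lit 2),
      assign (-1) (cell (-1) \<oplus> Lit 1)]"

definition masked_upto :: "rrec_instance \<Rightarrow> nat \<Rightarrow> nat \<Rightarrow> int" where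
  "masked_upto I m l = scaled I l + (if 1 \<le> l \<and> l \<le> m then 2 ^ (l - 1) else 0)"

abbreviation masked :: "rrec_instance \<Rightarrow> nat \<Rightarrow> int" where
  "masked I \<equiv> masked_upto I (num_items I)"

definition mask_inv :: "rrec_instance \<Rightarrow> nat \<Rightarrow> memory \<Rightarrow> bool" where
  "mask_inv I m s \<longleftrightarrow> header I s \<and> s (-1) = int m \<and> m \<le> num_items I \<and> s (-2) = scale I \<and>
     s (-3) = cost_bound I \<and> s (-4) = 2 ^ m \<and> (\<forall>l < value_count I. s (4 + 2 * int l) = masked_upto
         I m l)"

lemma power_bound:
  assumes "m \<le> num_items I"
  shows "\<bar>2 ^ m\<bar> < word_bound I"
proof -
  have "(2::int) ^ m < 2 ^ instance_size I"
    using assms num_items_le_size[of I] by (intro power_strict_increasing) auto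
  then show ?thesis by (intro power_le_memory_bound[OF _ size_le_memory_bound]) simp
qed

lemma masked_bound:
  assumes "l < value_count I" "m \<le> num_items I"
  shows "\<bar>masked_upto I m l\<bar> < word_bound I"
proof -
  let ?L = "instance_size I"
  define Y :: int where "Y = 2 ^ (3 * ?L ^ 2 + ?L)"
  have "\<bar>scaled I l\<bar> < Y" unfolding Y_def by (rule scaled_less) fact
  moreover have "(2::int) ^ (l - 1) \<le> Y" if "l \<le> m"
    unfolding Y_def using that assms num_items_le_size[of I] by (intro power_increasing) auto
  moreover have "(0::int) < 2 ^ (l - 1)" by simp
  ultimately have "\<bar>masked_upto I m l\<bar> < 2 * Y"
    unfolding masked_upto_def by (split if_split) linarith
  then have "\<bar>masked_upto I m l\<bar> < 2 ^ (3 * ?L ^ 2 + ?L + 1)"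
    by (simp add: Y_def)
  then show ?thesis
    by (rule power_le_memory_bound) (simp add: memory_bound_def power2_eq_square)
qed

lemma mask_init_triple:
  "poly_triple instance_size (\<lambda>I s. scaling_inv I (value_count I) s) mask_init (\<lambda>I s. mask_inv I 0
      s)"
proof (rule poly_triple_loop_free[OF _ poly_bounded_memory_bound])
  show "loop_free mask_init" by (simp add: mask_init_def)
  fix I s assume inv: "scaling_inv I (value_count I) s"
  then have h: "header I s" by (auto simp: scaling_inv_def)
  have "header I (s(-1 := 0, -4 := 1))"
    using h counter_bound[of 0 I] counter_bound[of 1 I] num_items_le_size[of I] by (auto intro!:
        header_update)
  then show "word_bounded I s \<and> mask_inv I 0 (effect mask_init s)"
    using header_bounded[OF h] inv
    by (auto simp: scaling_inv_def mask_inv_def mask_init_def masked_upto_def)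
qed

lemma mask_step:
  assumes "mask_inv I m s" "m < num_items I"
  shows "expr_val items_guard s > 0 \<and> mask_inv I (Suc m) (effect mask_body s)"
proof -
  have shift: "6 + 2 * int m = 4 + 2 * int (Suc m)" by simp
  have v: "s (6 + 2 * int m) = masked_upto I m (Suc m)"
  proof -
    have "Suc m < value_count I" using assms(2) by simp
    then show ?thesis unfolding shift using assms(1) unfolding mask_inv_def by blast
  qed
  have w: "masked_upto I (Suc m) (Suc m) = masked_upto I m (Suc m) + 2 ^ m"
    by (simp add: masked_upto_def)
  have e: "effect mask_body s =
      s(4 + 2 * int (Suc m) := masked_upto I (Suc m) (Suc m), -4 := 2 ^ Suc m, -1 := int (Suc m))"
    using assms v w
    by (simp add: mask_inv_def mask_body_def add.commute[of _ "1 :: int"] mult.commute[of _ "2 ::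
        int"])
  have "header I (effect mask_body s)"
    unfolding e using assms counter_bound[of "Suc m" I] value_count_le_size[of I]
      masked_bound[of "Suc m" I "Suc m"] power_bound[of "Suc m" I]
    by (intro header_update) (auto simp: mask_inv_def)
  moreover have "masked_upto I (Suc m) l = masked_upto I m l" if "l \<noteq> Suc m" for l
    using that by (auto simp: masked_upto_def)
  moreover have "2 * int l = 2 + 2 * int m \<longleftrightarrow> l = Suc m" for l by presburger
  ultimately show ?thesis
    using assms unfolding e by (auto simp: mask_inv_def items_guard_def header_def)
qed

lemma mask_triple:
  "poly_triple instance_size (\<lambda>I. mask_inv I 0) (WhilePositive items_guard mask_body) (\<lambda>I.
      mask_inv I (num_items I))"
  by (rule loop_triple[where Inv = mask_inv and N = num_items,
        OF _ poly_bounded_id num_items_le _ mask_step]) (auto simp: mask_body_def mask_inv_def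
            items_guard_def header_def)


section \<open>The dynamic programming table\<close>

definition radix :: "nat \<Rightarrow> nat" where "radix n = 2 * n * n + 2"
definition stride :: "nat \<Rightarrow> nat" where "stride n = radix n * radix n * radix n"

text \<open>The coordinate e is padded to the range \<open>stride\<close> so that one divisor
  decodes both w and e. Padded entries repeat the value at the last proper choice.\<close>

definition table_size :: "nat \<Rightarrow> nat" where
  "table_size n = (n + 1) * (n + 1) * (n + 1) * stride n * stride n"

text \<open>The size ensures that a penalty reduced by n choice costs still exceeds every genuine
  total; \<open>penalty_margin\<close> gives the inequality behind the factor 8 (n + 1)^2.\<close>

definition penalty :: "rrec_instance \<Rightarrow> int" where
  "penalty I = 8 * cost_bound I * (int (num_items I) + 1) * (int (num_items I) + 1)"

text \<open>The choice \<open>e\<close> for an item encodes \<open>x = e mod 2\<close> and \<open>j = e div 2\<close>.\<close>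

definition choice_weight :: "nat \<Rightarrow> nat \<Rightarrow> nat \<Rightarrow> nat" where
  "choice_weight n v e =
     (e mod 2) * radix n * radix n + (e div 2) * radix n + (e mod 2) * (v - e div 2)"

text \<open>Only the recovery part is divided by v. Its data carry no recorded bits, so for 1 \<le>
  v \<le> n the division is exact.\<close>

definition choice_cost :: "rrec_instance \<Rightarrow> nat \<Rightarrow> nat \<Rightarrow> nat \<Rightarrow> nat \<Rightarrow> int" where
  "choice_cost I v u i e = int (e mod 2) * masked I i +
     (masked I (num_items I + i) * int (e div 2) +
      (masked I (2 * num_items I + i) - masked I (num_items I + i)) * max 0 (int (e div 2) - int
          u)) div int v"

definition budget_cost :: "rrec_instance \<Rightarrow> nat \<Rightarrow> nat \<Rightarrow> nat \<Rightarrow> int" where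
  "budget_cost I v u w = (if w \<le> recovery I * v then masked I 0 * int u div int v else penalty I)"

abbreviation opt_table :: "rrec_instance \<Rightarrow> nat \<Rightarrow> nat \<Rightarrow> nat \<Rightarrow> nat \<Rightarrow> nat \<Rightarrow> int" where
  "opt_table I v u \<equiv> knapsack (penalty I) (budget_cost I v u) (choice_weight (num_items I) v)
     (2 * v + 1) (choice_cost I v u)"

text \<open>The item index is the most significant digit and the choice the least, so the preceding
  row is complete before a row starts and the entry for e - 1 is the immediate predecessor of that
  for e.\<close>

definition table_index :: "nat \<Rightarrow> nat \<Rightarrow> nat \<Rightarrow> nat \<Rightarrow> nat \<Rightarrow> nat \<Rightarrow> nat" where
  "table_index n i v u w e = (((i * (n + 1) + v) * (n + 1) + u) * stride n + w) * stride n + e"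

definition table :: "rrec_instance \<Rightarrow> nat \<Rightarrow> int" where
  "table I q = (let n = num_items I; q1 = q div stride n; q2 = q1 div stride n; q3 = q2 div (n + 1)
     in opt_table I (q3 mod (n + 1)) (q2 mod (n + 1)) (q3 div (n + 1)) (q1 mod stride n) (q mod
         stride n))"

section \<open>Index arithmetic and size bounds for the table\<close>

lemma radix_pos: "radix n > 0" by (simp add: radix_def)
lemma stride_pos: "stride n > 0" by (simp add: stride_def radix_pos)

lemma table_table_index:
  assumes "v \<le> num_items I" "u \<le> num_items I" "w < stride (num_items I)" "e < stride (num_items I)"
  shows "table I (table_index (num_items I) i v u w e) = opt_table I v u i w e"
proof -
  have digits: "q div S mod S = w \<and> q mod S = e \<and> q div S div S mod V = u \<and>
      q div S div S div V mod V = v \<and> q div S div S div V div V = i"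
    if "q = (((i * V + v) * V + u) * S + w) * S + e" "v < V" "u < V" "w < S" "e < S" for q V S ::
        nat
    using that by simp
  show ?thesis
    unfolding table_def Let_def
    using digits[OF table_index_def[of "num_items I" i v u w e]] assms
    by (simp only: less_Suc_eq_le Suc_eq_plus1[symmetric])
qed

lemma table_index_cases:
  assumes "q < table_size n"
  obtains i v u w e where "q = table_index n i v u w e" "i \<le> n" "v \<le> n" "u \<le> n" "w < stride n" "e
      < stride n"
proof -
  let ?q1 = "q div stride n" let ?q2 = "?q1 div stride n" let ?q3 = "?q2 div (n + 1)"
  have "?q3 div (n + 1) < n + 1"
    using assms by (simp add: table_size_def div_mult2_eq[symmetric] less_mult_imp_div_less
        mult_ac del: Suc_eq_plus1 add_Suc_right)
  moreover have "q = table_index n (?q3 div (n + 1)) (?q3 mod (n + 1)) (?q2 mod (n + 1)) (?q1 mod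
      stride n) (q mod stride n)"
    unfolding table_index_def by (simp only: div_mult_mod_eq)
  moreover have "a mod (n + 1) \<le> n" for a using mod_less_divisor[of "n + 1" a] by linarith
  ultimately show thesis using stride_pos[of n]
    by (intro that[of "?q3 div (n + 1)" "?q3 mod (n + 1)" "?q2 mod (n + 1)" "?q1 mod stride n" "q
        mod stride n"]) auto
qed

lemma power_15_eq:
  "m * m * m * ((2 * (m * m)) * (2 * (m * m)) * (2 * (m * m))) * ((2 * (m * m)) * (2 * (m * m)) *
      (2 * (m * m))) =
     64 * m ^ 15" for m :: nat
  by (simp add: power_numeral_reduce mult_ac)

text \<open>The radix is at most 2 (n + 1)^2 and a stride at most 8 (n + 1)^6; three counters and
  two strides give degree 3 + 6 + 6.\<close>

lemma table_size_le: "table_size n \<le> 64 * (n + 1) ^ 15"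
proof -
  have r: "radix n \<le> 2 * ((n + 1) * (n + 1))" by (simp add: radix_def)
  have "stride n \<le> (2 * ((n + 1) * (n + 1))) * (2 * ((n + 1) * (n + 1))) * (2 * ((n + 1) * (n +
      1)))"
    unfolding stride_def by (intro mult_le_mono r)
  then have "table_size n \<le> (n + 1) * (n + 1) * (n + 1) *
      ((2 * ((n + 1) * (n + 1))) * (2 * ((n + 1) * (n + 1))) * (2 * ((n + 1) * (n + 1)))) *
      ((2 * ((n + 1) * (n + 1))) * (2 * ((n + 1) * (n + 1))) * (2 * ((n + 1) * (n + 1))))"
    unfolding table_size_def by (intro mult_le_mono) auto
  also have "\<dots> = 64 * (n + 1) ^ 15" by (rule power_15_eq)
  finally show ?thesis .
qed

lemma small_bound:
  assumes "\<bar>z\<bar> \<le> 8 * int (table_size (num_items I))"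
  shows "\<bar>z\<bar> < word_bound I"
proof -
  let ?L = "instance_size I"
  have "num_items I + 1 \<le> ?L" using num_items_le_size[of I] by simp
  also have "?L < 2 ^ ?L" by (rule less_exp)
  finally have "(num_items I + 1) ^ 15 \<le> (2 ^ ?L) ^ 15" by (intro power_mono) auto
  then have "table_size (num_items I) \<le> 64 * 2 ^ (15 * ?L)"
    using table_size_le[of "num_items I"] by (simp add: power_mult[symmetric] mult.commute)
  then have "int (table_size (num_items I)) \<le> 64 * 2 ^ (15 * ?L)"
    by (metis of_nat_le_iff of_nat_mult of_nat_numeral of_nat_power)
  moreover have "(2::int) ^ (15 * ?L + 10) = 1024 * 2 ^ (15 * ?L)" by (simp add: power_add)
  moreover have "(0::int) < 2 ^ (15 * ?L)" by simp
  ultimately have "\<bar>z\<bar> < 2 ^ (15 * ?L + 10)" using assms by linarith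
  then show ?thesis
    by (rule power_le_memory_bound) (simp add: memory_bound_def power2_eq_square)
qed

lemma cost_bound_nonneg: "0 \<le> cost_bound I"
  using abs_scaled_le[of 0 I] by simp

lemma masked_le:
  assumes "l < value_count I"
  shows "\<bar>masked I l\<bar> \<le> 2 * cost_bound I"
    and "l = 0 \<or> l > num_items I \<Longrightarrow> \<bar>masked I l\<bar> \<le> cost_bound I"
proof -
  have s: "\<bar>scaled I l\<bar> \<le> cost_bound I" by (rule abs_scaled_le) fact
  have "(2::int) ^ (l - 1) \<le> cost_bound I" if "l \<le> num_items I"
  proof -
    have "(2::int) ^ (l - 1) \<le> 2 ^ num_items I" using that by (intro power_increasing) auto
    then show ?thesis using power_num_items_le[of I] by linarith
  qed
  moreover have "(0::int) < 2 ^ (l - 1)" by simp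
  ultimately show "\<bar>masked I l\<bar> \<le> 2 * cost_bound I"
    using s cost_bound_nonneg[of I] unfolding masked_upto_def by (split if_split) linarith
  show "\<bar>masked I l\<bar> \<le> cost_bound I" if "l = 0 \<or> l > num_items I"
    using that s by (auto simp: masked_upto_def)
qed

text \<open>The recorded bit at most doubles the first-stage bound; the lower cost contributes n
  times the bound and the deviation, a difference of two costs, 2 n times.\<close>

lemma choice_cost_le:
  assumes "i \<in> {1..num_items I}" "v \<le> num_items I" "e \<le> 2 * v + 1"
  shows "\<bar>choice_cost I v u i e\<bar> \<le> 3 * cost_bound I * (int (num_items I) + 1)"
proof -
  let ?n = "num_items I" and ?j = "e div 2"
  let ?m = "max 0 (int ?j - int u)"
  have j: "0 \<le> int ?j" "int ?j \<le> int ?n" "0 \<le> ?m" "?m \<le> int ?n" using assms by auto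
  have c: "\<bar>masked I i\<bar> \<le> 2 * cost_bound I" "\<bar>masked I (?n + i)\<bar> \<le> cost_bound I"
    "\<bar>masked I (2 * ?n + i)\<bar> \<le> cost_bound I"
    using assms masked_le(1)[of i I] masked_le(2)[of "?n + i" I] masked_le(2)[of "2 * ?n + i" I]
    by auto
  have "\<bar>int (e mod 2) * masked I i\<bar> \<le> 1 * (2 * cost_bound I)"
    unfolding abs_mult using c(1) by (intro mult_mono) auto
  moreover have "\<bar>masked I (?n + i) * int ?j\<bar> \<le> cost_bound I * int ?n"
    unfolding abs_mult using c j cost_bound_nonneg[of I] by (intro mult_mono) auto
  moreover have "\<bar>(masked I (2 * ?n + i) - masked I (?n + i)) * ?m\<bar> \<le> (2 * cost_bound I) * int ?n"
    unfolding abs_mult using c j cost_bound_nonneg[of I] by (intro mult_mono) auto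
  moreover have triangle: "\<bar>A + (P + Q) div int v\<bar> \<le> a + (b + c)"
    if "\<bar>A\<bar> \<le> a" "\<bar>P\<bar> \<le> b" "\<bar>Q\<bar> \<le> c" for A P Q a b c :: int
    using that abs_div_le[of "P + Q" "int v"] by linarith
  ultimately have "\<bar>choice_cost I v u i e\<bar> \<le> 1 * (2 * cost_bound I) + (cost_bound I * int ?n + (2
      * cost_bound I) * int ?n)"
    unfolding choice_cost_def by (intro triangle)
  then show ?thesis using cost_bound_nonneg[of I] by (simp add: algebra_simps)
qed

lemma budget_value_le:
  assumes "u \<le> num_items I"
  shows "\<bar>masked I 0 * int u div int v\<bar> \<le> cost_bound I * int (num_items I)"
proof -
  have "\<bar>masked I 0 * int u div int v\<bar> \<le> \<bar>masked I 0 * int u\<bar>" by (rule abs_div_le)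
  also have "\<dots> \<le> cost_bound I * int (num_items I)"
    unfolding abs_mult using assms masked_le(2)[of 0 I] by (intro mult_mono) auto
  finally show ?thesis .
qed

lemma penalty_nonneg: "0 \<le> penalty I"
  unfolding penalty_def by (intro mult_nonneg_nonneg cost_bound_nonneg) auto

lemma penalty_margin:
  "2 * int (num_items I) * (3 * cost_bound I * (int (num_items I) + 1)) + cost_bound I * int
      (num_items I) \<le> penalty I"
proof -
  let ?c = "cost_bound I" and ?n = "int (num_items I)"
  \<comment> \<open>The polynomial is 8 (n + 1)^2 - 6 n (n + 1) - n.\<close>
  have "0 \<le> ?c * (2 * ?n * ?n + 9 * ?n + 8)"
    by (rule mult_nonneg_nonneg[OF cost_bound_nonneg]) simp
  then show ?thesis by (simp add: penalty_def algebra_simps)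
qed

lemma opt_table_le:
  assumes "v \<le> num_items I" "u \<le> num_items I" "i \<le> num_items I"
  shows "\<bar>opt_table I v u i w e\<bar> \<le> 2 * penalty I"
proof -
  let ?X = "3 * cost_bound I * (int (num_items I) + 1)"
  have X: "0 \<le> ?X" using cost_bound_nonneg[of I] by simp
  have m: "int (num_items I) * ?X + cost_bound I * int (num_items I) \<le> penalty I"
    using penalty_margin[of I] X mult_nonneg_nonneg[OF of_nat_0_le_iff X, of "num_items I"] by
        linarith
  have "\<bar>masked I 0 * int u div int v\<bar> \<le> penalty I"
    using budget_value_le[OF assms(2), of v] m mult_nonneg_nonneg[OF of_nat_0_le_iff X, of
        "num_items I"]
    by linarith
  then have b: "\<bar>budget_cost I v u w\<bar> \<le> penalty I" for w
    using penalty_nonneg[of I] by (simp only: budget_cost_def split: if_split) simp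
  have "\<bar>opt_table I v u i w e\<bar> \<le> penalty I + int i * ?X"
    by (rule abs_knapsack_le) (use choice_cost_le assms b penalty_nonneg[of I] in auto)
  moreover have "int i * ?X \<le> int (num_items I) * ?X" using assms(3) X by (intro mult_right_mono)
      auto
  moreover have "0 \<le> cost_bound I * int (num_items I)" using cost_bound_nonneg[of I] by simp
  ultimately show ?thesis using m by linarith
qed

lemma penalty_bound:
  assumes "\<bar>z\<bar> \<le> 2 * penalty I"
  shows "\<bar>z\<bar> < word_bound I"
proof -
  let ?n = "int (num_items I) + 1"
  define L where "L = instance_size I"
  define E where "E = 6 * L ^ 2 + 3 * L + 1"
  have n: "?n \<le> 2 ^ L"
    using int_less_power_size[of "num_items I + 1" I] num_items_le_size[of I] by (simp add: L_def)
  have "cost_bound I \<le> 2 ^ E" using cost_bound_less[of "value_count I" I] unfolding E_def L_def by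
      linarith
  then have "8 * cost_bound I * ?n * ?n \<le> 8 * 2 ^ E * 2 ^ L * 2 ^ L"
    using n cost_bound_nonneg[of I] by (intro mult_mono mult_nonneg_nonneg) auto
  also have "\<dots> = 8 * 2 ^ (E + 2 * L)" by (simp add: power_add mult_2)
  finally have "penalty I \<le> 8 * 2 ^ (E + 2 * L)" by (simp only: penalty_def)
  moreover have "(2::int) ^ (E + 2 * L + 5) = 32 * 2 ^ (E + 2 * L)" by (simp add: power_add)
  moreover have "(0::int) < 2 ^ (E + 2 * L)" by simp
  ultimately have "\<bar>z\<bar> < 2 ^ (E + 2 * L + 5)" using assms by linarith
  then show ?thesis unfolding L_def[symmetric]
    by (rule power_le_memory_bound) (simp add: memory_bound_def E_def power2_eq_square)
qed


section \<open>Filling the table\<close>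

definition setup_body :: program where
  "setup_body = block
     [assign (-3) (Lit 8 \<otimes> cell (-3) \<otimes> (cell 1 \<oplus> Lit 1) \<otimes> (cell 1 \<oplus> Lit 1)),
      assign (-5) (Lit 2 \<otimes> cell 1 \<otimes> cell 1 \<oplus> Lit 2),
      assign (-6) (cell (-5) \<otimes> cell (-5) \<otimes> cell (-5)),
      assign (-16) (cell 1 \<oplus> Lit 1),
      assign (-7) (cell (-16) \<otimes> cell (-16) \<otimes> cell (-16) \<otimes> cell (-6) \<otimes> cell (-6)),
      assign (-1) (Lit 0)]"

definition decode_body :: program where
  "decode_body = block
     [assign (-8) (cell (-1) \<ominus> cell (-6) \<otimes> (cell (-1) \<oslash> cell (-6))),
      assign (-9) (cell (-1) \<oslash> cell (-6)),
      assign (-10) (cell (-9) \<oslash> cell (-6)),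
      assign (-9) (cell (-9) \<ominus> cell (-6) \<otimes> cell (-10)),
      assign (-11) (cell (-10) \<oslash> cell (-16)),
      assign (-10) (cell (-10) \<ominus> cell (-16) \<otimes> cell (-11)),
      assign (-12) (cell (-11) \<oslash> cell (-16)),
      assign (-11) (cell (-11) \<ominus> cell (-16) \<otimes> cell (-12)),
      assign (-13) (cell (-3))]"

definition weight_body :: program where
  "weight_body = block
     [assign (-14) (cell (-8) \<ominus> Lit 2 \<otimes> (cell (-8) \<oslash> Lit 2)),
      assign (-15) (cell (-8) \<oslash> Lit 2),
      IfPositive (cell (-15) \<ominus> cell (-10))
        (assign (-18) (cell (-15) \<ominus> cell (-10))) (assign (-18) (Lit 0)),
      assign (-4) (cell (-14) \<otimes> cell (-5) \<otimes> cell (-5) \<oplus> cell (-15) \<otimes> cell (-5) \<oplus>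
        cell (-14) \<otimes> (cell (-11) \<ominus> cell (-15)))]"

text \<open>The address is obtained from the current index by differences: (n + 1)^2 * stride^2
  steps back one item, the weight times the stride lowers the capacity, and replacing e by 2 * v + 1
  selects the minimum over all choices.\<close>

definition candidate_expr :: expr where
  "candidate_expr =
     Load (Lit (-100) \<ominus> (cell (-1) \<ominus> cell (-16) \<otimes> cell (-16) \<otimes> cell (-6) \<otimes> cell (-6) \<ominus>
       cell (-4) \<otimes> cell (-6) \<ominus> cell (-8) \<oplus> Lit 2 \<otimes> cell (-11) \<oplus> Lit 1)) \<oplus>
     (cell (-14) \<otimes> Load (Lit 4 \<oplus> Lit 2 \<otimes> cell (-12)) \<oplus>
      (Load (Lit 4 \<oplus> Lit 2 \<otimes> (cell 1 \<oplus> cell (-12))) \<otimes> cell (-15) \<oplus>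
       (Load (Lit 4 \<oplus> Lit 2 \<otimes> (Lit 2 \<otimes> cell 1 \<oplus> cell (-12))) \<ominus>
        Load (Lit 4 \<oplus> Lit 2 \<otimes> (cell 1 \<oplus> cell (-12)))) \<otimes> cell (-18)) \<oslash> cell (-11))"

text \<open>The guards test j \<le> v and weight \<le> w; adding one turns the strict positivity
  test into a weak inequality. If a test fails, cell -13 keeps the penalty set during
  decoding.\<close>

definition candidate_body :: program where
  "candidate_body =
     IfPositive (cell (-11) \<oplus> Lit 1 \<ominus> cell (-15))
       (IfPositive (cell (-9) \<oplus> Lit 1 \<ominus> cell (-4)) (assign (-13) candidate_expr) Skip) Skip"

definition previous_expr :: expr where
  "previous_expr = Load (Lit (-100) \<ominus> (cell (-1) \<ominus> Lit 1))"

definition minimum_body :: program where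
  "minimum_body =
     IfPositive (cell (-8))
       (IfPositive (cell (-13) \<ominus> previous_expr) (assign (-13) previous_expr) Skip)
       (IfPositive (cell (-13) \<ominus> cell (-3)) (assign (-13) (cell (-3))) Skip)"

definition base_body :: program where
  "base_body =
     IfPositive (cell 3 \<otimes> cell (-11) \<oplus> Lit 1 \<ominus> cell (-9))
       (assign (-13) (Load (Lit 4) \<otimes> cell (-10) \<oslash> cell (-11))) Skip"

definition entry_body :: program where
  "entry_body = IfPositive (cell (-12)) (block [weight_body, candidate_body, minimum_body])
      base_body"

definition table_body :: program where
  "table_body = block
     [decode_body, entry_body,
      Store (Lit (-100) \<ominus> cell (-1)) (cell (-13)),
      assign (-1) (cell (-1) \<oplus> Lit 1)]"

definition table_guard :: expr where
  "table_guard = cell (-7) \<ominus> cell (-1)"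

definition context_cells :: "rrec_instance \<Rightarrow> memory \<Rightarrow> bool" where
  "context_cells I s \<longleftrightarrow> header I s \<and> s (-2) = scale I \<and> s (-3) = penalty I \<and>
     s (-5) = int (radix (num_items I)) \<and> s (-6) = int (stride (num_items I)) \<and>
     s (-16) = int (num_items I) + 1 \<and> s (-7) = int (table_size (num_items I)) \<and>
     (\<forall>l < value_count I. s (4 + 2 * int l) = masked I l)"

definition table_inv :: "rrec_instance \<Rightarrow> nat \<Rightarrow> memory \<Rightarrow> bool" where
  "table_inv I q s \<longleftrightarrow> context_cells I s \<and> s (-1) = int q \<and> q \<le> table_size (num_items I) \<and>
     (\<forall>r < q. s (-100 - int r) = table I r)"

section \<open>Index shifts and the effect of one round\<close>

lemma table_index_Suc:
  assumes "W \<le> w"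
  shows "int (table_index n (Suc i) v u w e) - (int n + 1) * (int n + 1) * int (stride n) * int
      (stride n)
     - int W * int (stride n) - int e + d = int (table_index n i v u (w - W) 0) + d"
proof -
  obtain w' where "w = W + w'" using assms le_Suc_ex by blast
  then show ?thesis by (simp add: table_index_def algebra_simps)
qed

lemma table_index_mono:
  assumes "i \<le> i'" "v \<le> v'" "u \<le> u'" "w \<le> w'" "e \<le> e'"
  shows "table_index n i v u w e \<le> table_index n i' v' u' w' e'"
  unfolding table_index_def using assms by (intro add_mono mult_le_mono1)

text \<open>Each digit stays below its range, so successive carries from e up to v reach at most the
  start of the next row.\<close>

lemma table_index_less:
  assumes "v \<le> n" "u \<le> n" "w < stride n" "e < stride n"
  shows "table_index n i v u w e < table_index n (Suc i) 0 0 0 0"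
proof -
  have "table_index n i v u w e < table_index n i v u w (stride n)"
    using assms(4) by (simp add: table_index_def)
  also have "\<dots> \<le> table_index n i v u (stride n) 0"
    using assms(3) mult_le_mono1[of "Suc w" "stride n" "stride n"] by (simp add: table_index_def
        algebra_simps)
  also have "\<dots> \<le> table_index n i v (n + 1) 0 0"
    using assms(2) mult_le_mono1[of "Suc u" "n + 1" "stride n * stride n"]
    by (simp add: table_index_def algebra_simps)
  also have "\<dots> \<le> table_index n i (n + 1) 0 0 0"
    using assms(1) mult_le_mono1[of "Suc v" "n + 1" "(n + 1) * stride n * stride n"]
    by (simp add: table_index_def algebra_simps)
  also have "\<dots> = table_index n (Suc i) 0 0 0 0" by (simp add: table_index_def algebra_simps)
  finally show ?thesis .
qed

lemma decode_effect:
  assumes c: "context_cells I s" "s (-1) = int (table_index (num_items I) i v u w e)"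
    and "v \<le> num_items I" "u \<le> num_items I" "w < stride (num_items I)" "e < stride (num_items I)"
  shows "effect decode_body s = s(-8 := int e, -9 := int w, -10 := int u, -11 := int v,
     -12 := int i, -13 := penalty I)"
proof -
  define S where "S = int (stride (num_items I))"
  define V where "V = int (num_items I) + 1"
  define q3 where "q3 = int i * V + int v"
  define q2 where "q2 = q3 * V + int u"
  define q1 where "q1 = q2 * S + int w"
  define q where "q = q1 * S + int e"
  have b: "int e < S" "int w < S" "int u < V" "int v < V" using assms by (auto simp: S_def V_def)
  have div: "q div S = q1" "q1 div S = q2" "q2 div V = q3" "q3 div V = int i"
    using b by (simp_all add: q_def q1_def q2_def q3_def)
  have sub: "q - S * q1 = int e" "q1 - S * q2 = int w" "q2 - V * q3 = int u" "q3 - V * int i = int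
      v"
    by (simp_all add: q_def q1_def q2_def q3_def)
  have "int (table_index (num_items I) i v u w e) = q"
    unfolding q_def q1_def q2_def q3_def S_def V_def table_index_def by (simp add: algebra_simps)
  then have cells: "s (-1) = q" "s (-6) = S" "s (-16) = V" "s (-3) = penalty I"
    using c by (simp_all add: context_cells_def S_def V_def)
  have "effect decode_body s = s(-8 := int e, -9 := q1, -10 := q2, -9 := int w, -11 := q3, -10 :=
      int u,
      -12 := int i, -11 := int v, -13 := penalty I)"
    unfolding decode_body_def by (simp add: cells div sub)
  then show ?thesis by (auto simp: fun_eq_iff)
qed

lemma weight_effect:
  assumes "s (-8) = int e" "s (-10) = int u" "s (-11) = int v" "s (-5) = int R"
  shows "effect weight_body s = s(-14 := int (e mod 2), -15 := int (e div 2),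
     -18 := max 0 (int (e div 2) - int u),
     -4 := int (e mod 2) * int R * int R + int (e div 2) * int R + int (e mod 2) * (int v - int (e
         div 2)))"
proof -
  have "int e - 2 * (int e div 2) = int (e mod 2)" "int e div 2 = int (e div 2)"
    by (simp_all add: zmod_int zdiv_int minus_mult_div_eq_mod)
  then show ?thesis
    using assms by (simp add: weight_body_def max_def)
qed

lemma candidate_effect:
  assumes c: "context_cells I s"
    and q: "s (-1) = int (table_index (num_items I) (Suc i) v u w e)" and i: "Suc i \<le> num_items I"
    and T: "\<And>r. r < table_index (num_items I) (Suc i) v u w e \<Longrightarrow> s (-100 - int r) = table I r"
    and b: "v \<le> num_items I" "u \<le> num_items I" "w < stride (num_items I)" "e < stride (num_items I)"
    and l: "s (-8) = int e" "s (-9) = int w" "s (-10) = int u" "s (-11) = int v" "s (-12) = int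
        (Suc i)"
    and m: "s (-14) = int (e mod 2)" "s (-15) = int (e div 2)" "s (-18) = max 0 (int (e div 2) -
        int u)"
      "s (-4) = int (e mod 2) * int (radix (num_items I)) * int (radix (num_items I)) +
         int (e div 2) * int (radix (num_items I)) + int (e mod 2) * (int v - int (e div 2))"
    and p: "s (-13) = penalty I"
  shows "effect candidate_body s = s(-13 :=
     (if e \<le> 2 * v + 1 \<and> choice_weight (num_items I) v e \<le> w
      then opt_table I v u i (w - choice_weight (num_items I) v e) (2 * v + 1) + choice_cost I v u
          (Suc i) e
      else penalty I))"
proof (cases "e \<le> 2 * v + 1")
  case False
  then have "\<not> int v + 1 - int (e div 2) > 0" by linarith
  then show ?thesis using False l m p by (simp add: candidate_body_def fun_upd_idem)
next
  case e: True
  let ?n = "num_items I" and ?W = "choice_weight (num_items I) v e"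
  have j: "e div 2 \<le> v" using e by linarith
  have W: "s (-4) = int ?W"
    unfolding m(4) choice_weight_def using j by (simp add: of_nat_diff)
  have jpos: "int v + 1 - int (e div 2) > 0" using j by linarith
  show ?thesis
  proof (cases "?W \<le> w")
    case False
    then have "\<not> int w + 1 - int ?W > 0" by linarith
    then show ?thesis using False l m(2) W p jpos by (simp add: candidate_body_def fun_upd_idem)
  next
    case w: True
    have n1: "1 \<le> ?n" using i by simp
    have stride_ge: "2 * v + 1 < stride ?n"
    proof -
      have "?n \<le> ?n * ?n" by (rule le_square)
      then have "2 * v + 1 < radix ?n" unfolding radix_def mult.assoc using b(1) by linarith
      also have "radix ?n \<le> stride ?n" using radix_pos[of ?n] by (simp add: stride_def)
      finally show ?thesis .
    qed
    let ?r = "table_index ?n i v u (w - ?W) (2 * v + 1)"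
    have r: "?r = table_index ?n i v u (w - ?W) 0 + (2 * v + 1)" by (simp add: table_index_def)
    \<comment> \<open>The entry to be read lies in the preceding row and has therefore been
      stored.\<close>
    have "?r < table_index ?n (Suc i) v u w e"
    proof -
      have "?r < table_index ?n (Suc i) 0 0 0 0"
        using b(1-3) stride_ge by (intro table_index_less) auto
      also have "\<dots> \<le> table_index ?n (Suc i) v u w e" by (rule table_index_mono) simp_all
      finally show ?thesis .
    qed
    from T[OF this] have t: "s (-100 - int ?r) = opt_table I v u i (w - ?W) (2 * v + 1)"
      using table_table_index[of v I u "w - ?W" "2 * v + 1" i] b stride_ge by simp
    have addr: "int (table_index ?n (Suc i) v u w e) - (int ?n + 1) * (int ?n + 1) * int (stride
        ?n) * int (stride ?n)
        - int ?W * int (stride ?n) - int e + 2 * int v + 1 = int ?r"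
      unfolding r using table_index_Suc[OF w, of ?n i v u e "2 * int v + 1"] by linarith
    have vals: "s (4 + 2 * int (Suc i)) = masked I (Suc i)"
      "s (4 + 2 * (int ?n + int (Suc i))) = masked I (?n + Suc i)"
      "s (4 + 2 * (2 * int ?n + int (Suc i))) = masked I (2 * ?n + Suc i)"
    proof -
      have v: "s (4 + 2 * int l) = masked I l" if "l < value_count I" for l
        using c that by (simp add: context_cells_def)
      show "s (4 + 2 * int (Suc i)) = masked I (Suc i)" by (rule v) (use i in simp)
      show "s (4 + 2 * (int ?n + int (Suc i))) = masked I (?n + Suc i)"
        using v[of "?n + Suc i"] i by (simp add: algebra_simps)
      show "s (4 + 2 * (2 * int ?n + int (Suc i))) = masked I (2 * ?n + Suc i)"
        using v[of "2 * ?n + Suc i"] i by (simp add: algebra_simps)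
    qed
    have "expr_val candidate_expr s =
        opt_table I v u i (w - ?W) (2 * v + 1) + choice_cost I v u (Suc i) e"
    proof -
      have n: "s 1 = int ?n" "s (-16) = int ?n + 1" "s (-6) = int (stride ?n)"
        using c by (simp_all add: context_cells_def header_def)
      show ?thesis
        unfolding candidate_expr_def expr_val.simps apply_op.simps n q W l m(1-3) addr t vals
            choice_cost_def ..
    qed
    then show ?thesis using w e l m(2) W jpos by (simp add: candidate_body_def)
  qed
qed

lemma minimum_effect:
  assumes "s (-1) = int q" "s (-8) = int e" "s (-13) = c" "e > 0 \<Longrightarrow> s (-100 - (int q - 1)) = d"
  shows "effect minimum_body s = s(-13 := min c (if e > 0 then d else s (-3)))"
  using assms by (auto simp: minimum_body_def previous_expr_def min_def fun_upd_idem)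

lemma base_effect:
  assumes "context_cells I s" "s (-9) = int w" "s (-10) = int u" "s (-11) = int v" "s (-13) =
      penalty I"
  shows "effect base_body s = s(-13 := budget_cost I v u w)"
proof -
  have "s 4 = masked I 0" using assms(1) by (force simp: context_cells_def)
  moreover have "int (recovery I) * int v + 1 - int w > 0 \<longleftrightarrow> w \<le> recovery I * v"
  proof -
    have "int (recovery I) * int v + 1 - int w > 0 \<longleftrightarrow> int w \<le> int (recovery I * v)" by auto
    then show ?thesis by (simp only: of_nat_le_iff)
  qed
  ultimately show ?thesis
    using assms by (simp add: base_body_def budget_cost_def context_cells_def header_def
        fun_upd_idem)
qed


lemma context_cells_cong:
  assumes "context_cells I s" "header I s'"
    and "\<And>a. a \<notin> {-1, -4, -8, -9, -10, -11, -12, -13, -14, -15, -18, -19} \<Longrightarrow> a > -100 \<Longrightarrow> s' a = s a"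
  shows "context_cells I s'"
  using assms(1,2) unfolding context_cells_def by (simp add: assms(3))

lemma context_cells_header: "context_cells I s \<Longrightarrow> header I s"
  by (simp add: context_cells_def)

lemma stride_le_table_size: "stride n * stride n \<le> table_size n" "stride n \<le> table_size n"
proof -
  have "1 \<le> (n + 1) * (n + 1) * (n + 1)" by simp
  then have 1: "1 * (stride n * stride n) \<le> (n + 1) * (n + 1) * (n + 1) * (stride n * stride n)"
    by (rule mult_le_mono1)
  then show "stride n * stride n \<le> table_size n" by (simp add: table_size_def mult_ac)
  moreover have "stride n \<le> stride n * stride n" using stride_pos[of n] by simp
  ultimately show "stride n \<le> table_size n" by linarith
qed

lemma items_le_table_size: "n + 1 \<le> table_size n"
proof -
  have "1 * (n + 1) \<le> ((n + 1) * (n + 1) * stride n * stride n) * (n + 1)"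
    using stride_pos[of n] by (intro mult_le_mono1) simp
  then show ?thesis unfolding table_size_def by (simp only: mult_ac mult_1_left)
qed

lemma items_less_stride: "n < radix n" "2 * n + 1 < radix n" if "1 \<le> n"
proof -
  have "n \<le> n * n" by (rule le_square)
  then show "n < radix n" "2 * n + 1 < radix n" unfolding radix_def mult.assoc by linarith+
qed

lemma radix_le_stride: "radix n * radix n \<le> stride n" "radix n \<le> stride n"
  using radix_pos[of n] by (simp_all add: stride_def)

lemma entry_effect:
  assumes c: "context_cells I s" and q: "s (-1) = int q" "q = table_index (num_items I) i v u w e"
    and i: "i \<le> num_items I"
    and T: "\<And>r. r < q \<Longrightarrow> s (-100 - int r) = table I r"
    and b: "v \<le> num_items I" "u \<le> num_items I" "w < stride (num_items I)" "e < stride (num_items I)"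
    and l: "s (-8) = int e" "s (-9) = int w" "s (-10) = int u" "s (-11) = int v" "s (-12) = int i"
    and p: "s (-13) = penalty I"
  shows "effect entry_body s (-13) = table I q \<and> header I (effect entry_body s) \<and>
     (\<forall>a. a \<notin> {-4, -13, -14, -15, -18} \<longrightarrow> effect entry_body s a = s a)"
proof (cases i)
  case 0
  have t: "table I q = budget_cost I v u w"
    unfolding q(2) using b by (simp add: table_table_index 0)
  have "effect entry_body s = s(-13 := table I q)"
    using base_effect[OF c l(2-4) p] 0 l(5) by (simp add: entry_body_def t)
  moreover have "\<bar>table I q\<bar> < word_bound I"
    using opt_table_le[OF b(1,2), of 0 w e] 0 by (intro penalty_bound) (simp add: t)
  ultimately show ?thesis
    using c by (auto simp: context_cells_def intro!: header_update)
next
  case (Suc i')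
  let ?n = "num_items I"
  let ?B = "word_bound I"
  have n1: "1 \<le> ?n" using i Suc by simp
  define W where "W = int (e mod 2) * int (radix ?n) * int (radix ?n) +
     int (e div 2) * int (radix ?n) + int (e mod 2) * (int v - int (e div 2))"
  define s1 where "s1 = s(-14 := int (e mod 2), -15 := int (e div 2), -18 := max 0 (int (e div 2)
      - int u), -4 := W)"
  have e1: "effect weight_body s = s1"
    unfolding s1_def W_def by (rule weight_effect[OF l(1,3,4)]) (use c in \<open>simp add:
        context_cells_def\<close>)
  have small: "\<bar>z\<bar> < ?B" if "\<bar>z\<bar> \<le> 8 * int (table_size ?n)" for z
    using that by (rule small_bound)
  have N: "int (stride ?n) \<le> int (table_size ?n)" "int (stride ?n * stride ?n) \<le> int (table_size
      ?n)"
    using stride_le_table_size[of ?n] by (simp_all only: of_nat_le_iff)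
  \<comment> \<open>The weight is stored before its range is tested, so the bound must cover padded
    choices too, for which v - e div 2 may be negative.\<close>
  have "\<bar>W\<bar> < ?B"
  proof (rule small)
    have R: "int (radix ?n) * int (radix ?n) \<le> int (stride ?n)"
      using radix_le_stride(1)[of ?n] by (simp only: of_nat_mult[symmetric] of_nat_le_iff)
    have "\<bar>int (e mod 2) * (int (radix ?n) * int (radix ?n))\<bar> \<le> 1 * int (stride ?n)"
      unfolding abs_mult using R by (intro mult_mono) auto
    moreover have "\<bar>int (e div 2) * int (radix ?n)\<bar> \<le> int (stride ?n) * int (stride ?n)"
      unfolding abs_mult using b(4) radix_le_stride(2)[of ?n] by (intro mult_mono) auto
    moreover have "\<bar>int (e mod 2) * (int v - int (e div 2))\<bar> \<le> 1 * (2 * int (stride ?n))"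
      unfolding abs_mult
      using b(1,4) items_less_stride(1)[OF n1] radix_le_stride(2)[of ?n] by (intro mult_mono) auto
    ultimately show "\<bar>W\<bar> \<le> 8 * int (table_size ?n)"
      unfolding W_def mult.assoc using N unfolding of_nat_mult by linarith
  qed
  moreover have "\<bar>int (e mod 2)\<bar> < ?B" "\<bar>int (e div 2)\<bar> < ?B" "\<bar>max 0 (int (e div 2) - int u)\<bar> < ?B"
    by (rule small; use b(4) N(1) stride_pos[of ?n] in linarith)+
  ultimately have h1: "header I s1"
    unfolding s1_def using context_cells_header[OF c] by (intro header_update) auto
  have c1: "context_cells I s1"
    using c h1 by (rule context_cells_cong) (auto simp: s1_def)
  define cand where "cand = (if e \<le> 2 * v + 1 \<and> choice_weight ?n v e \<le> w
      then opt_table I v u i' (w - choice_weight ?n v e) (2 * v + 1) + choice_cost I v u (Suc i') e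
      else penalty I)"
  have T1: "s1 (-100 - int r) = table I r" if "r < q" for r
    using T[OF that] by (simp add: s1_def)
  have e2: "effect candidate_body s1 = s1(-13 := cand)"
    unfolding cand_def
    by (rule candidate_effect[OF c1]) (use q Suc i b l p T1 in \<open>simp_all add: s1_def W_def\<close>)
  have "effect minimum_body (s1(-13 := cand)) = (s1(-13 := cand))(-13 := min cand
      (if e > 0 then opt_table I v u (Suc i') w (e - 1) else (s1(-13 := cand)) (-3)))"
  proof (rule minimum_effect)
    assume e: "e > 0"
    \<comment> \<open>The predecessor belongs to the same capacity only for e > 0; for e = 0 the
      recursion compares with the penalty instead.\<close>
    have "q - 1 = table_index ?n i v u w (e - 1)" "q - 1 < q" using e by (simp_all add: q(2)
        table_index_def)
    then have "s1 (-100 - int (q - 1)) = opt_table I v u i w (e - 1)"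
      using T1[of "q - 1"] b by (simp add: table_table_index)
    moreover have "int q - 1 = int (q - 1)" using \<open>q - 1 < q\<close> by linarith
    moreover have "-100 - int (q - 1) \<noteq> -13" by linarith
    ultimately show "(s1(-13 := cand)) (-100 - (int q - 1)) = opt_table I v u (Suc i') w (e - 1)"
      by (simp only: fun_upd_other Suc simp_thms)
  qed (use q l in \<open>simp_all add: s1_def\<close>)
  also have "min cand (if e > 0 then opt_table I v u (Suc i') w (e - 1) else (s1(-13 := cand))
      (-3)) = table I q"
  proof -
    have "s1 (-3) = penalty I" using c1 by (simp add: context_cells_def)
    then show ?thesis
      unfolding q(2) using b Suc
      by (cases e) (simp_all add: table_table_index knapsack.simps(2) cand_def)
  qed
  finally have e3: "effect minimum_body (s1(-13 := cand)) = s1(-13 := table I q)"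
    by (simp only: fun_upd_upd)
  have "expr_val (cell (-12)) s > 0" using l(5) Suc by simp
  then have "effect entry_body s = s1(-13 := table I q)"
    by (simp only: entry_body_def effect.simps block.simps if_True e1 e2 e3)
  moreover have "\<bar>table I q\<bar> < ?B"
    unfolding q(2) using opt_table_le[OF b(1,2) i, of w e] b by (intro penalty_bound) (simp add:
        table_table_index)
  ultimately show ?thesis
    using h1 by (auto simp: s1_def intro!: header_update)
qed

lemma table_step:
  assumes inv: "table_inv I q s" and q: "q < table_size (num_items I)"
  shows "expr_val table_guard s > 0 \<and> table_inv I (Suc q) (effect table_body s)"
proof -
  let ?n = "num_items I" and ?B = "word_bound I"
  have c: "context_cells I s" and s1: "s (-1) = int q" and T: "\<And>r. r < q \<Longrightarrow> s (-100 - int r) =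
      table I r"
    using inv by (auto simp: table_inv_def)
  obtain i v u w e where d: "q = table_index ?n i v u w e" "i \<le> ?n" "v \<le> ?n" "u \<le> ?n"
    "w < stride ?n" "e < stride ?n"
    using table_index_cases[OF q] .
  define s2 where "s2 = s(-8 := int e, -9 := int w, -10 := int u, -11 := int v, -12 := int i, -13
      := penalty I)"
  have e2: "effect decode_body s = s2"
    unfolding s2_def by (rule decode_effect[OF c _ d(3-6)]) (simp add: s1 d(1))
  have small: "\<bar>int m\<bar> < ?B" if "m \<le> 8 * table_size ?n" for m
    by (rule small_bound) (use that in simp)
  have n: "?n \<le> table_size ?n" using items_le_table_size[of ?n] by linarith
  have h2: "header I s2"
    unfolding s2_def using context_cells_header[OF c] d n stride_le_table_size(2)[of ?n]
        penalty_nonneg[of I]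
    by (intro header_update small penalty_bound) auto
  have c2: "context_cells I s2"
    by (rule context_cells_cong[OF c h2]) (auto simp: s2_def)
  define s3 where "s3 = effect entry_body s2"
  have "s3 (-13) = table I q \<and> header I s3 \<and> (\<forall>a. a \<notin> {-4, -13, -14, -15, -18} \<longrightarrow> s3 a = s2 a)"
    unfolding s3_def by (rule entry_effect[OF c2 _ d(1,2) _ d(3-6)]) (use T s1 in \<open>simp_all add:
        s2_def\<close>)
  then have s3: "s3 (-13) = table I q" "header I s3" "\<And>a. a \<notin> {-4, -13, -14, -15, -18} \<Longrightarrow> s3 a = s2
      a"
    by blast+
  have tq: "\<bar>table I q\<bar> < ?B"
    unfolding d(1) using opt_table_le[OF d(3,4,2), of w e] d by (intro penalty_bound) (simp add:
        table_table_index)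
  have e4: "effect table_body s = s3(-100 - int q := table I q, -1 := int (Suc q))"
  proof -
    have q3: "s3 (-1) = int q" using s3(3)[of "-1"] s1 by (simp add: s2_def)
    have "effect table_body s = effect (block [Store (Lit (-100) \<ominus> cell (-1)) (cell (-13)),
        assign (-1) (cell (-1) \<oplus> Lit 1)]) s3"
      by (simp only: table_body_def block.simps effect.simps e2 s3_def)
    then show ?thesis by (simp add: q3 s3(1) add.commute)
  qed
  have h4: "header I (effect table_body s)"
    unfolding e4 using s3(2) tq q by (intro header_update small) auto
  have "context_cells I (effect table_body s)"
    using c h4 by (rule context_cells_cong) (auto simp: e4 s3(3) s2_def)
  moreover have "effect table_body s (-100 - int r) = table I r" if "r < Suc q" for r
    using that T[of r] by (cases "r = q") (auto simp: e4 s3(3) s2_def)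
  moreover have "effect table_body s (-1) = int (Suc q)" by (simp add: e4)
  moreover have "expr_val table_guard s > 0"
    using c s1 q by (simp add: table_guard_def context_cells_def)
  ultimately show ?thesis
    using q by (simp add: table_inv_def)
qed

lemma table_triple:
  "poly_triple instance_size (\<lambda>I. table_inv I 0) (WhilePositive table_guard table_body)
     (\<lambda>I. table_inv I (table_size (num_items I)))"
proof (rule loop_triple[where Inv = table_inv and N = "\<lambda>I. table_size (num_items I)",
       OF _ _ _ _ table_step])
  show "loop_free table_body"
    by (simp add: table_body_def decode_body_def entry_body_def weight_body_def candidate_body_def
        minimum_body_def base_body_def)
  show "poly_bounded (\<lambda>L. 64 * L ^ 15)" by (intro poly_bounded_intros)
  show "table_size (num_items I) \<le> 64 * instance_size I ^ 15" for I
  proof -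
    have "(num_items I + 1) ^ 15 \<le> instance_size I ^ 15"
      using num_items_le_size[of I] by (intro power_mono) auto
    then show ?thesis using table_size_le[of "num_items I"] by linarith
  qed
qed (auto simp: table_inv_def table_guard_def context_cells_def header_bounded)

lemma setup_triple:
  "poly_triple instance_size (\<lambda>I s. mask_inv I (num_items I) s) setup_body (\<lambda>I s. table_inv I 0 s)"
proof (rule poly_triple_loop_free[OF _ poly_bounded_memory_bound])
  show "loop_free setup_body" by (simp add: setup_body_def)
  fix I s assume inv: "mask_inv I (num_items I) s"
  let ?n = "num_items I" and ?B = "word_bound I"
  have h: "header I s" using inv by (simp add: mask_inv_def)
  have e: "effect setup_body s = s(-3 := penalty I, -5 := int (radix ?n), -6 := int (stride ?n),
      -16 := int (?n + 1), -7 := int (table_size ?n), -1 := 0)"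
    using inv by (simp add: setup_body_def mask_inv_def header_def penalty_def radix_def stride_def
        table_size_def algebra_simps)
  have small: "\<bar>int m\<bar> < ?B" if "m \<le> 8 * table_size ?n" for m
    by (rule small_bound) (use that in simp)
  have "?n + 1 \<le> table_size ?n" by (rule items_le_table_size)
  then have h': "header I (effect setup_body s)"
    unfolding e using h stride_le_table_size(2)[of ?n] radix_le_stride(2)[of ?n] penalty_nonneg[of
        I]
      small[of 0]
    by (intro header_update small penalty_bound) auto
  then show "word_bounded I s \<and> table_inv I 0 (effect setup_body s)"
    using inv header_bounded[OF h] h' unfolding table_inv_def context_cells_def
    by (auto simp: e mask_inv_def)
qed


section \<open>Extracting an optimal solution\<close>

definition search_init :: program where
  "search_init = block [assign (-19) (cell (-3)), assign (-1) (Lit 0)]"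

text \<open>The n * (n + 1) rounds run through v = 1, ..., n and u = 0, ..., n. Pairs with u > v are
  harmless because \<open>rrec_cost_le\<close> shows that they also give upper bounds.\<close>

definition search_guard :: expr where
  "search_guard = cell 1 \<otimes> (cell 1 \<oplus> Lit 1) \<ominus> cell (-1)"

definition search_body :: program where
  "search_body = block
     [assign (-11) (cell (-1) \<oslash> cell (-16)),
      assign (-10) (cell (-1) \<ominus> cell (-16) \<otimes> cell (-11)),
      assign (-11) (cell (-11) \<oplus> Lit 1),
      assign (-9) (cell 2 \<otimes> cell (-5) \<otimes> cell (-5) \<oplus> cell 2 \<otimes> cell (-11) \<otimes> cell (-5) \<oplus> cell 3 \<otimes>
          cell (-11)),
      assign (-13) (Load (Lit (-100) \<ominus> ((((cell 1 \<otimes> cell (-16) \<oplus> cell (-11)) \<otimes> cell (-16) \<oplus> cell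
          (-10))
        \<otimes> cell (-6) \<oplus> cell (-9)) \<otimes> cell (-6) \<oplus> Lit 2 \<otimes> cell (-11) \<oplus> Lit 1))),
      IfPositive (cell (-19) \<ominus> cell (-13)) (assign (-19) (cell (-13))) Skip,
      assign (-1) (cell (-1) \<oplus> Lit 1)]"

text \<open>The capacity with radix digits p, p * v and k * v: the required cardinality, the
  required total of the numerators j, and the largest permitted slack.\<close>

definition full_weight :: "rrec_instance \<Rightarrow> nat \<Rightarrow> nat" where
  "full_weight I v = num_selected I * radix (num_items I) * radix (num_items I) +
     num_selected I * v * radix (num_items I) + recovery I * v"

definition fraction_value :: "rrec_instance \<Rightarrow> nat \<Rightarrow> nat \<Rightarrow> int" where
  "fraction_value I v u = opt_table I v u (num_items I) (full_weight I v) (2 * v + 1)"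

fun search_min :: "rrec_instance \<Rightarrow> nat \<Rightarrow> int" where
  "search_min I 0 = penalty I"
| "search_min I (Suc m) = min (search_min I m)
     (fraction_value I (m div (num_items I + 1) + 1) (m mod (num_items I + 1)))"

abbreviation search_count :: "rrec_instance \<Rightarrow> nat" where
  "search_count I \<equiv> num_items I * (num_items I + 1)"

abbreviation optimum :: "rrec_instance \<Rightarrow> int" where
  "optimum I \<equiv> search_min I (search_count I)"

definition search_inv :: "rrec_instance \<Rightarrow> nat \<Rightarrow> memory \<Rightarrow> bool" where
  "search_inv I m s \<longleftrightarrow> context_cells I s \<and> s (-1) = int m \<and> m \<le> search_count I \<and>
     s (-19) = search_min I m \<and> (\<forall>r < table_size (num_items I). s (-100 - int r) = table I r)"

lemma full_weight_less:
  assumes "I \<in> rrec_instances" "v \<le> num_items I"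
  shows "full_weight I v < stride (num_items I)"
proof -
  let ?n = "num_items I" and ?p = "num_selected I" and ?R = "radix (num_items I)"
  have pk: "?p \<le> ?n" "recovery I \<le> ?n" "1 \<le> ?n"
    using rrec_instancesD[OF assms(1)] by auto
  have R: "Suc (?n * ?n) \<le> ?R" "Suc ?n \<le> ?R"
    using items_less_stride(1)[OF pk(3)] by (auto simp: radix_def)
  have "?p * v \<le> ?n * ?n" "recovery I * v \<le> ?n * ?n" using pk assms(2) by (auto intro: mult_le_mono)
  then have b: "Suc (?p * v) \<le> ?R" "Suc (recovery I * v) \<le> ?R" "Suc ?p \<le> ?R" using R pk by linarith+
  have "full_weight I v = (?p * ?R + ?p * v) * ?R + recovery I * v"
    by (simp add: full_weight_def algebra_simps)
  also have "\<dots> < (?p * ?R + ?p * v) * ?R + ?R" using b(2) by simp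
  also have "\<dots> = (?p * ?R + Suc (?p * v)) * ?R" by simp
  also have "\<dots> \<le> (?p * ?R + ?R) * ?R" using b(1) by (intro mult_le_mono1 add_left_mono)
  also have "\<dots> = (Suc ?p * ?R) * ?R" by simp
  also have "\<dots> \<le> (?R * ?R) * ?R" using b(3) by (intro mult_le_mono1)
  finally show ?thesis by (simp add: stride_def)
qed

lemma search_init_triple:
  "poly_triple instance_size (\<lambda>I s. table_inv I (table_size (num_items I)) s) search_init
     (\<lambda>I s. search_inv I 0 s)"
proof (rule poly_triple_loop_free[OF _ poly_bounded_memory_bound])
  show "loop_free search_init" by (simp add: search_init_def)
  fix I s assume inv: "table_inv I (table_size (num_items I)) s"
  then have c: "context_cells I s" by (simp add: table_inv_def)
  then have p: "s (-3) = penalty I" by (simp add: context_cells_def)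
  have e: "effect search_init s = s(-19 := penalty I, -1 := 0)" by (simp add: search_init_def p)
  have h: "header I (effect search_init s)"
    unfolding e using context_cells_header[OF c] penalty_bound[of "penalty I" I] penalty_nonneg[of
        I]
    by (intro header_update) auto
  have "context_cells I (effect search_init s)"
    by (rule context_cells_cong[OF c h]) (auto simp: e)
  then show "word_bounded I s \<and> search_inv I 0 (effect search_init s)"
    using inv header_bounded[OF context_cells_header[OF c]]
    by (auto simp: search_inv_def table_inv_def e)
qed

lemma search_step:
  assumes inv: "search_inv I m s" and m: "m < search_count I"
  shows "expr_val search_guard s > 0 \<and> search_inv I (Suc m) (effect search_body s)"
proof -
  let ?n = "num_items I"
  have c: "context_cells I s" and s1: "s (-1) = int m" and s19: "s (-19) = search_min I m"
    and T: "\<And>r. r < table_size ?n \<Longrightarrow> s (-100 - int r) = table I r"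
    using inv by (auto simp: search_inv_def)
  define v0 where "v0 = m div (?n + 1)"
  define u where "u = m mod (?n + 1)"
  let ?v = "v0 + 1"
  have I: "I \<in> rrec_instances" using context_cells_header[OF c] by (simp add: header_def)
  have n1: "1 \<le> ?n" using rrec_instancesD(1)[OF I] .
  have u: "u \<le> ?n" using mod_less_divisor[of "?n + 1" m] unfolding u_def by linarith
  have "v0 < ?n" unfolding v0_def using m by (intro less_mult_imp_div_less) simp
  then have v: "?v \<le> ?n" by simp
  have muv: "m = v0 * (?n + 1) + u" unfolding v0_def u_def by (rule div_mult_mod_eq[symmetric])
  have div: "int m div (int ?n + 1) = int v0"
    unfolding v0_def zdiv_int by (simp add: add.commute)
  have sub: "int m - (int ?n + 1) * int v0 = int u" by (simp add: muv algebra_simps)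
  have cells: "s 1 = int ?n" "s 2 = int (num_selected I)" "s 3 = int (recovery I)" "s (-16) = int
      ?n + 1"
    "s (-5) = int (radix ?n)" "s (-6) = int (stride ?n)"
    using c by (simp_all add: context_cells_def header_def)
  let ?w = "full_weight I ?v"
  have w: "int (num_selected I) * int (radix ?n) * int (radix ?n) +
      int (num_selected I) * (int v0 + 1) * int (radix ?n) + int (recovery I) * (int v0 + 1) = int
          ?w"
    by (simp add: full_weight_def algebra_simps)
  let ?r = "table_index ?n ?n ?v u ?w (2 * ?v + 1)"
  have r: "(((int ?n * (int ?n + 1) + (int v0 + 1)) * (int ?n + 1) + int u) * int (stride ?n) +
      int ?w) *
      int (stride ?n) + 2 * (int v0 + 1) + 1 = int ?r"
    by (simp add: table_index_def algebra_simps)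
  have ws: "?w < stride ?n" using full_weight_less[OF I v] .
  have es: "2 * ?v + 1 < stride ?n"
  proof -
    have "2 * ?v + 1 \<le> 2 * ?n + 1" using v by simp
    also have "\<dots> < radix ?n" by (rule items_less_stride(2)[OF n1])
    also have "\<dots> \<le> stride ?n" by (rule radix_le_stride(2))
    finally show ?thesis .
  qed
  have "?r < table_size ?n"
  proof -
    have "?r < table_index ?n (Suc ?n) 0 0 0 0" by (rule table_index_less[OF v u ws es])
    also have "\<dots> = table_size ?n" by (simp add: table_index_def table_size_def algebra_simps)
    finally show ?thesis .
  qed
  from T[OF this] have t: "s (-100 - int ?r) = fraction_value I ?v u"
    unfolding fraction_value_def using table_table_index[OF v u ws es] by simp
  define s' where "s' = s(-11 := int v0 + 1, -10 := int u, -9 := int ?w, -13 := fraction_value I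
      ?v u,
     -19 := search_min I (Suc m), -1 := int (Suc m))"
  have mn: "search_min I (Suc m) = min (search_min I m) (fraction_value I ?v u)"
    by (simp add: v0_def u_def)
  have e: "effect search_body s = s'"
  proof -
    define s2 where "s2 = s(-10 := int u, -11 := int v0 + 1, -9 := int ?w)"
    have 1: "effect search_body s = effect (block
     [assign (-13) (Load (Lit (-100) \<ominus> ((((cell 1 \<otimes> cell (-16) \<oplus> cell (-11)) \<otimes> cell (-16) \<oplus> cell
         (-10))
        \<otimes> cell (-6) \<oplus> cell (-9)) \<otimes> cell (-6) \<oplus> Lit 2 \<otimes> cell (-11) \<oplus> Lit 1))),
      IfPositive (cell (-19) \<ominus> cell (-13)) (assign (-19) (cell (-13))) Skip,
      assign (-1) (cell (-1) \<oplus> Lit 1)]) s2"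
      unfolding search_body_def s2_def
      by (simp add: cells s1 div sub w)
    have "s2 (-100 - int ?r) = fraction_value I ?v u" using t by (simp add: s2_def)
    then have 2: "expr_val (Load (Lit (-100) \<ominus> ((((cell 1 \<otimes> cell (-16) \<oplus> cell (-11)) \<otimes> cell (-16)
        \<oplus> cell (-10))
        \<otimes> cell (-6) \<oplus> cell (-9)) \<otimes> cell (-6) \<oplus> Lit 2 \<otimes> cell (-11) \<oplus> Lit 1))) s2 = fraction_value I
            ?v u"
      using cells r by (simp only: expr_val.simps apply_op.simps) (simp add: s2_def)
    have "s2 (-19) = search_min I m" "s2 (-1) = int m" using s19 s1 by (simp_all add: s2_def)
    then show ?thesis
      unfolding 1 block.simps effect.simps 2
      by (auto simp: s'_def s2_def mn min_def fun_eq_iff simp del: search_min.simps)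
  qed
  have small: "\<bar>int q\<bar> < word_bound I" if "q \<le> 8 * table_size ?n" for q
    by (rule small_bound) (use that in simp)
  have mb: "\<bar>search_min I q\<bar> \<le> 2 * penalty I" if "q \<le> search_count I" for q
    using that
  proof (induction q)
    case 0
    then show ?case using penalty_nonneg[of I] by simp
  next
    case (Suc q)
    have "q div (?n + 1) < ?n" using Suc.prems by (intro less_mult_imp_div_less) simp
    moreover have "q mod (?n + 1) \<le> ?n" using mod_less_divisor[of "?n + 1" q] by linarith
    ultimately have "\<bar>fraction_value I (q div (?n + 1) + 1) (q mod (?n + 1))\<bar> \<le> 2 * penalty I"
      unfolding fraction_value_def by (intro opt_table_le) auto
    moreover have "\<bar>search_min I q\<bar> \<le> 2 * penalty I" using Suc by simp
    ultimately show ?case unfolding search_min.simps(2) by linarith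
  qed
  have mN: "search_count I \<le> table_size ?n"
  proof -
    have "?n * (?n + 1) * (1 * 1) \<le> ((?n + 1) * (?n + 1) * (?n + 1)) * (stride ?n * stride ?n)"
      using stride_pos[of ?n] by (intro mult_le_mono) auto
    then show ?thesis unfolding table_size_def by (simp only: mult_ac mult_1_left mult_1_right)
  qed
  have "\<bar>fraction_value I ?v u\<bar> < word_bound I"
    unfolding fraction_value_def using u v by (intro penalty_bound opt_table_le) auto
  moreover have "\<bar>search_min I (Suc m)\<bar> < word_bound I"
    using mb[of "Suc m"] m by (intro penalty_bound) simp
  moreover have "\<bar>int v0 + 1\<bar> < word_bound I"
    using small[of ?v] v items_le_table_size[of ?n] by simp
  ultimately have h: "header I s'"
    unfolding s'_def using context_cells_header[OF c] u ws items_le_table_size[of ?n]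
      stride_le_table_size(2)[of ?n] m mN
    by (intro header_update small) (auto simp del: search_min.simps)
  have c': "context_cells I s'"
    by (rule context_cells_cong[OF c h]) (auto simp: s'_def)
  have "expr_val search_guard s > 0"
  proof -
    have "int m < int (search_count I)" using m by (simp only: of_nat_less_iff)
    then show ?thesis by (simp add: search_guard_def cells s1 algebra_simps)
  qed
  moreover have "search_inv I (Suc m) s'"
    unfolding search_inv_def using c' m T by (auto simp: s'_def simp del: search_min.simps)
  ultimately show ?thesis by (simp add: e)
qed

lemma search_triple:
  "poly_triple instance_size (\<lambda>I. search_inv I 0) (WhilePositive search_guard search_body)
     (\<lambda>I. search_inv I (search_count I))"
proof (rule loop_triple[where Inv = search_inv and N = search_count,
       OF _ _ _ _ search_step])
  show "loop_free search_body" by (simp add: search_body_def)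
  show "poly_bounded (\<lambda>L. L * L)" by (intro poly_bounded_intros)
  show "search_count I \<le> instance_size I * instance_size I" for I
    by (rule mult_le_mono) (use num_items_le_size[of I] in linarith)+
  show "\<not> 0 < expr_val search_guard s" if "search_inv I (search_count I) s" for I s
  proof -
    have "s (-1) = int (search_count I)" "s 1 = int (num_items I)"
      using that by (auto simp: search_inv_def context_cells_def header_def)
    then show ?thesis by (simp add: search_guard_def algebra_simps)
  qed
qed (auto simp: search_inv_def context_cells_def header_bounded)

section \<open>Writing the output\<close>

definition output_init :: program where
  "output_init = block [assign (-17) (cell 1), assign (-1) (Lit 0)]"

definition output_guard :: expr where
  "output_guard = cell (-17) \<ominus> cell (-1)"

text \<open>The optimum may be negative, as first-stage costs may be. Floor division still yields
  bits in {0, 1}. Halving the scale along with the optimum leaves the reduced pair of numerator and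
  denominator at the end.\<close>

definition output_body :: program where
  "output_body = block
     [Store (cell (-1) \<oplus> Lit 1) (cell (-19) \<ominus> Lit 2 \<otimes> (cell (-19) \<oslash> Lit 2)),
      assign (-19) (cell (-19) \<oslash> Lit 2),
      assign (-2) (cell (-2) \<oslash> Lit 2),
      assign (-1) (cell (-1) \<oplus> Lit 1)]"

definition output_final :: program where
  "output_final = block
     [Store (cell (-17) \<oplus> Lit 1) (cell (-19)),
      Store (cell (-17) \<oplus> Lit 2) (cell (-2)),
      assign 0 (cell (-17) \<oplus> Lit 2)]"

text \<open>\<open>header\<close> is replaced by weaker conditions, since the output overwrites the
  input cells from cell 1 on; the number of items survives in cell -17.\<close>

definition output_inv :: "rrec_instance \<Rightarrow> nat \<Rightarrow> memory \<Rightarrow> bool" where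
  "output_inv I m s \<longleftrightarrow> I \<in> rrec_instances \<and> word_bounded I s \<and>
     s (-17) = int (num_items I) \<and> s (-1) = int m \<and> m \<le> num_items I \<and>
     s (-19) = optimum I div 2 ^ m \<and> s (-2) = scale I div 2 ^ m \<and>
     (\<forall>l < m. s (1 + int l) = optimum I div 2 ^ l mod 2)"

definition rrec_output :: "rrec_instance \<Rightarrow> int list" where
  "rrec_output I = map (\<lambda>i. optimum I div 2 ^ (i - 1) mod 2) [1..<num_items I + 1] @
     [optimum I div 2 ^ num_items I, scale I div 2 ^ num_items I]"

lemma output_init_triple:
  "poly_triple instance_size (\<lambda>I s. search_inv I (search_count I) s) output_init (\<lambda>I s. output_inv
      I 0 s)"
proof (rule poly_triple_loop_free[OF _ poly_bounded_memory_bound])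
  show "loop_free output_init" by (simp add: output_init_def)
  fix I s assume inv: "search_inv I (search_count I) s"
  then have h: "header I s" by (simp add: search_inv_def context_cells_def)
  then have n: "s 1 = int (num_items I)" by (simp add: header_def)
  have "\<bar>int (num_items I)\<bar> < word_bound I"
    using num_items_le_size[of I] by (intro counter_bound) simp
  with header_bounded[OF h] have "word_bounded I (effect output_init s)"
    by (auto simp: output_init_def n intro!: bounded_memory_update)
  then show "word_bounded I s \<and> output_inv I 0 (effect output_init s)"
    using header_bounded[OF h] h inv
    by (auto simp: output_inv_def output_init_def n header_def search_inv_def context_cells_def)
qed

lemma output_step:
  assumes inv: "output_inv I m s" and m: "m < num_items I"
  shows "expr_val output_guard s > 0 \<and> output_inv I (Suc m) (effect output_body s)"
proof -
  let ?B = "word_bound I"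
  have s: "s (-17) = int (num_items I)" "s (-1) = int m" "s (-19) = optimum I div 2 ^ m"
    "s (-2) = scale I div 2 ^ m" "\<And>l. l < m \<Longrightarrow> s (1 + int l) = optimum I div 2 ^ l mod 2"
    and b: "word_bounded I s" and I: "I \<in> rrec_instances"
    using inv by (auto simp: output_inv_def)
  have e: "effect output_body s = s(1 + int m := optimum I div 2 ^ m mod 2,
     -19 := optimum I div 2 ^ m div 2, -2 := scale I div 2 ^ m div 2, -1 := int (Suc m))"
    by (simp add: output_body_def s minus_mult_div_eq_mod add.commute)
  have d: "a div 2 ^ m div 2 = a div 2 ^ Suc m" for a :: int
    by (simp add: zdiv_zmult2_eq[symmetric] mult.commute)
  have "\<bar>optimum I div 2 ^ m\<bar> < ?B" "\<bar>scale I div 2 ^ m\<bar> < ?B"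
    using b s(3,4) unfolding bounded_memory_def by metis+
  then have "\<bar>optimum I div 2 ^ m div 2\<bar> < ?B" "\<bar>scale I div 2 ^ m div 2\<bar> < ?B"
    using abs_div_le[of "optimum I div 2 ^ m" 2] abs_div_le[of "scale I div 2 ^ m" 2] by linarith+
  moreover have "\<bar>optimum I div 2 ^ m mod 2\<bar> < ?B"
  proof -
    have "(1::nat) \<le> memory_bound (instance_size I)" by (simp add: memory_bound_def)
    from power_increasing[OF this, of "2::int"] show ?thesis
      using pos_mod_bound[of 2 "optimum I div 2 ^ m"] pos_mod_sign[of 2 "optimum I div 2 ^ m"] by
          simp
  qed
  moreover have "\<bar>int (Suc m)\<bar> < ?B" using m num_items_le_size[of I] by (intro counter_bound) simp
  ultimately have "word_bounded I (effect output_body s)"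
    unfolding e using b by (intro bounded_memory_update)
  then show ?thesis
    using I s m unfolding output_inv_def e d by (auto simp: output_guard_def less_Suc_eq)
qed

lemma output_triple:
  "poly_triple instance_size (\<lambda>I. output_inv I 0) (WhilePositive output_guard output_body) (\<lambda>I.
      output_inv I (num_items I))"
  by (rule loop_triple[where Inv = output_inv and N = num_items,
        OF _ poly_bounded_id num_items_le _ output_step]) (auto simp: output_body_def
            output_inv_def output_guard_def)

lemma output_final_triple:
  "poly_triple instance_size (\<lambda>I s. output_inv I (num_items I) s) output_final
     (\<lambda>I s. output_list s = rrec_output I)"
proof (rule poly_triple_loop_free[OF _ poly_bounded_memory_bound])
  show "loop_free output_final" by (simp add: output_final_def)
  fix I s assume inv: "output_inv I (num_items I) s"
  let ?n = "num_items I" and ?s = "effect output_final s"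
  have e: "?s = s(int ?n + 1 := optimum I div 2 ^ ?n, int ?n + 2 := scale I div 2 ^ ?n, 0 := int
      ?n + 2)"
    using inv by (simp add: output_final_def output_inv_def)
  have "?s (int i) = optimum I div 2 ^ (i - 1) mod 2" if "i \<in> {1..<?n + 1}" for i
  proof -
    have "i - 1 < ?n" using that by auto
    then have "s (1 + int (i - 1)) = optimum I div 2 ^ (i - 1) mod 2"
      using inv unfolding output_inv_def by blast
    moreover have "1 + int (i - 1) = int i" using that by auto
    ultimately have "s (int i) = optimum I div 2 ^ (i - 1) mod 2" by simp
    moreover have "?s (int i) = s (int i)" using that by (auto simp: e)
    ultimately show ?thesis by simp
  qed
  moreover have "nat (?s 0) + 1 = ?n + 3" by (simp add: e)
  moreover have "[1..<?n + 3] = [1..<?n + 1] @ [?n + 1, ?n + 2]"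
    by (simp add: numeral_3_eq_3)
  moreover have "?s (int (?n + 1)) = optimum I div 2 ^ ?n" "?s (int (?n + 2)) = scale I div 2 ^ ?n"
    by (simp_all add: e)
  ultimately have "output_list ?s = rrec_output I"
    unfolding output_list_def rrec_output_def by (simp only: map_append list.map) (auto simp del:
        upt_Suc)
  then show "word_bounded I s \<and> output_list ?s = rrec_output I"
    using inv by (simp add: output_inv_def)
qed

definition rrec_program :: program where
  "rrec_program = Sequence scale_init (Sequence (WhilePositive values_guard scale_body)
     (Sequence scaling_init (Sequence (WhilePositive values_guard scaling_body)
     (Sequence mask_init (Sequence (WhilePositive items_guard mask_body)
     (Sequence setup_body (Sequence (WhilePositive table_guard table_body)
     (Sequence search_init (Sequence (WhilePositive search_guard search_body)
     (Sequence output_init (Sequence (WhilePositive output_guard output_body)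
         output_final)))))))))))"

lemma rrec_program_triple:
  "poly_triple instance_size start rrec_program (\<lambda>I s. output_list s = rrec_output I)"
  unfolding rrec_program_def
  by (intro poly_triple_sequence[OF scale_init_triple] poly_triple_sequence[OF scale_triple]
      poly_triple_sequence[OF scaling_init_triple] poly_triple_sequence[OF scaling_triple]
      poly_triple_sequence[OF mask_init_triple] poly_triple_sequence[OF mask_triple]
      poly_triple_sequence[OF setup_triple] poly_triple_sequence[OF table_triple]
      poly_triple_sequence[OF search_init_triple] poly_triple_sequence[OF search_triple]
      poly_triple_sequence[OF output_init_triple] poly_triple_sequence[OF output_triple]
      output_final_triple)


section \<open>Correctness\<close>

text \<open>Splitting the sum at position i, the lower part lies in [0, 2^i) and disappears under
  floor division, and everything above digit i is even. The leading coefficient a may be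
  negative.\<close>

lemma binary_digit:
  fixes b :: "nat \<Rightarrow> int"
  assumes b: "\<And>l. l < n \<Longrightarrow> b l = 0 \<or> b l = 1"
  shows "0 \<le> (\<Sum>l<n. b l * 2 ^ l)" "(\<Sum>l<n. b l * 2 ^ l) < 2 ^ n"
    and "i < n \<Longrightarrow> (2 ^ n * a + (\<Sum>l<n. b l * 2 ^ l)) div 2 ^ i mod 2 = b i"
proof -
  have range: "0 \<le> (\<Sum>l<m. b l * 2 ^ l) \<and> (\<Sum>l<m. b l * 2 ^ l) < 2 ^ m" if "m \<le> n" for m
    using that
  proof (induction m)
    case (Suc m)
    then show ?case using b[of m] by auto
  qed simp
  then show "0 \<le> (\<Sum>l<n. b l * 2 ^ l)" "(\<Sum>l<n. b l * 2 ^ l) < 2 ^ n" by auto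
  show "(2 ^ n * a + (\<Sum>l<n. b l * 2 ^ l)) div 2 ^ i mod 2 = b i" if i: "i < n"
  proof -
    have "\<exists>c. (\<Sum>l<m. b l * 2 ^ l) = (\<Sum>l<i. b l * 2 ^ l) + 2 ^ i * (b i + 2 * c)" if "Suc i \<le> m"
        for m
      using that
    proof (induction m rule: dec_induct)
      case base
      show ?case by (intro exI[of _ 0]) simp
    next
      case (step m)
      then obtain c where c: "(\<Sum>l<m. b l * 2 ^ l) = (\<Sum>l<i. b l * 2 ^ l) + 2 ^ i * (b i + 2 * c)"
          by blast
      have "(2::int) ^ m = 2 ^ i * (2 * 2 ^ (m - Suc i))"
        using step(1) by (simp flip: power_Suc power_add)
      then show ?case
        by (intro exI[of _ "c + b m * 2 ^ (m - Suc i)"]) (simp add: c algebra_simps)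
    qed
    from this[of n] i obtain c where
      c: "(\<Sum>l<n. b l * 2 ^ l) = (\<Sum>l<i. b l * 2 ^ l) + 2 ^ i * (b i + 2 * c)" by auto
    have "(2::int) ^ n = 2 ^ i * (2 * 2 ^ (n - Suc i))"
      using i by (simp flip: power_Suc power_add)
    then have eq: "2 ^ n * a + (\<Sum>l<n. b l * 2 ^ l) =
        (\<Sum>l<i. b l * 2 ^ l) + (b i + 2 * (c + 2 ^ (n - Suc i) * a)) * 2 ^ i"
      by (simp add: c algebra_simps)
    have "(2 ^ n * a + (\<Sum>l<n. b l * 2 ^ l)) div 2 ^ i = b i + 2 * (c + 2 ^ (n - Suc i) * a)"
      unfolding eq using range[of i] i by (subst div_mult_self1) auto
    moreover have "(b i + 2 * d) mod 2 = b i" for d :: int using b[OF i] by auto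
    ultimately show ?thesis by (simp only:)
  qed
qed

lemma radix_digits:
  fixes R :: nat
  assumes "(a * R + b) * R + c = (a' * R + b') * R + c'" "b < R" "b' < R" "c < R" "c' < R"
  shows "a = a' \<and> b = b' \<and> c = c'"
proof -
  have c: "c = c'" using arg_cong[OF assms(1), of "\<lambda>z. z mod R"] assms(4,5) by simp
  then have ab: "a * R + b = a' * R + b'" using assms by simp
  moreover have "b = b'" using arg_cong[OF ab, of "\<lambda>z. z mod R"] assms(2,3) by simp
  ultimately show ?thesis using c assms by auto
qed

definition admissible_choice :: "rrec_instance \<Rightarrow> nat \<Rightarrow> (nat \<Rightarrow> nat) \<Rightarrow> bool" where
  "admissible_choice I v f \<longleftrightarrow> (\<forall>i\<in>{1..num_items I}. f i \<le> 2 * v + 1) \<and>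
     (\<Sum>i = 1..num_items I. f i mod 2) = num_selected I \<and>
     (\<lambda>i. f i div 2) \<in> fractional_recovery (num_items I) (num_selected I) (recovery I) (\<lambda>i. f i
         mod 2) v"

definition total_cost :: "rrec_instance \<Rightarrow> nat \<Rightarrow> nat \<Rightarrow> (nat \<Rightarrow> nat) \<Rightarrow> int" where
  "total_cost I v u f = masked I 0 * int u div int v + (\<Sum>i = 1..num_items I. choice_cost I v u i
      (f i))"

lemma sum_choice_weight:
  fixes f :: "nat \<Rightarrow> nat"
  shows "(\<Sum>i = 1..n. choice_weight n v (f i)) =
     ((\<Sum>i = 1..n. f i mod 2) * radix n + (\<Sum>i = 1..n. f i div 2)) * radix n +
     (\<Sum>i = 1..n. f i mod 2 * (v - f i div 2))"
  by (simp add: choice_weight_def sum.distrib sum_distrib_left algebra_simps)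

text \<open>This identity turns the lower bound on \<Sum> x j into an upper bound on \<Sum> x (v -
  j), the form that a capacity can express.\<close>

lemma sum_choice_slack:
  fixes f :: "nat \<Rightarrow> nat"
  assumes "\<And>i. i \<in> {1..n} \<Longrightarrow> f i \<le> 2 * v + 1"
  shows "(\<Sum>i = 1..n. f i mod 2 * (v - f i div 2)) + (\<Sum>i = 1..n. f i mod 2 * (f i div 2)) =
     (\<Sum>i = 1..n. f i mod 2) * v"
proof -
  have "f i mod 2 * (v - f i div 2) + f i mod 2 * (f i div 2) = f i mod 2 * v" if "i \<in> {1..n}" for i
  proof -
    have "f i div 2 \<le> v" using assms[OF that] by linarith
    then show ?thesis by (simp add: add_mult_distrib2[symmetric])
  qed
  then show ?thesis by (simp add: sum.distrib[symmetric] sum_distrib_right)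
qed

lemma full_weight_eq:
  "full_weight I v = (num_selected I * radix (num_items I) + num_selected I * v) * radix
      (num_items I) + recovery I * v"
  by (simp add: full_weight_def algebra_simps)

lemma admissible_choice_weight:
  assumes I: "I \<in> rrec_instances" and v: "v \<le> num_items I"
    and f: "\<And>i. i \<in> {1..num_items I} \<Longrightarrow> f i \<le> 2 * v + 1"
  defines "W \<equiv> (\<Sum>i = 1..num_items I. choice_weight (num_items I) v (f i))"
  shows "admissible_choice I v f \<longleftrightarrow> W \<le> full_weight I v \<and> full_weight I v - W \<le> recovery I * v"
proof -
  let ?n = "num_items I" and ?p = "num_selected I" and ?k = "recovery I"
  define X where "X = (\<Sum>i = 1..?n. f i mod 2)"
  define J where "J = (\<Sum>i = 1..?n. f i div 2)"
  define Z where "Z = (\<Sum>i = 1..?n. f i mod 2 * (v - f i div 2))"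
  define Y where "Y = (\<Sum>i = 1..?n. f i mod 2 * (f i div 2))"
  note D = rrec_instancesD[OF I]
  have W: "W = (X * radix ?n + J) * radix ?n + Z"
    unfolding W_def X_def J_def Z_def by (rule sum_choice_weight)
  have ZY: "Z + Y = X * v"
    unfolding X_def Y_def Z_def by (rule sum_choice_slack) fact
  have "f i div 2 \<le> v" if "i \<in> {1..?n}" for i using f[OF that] by linarith
  then have J: "J \<le> ?n * v" and jv: "\<forall>i\<in>{1..?n}. f i div 2 \<le> v"
    unfolding J_def using sum_bounded_above[of "{1..?n}" "\<lambda>i. f i div 2" v] by auto
  have X: "X \<le> ?n" unfolding X_def using sum_bounded_above[of "{1..?n}" "\<lambda>i. f i mod 2" 1] by auto
  have nv: "?n * v \<le> ?n * ?n" using v by simp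
  have bounds: "J < radix ?n" "?p * v < radix ?n" "?k * v \<le> ?n * ?n" "Z \<le> ?n * ?n" "?k * v < radix
      ?n"
  proof -
    have "?p * v \<le> ?n * v" "?k * v \<le> ?n * v" "X * v \<le> ?n * v" using D X by (auto intro!:
        mult_le_mono1)
    then show "J < radix ?n" "?p * v < radix ?n" "?k * v \<le> ?n * ?n" "Z \<le> ?n * ?n" "?k * v < radix
        ?n"
      using J nv ZY unfolding radix_def mult.assoc by linarith+
  qed
  have adm: "admissible_choice I v f \<longleftrightarrow> X = ?p \<and> J = ?p * v \<and> (?p - ?k) * v \<le> Y"
    using f jv by (auto simp: admissible_choice_def fractional_recovery_def X_def J_def Y_def)
  have pk: "?p * v = (?p - ?k) * v + ?k * v"
    using D(4) by (simp add: add_mult_distrib[symmetric])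
  have slack: "Z \<le> ?k * v \<longleftrightarrow> (?p - ?k) * v \<le> Y" if "X = ?p"
  proof -
    have "Z + Y = q + ?k * v \<Longrightarrow> Z \<le> ?k * v \<longleftrightarrow> q \<le> Y" for q by linarith
    then show ?thesis using ZY pk that by metis
  qed
  show ?thesis
  proof
    assume "admissible_choice I v f"
    then have a: "X = ?p" "J = ?p * v" "(?p - ?k) * v \<le> Y" using adm by auto
    then have "Z \<le> ?k * v" using slack by blast
    then show "W \<le> full_weight I v \<and> full_weight I v - W \<le> ?k * v"
      unfolding W full_weight_eq a by auto
  next
    assume w: "W \<le> full_weight I v \<and> full_weight I v - W \<le> ?k * v"
    define l where "l = full_weight I v - W"
    have l: "l \<le> ?k * v" "W + l = full_weight I v" using w by (auto simp: l_def)
    \<comment> \<open>Both summands are at most n^2, which is what the factor 2 in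
      \<open>radix\<close> provides for.\<close>
    have "Z + l < radix ?n" using bounds l(1) by (simp add: radix_def)
    moreover have "(X * radix ?n + J) * radix ?n + (Z + l) =
        (?p * radix ?n + ?p * v) * radix ?n + ?k * v"
      using l(2) unfolding W full_weight_eq by simp
    ultimately have a: "X = ?p" "J = ?p * v" "Z + l = ?k * v"
      using radix_digits[of X "radix ?n" J "Z + l" ?p "?p * v" "?k * v"] bounds by auto
    then have "(?p - ?k) * v \<le> Y" using slack by simp
    with a adm show "admissible_choice I v f" by simp
  qed
qed

lemma fraction_value_le:
  assumes I: "I \<in> rrec_instances" and v: "v \<le> num_items I" and f: "admissible_choice I v f"
  shows "fraction_value I v u \<le> total_cost I v u f"
proof -
  have f': "\<And>i. i \<in> {1..num_items I} \<Longrightarrow> f i \<le> 2 * v + 1" using f by (simp add: admissible_choice_def)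
  note w = admissible_choice_weight[OF I v, of f, OF f', THEN iffD1, OF _ f]
  have "fraction_value I v u \<le> budget_cost I v u (full_weight I v -
      (\<Sum>i = 1..num_items I. choice_weight (num_items I) v (f i))) +
      (\<Sum>i = 1..num_items I. choice_cost I v u i (f i))"
    unfolding fraction_value_def by (rule knapsack_le) (use f' w in auto)
  then show ?thesis using w f' by (simp add: budget_cost_def total_cost_def)
qed

lemma fraction_value_attained:
  assumes I: "I \<in> rrec_instances" and v: "v \<le> num_items I"
  shows "fraction_value I v u \<ge> penalty I - int (num_items I) * (3 * cost_bound I * (int
      (num_items I) + 1)) \<or>
    (\<exists>f. admissible_choice I v f \<and> fraction_value I v u = total_cost I v u f)"
proof -
  let ?n = "num_items I" and ?X = "3 * cost_bound I * (int (num_items I) + 1)"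
  have X: "\<bar>choice_cost I v u l e\<bar> \<le> ?X" if "l \<in> {1..?n}" "e \<le> 2 * v + 1" for l e
    using choice_cost_le[OF that(1) v that(2)] .
  from knapsack_attained[where big = "penalty I" and base = "budget_cost I v u" and i = ?n and X =
      ?X
      and weight = "choice_weight ?n v" and last_choice = "2 * v + 1" and cost = "choice_cost I v u"
      and w = "full_weight I v", OF X]
  consider "fraction_value I v u \<ge> penalty I - int ?n * ?X"
    | f where "\<forall>l\<in>{1..?n}. f l \<le> 2 * v + 1" "(\<Sum>l = 1..?n. choice_weight ?n v (f l)) \<le> full_weight
        I v"
      "fraction_value I v u = budget_cost I v u (full_weight I v - (\<Sum>l = 1..?n. choice_weight ?n v
          (f l))) +
        (\<Sum>l = 1..?n. choice_cost I v u l (f l))"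
    unfolding fraction_value_def by blast
  then show ?thesis
  proof cases
    case (2 f)
    show ?thesis
    proof (cases "admissible_choice I v f")
      case True
      then have "full_weight I v - (\<Sum>l = 1..?n. choice_weight ?n v (f l)) \<le> recovery I * v"
        using admissible_choice_weight[OF I v, of f] 2(1) by blast
      then show ?thesis using True 2(3) by (auto simp: budget_cost_def total_cost_def)
    next
      case False
      then have "\<not> full_weight I v - (\<Sum>l = 1..?n. choice_weight ?n v (f l)) \<le> recovery I * v"
        using admissible_choice_weight[OF I v, of f] 2(1,2) by blast
      then have eq: "fraction_value I v u = penalty I + (\<Sum>l = 1..?n. choice_cost I v u l (f l))"
        using 2(3) by (simp add: budget_cost_def)
      have "\<bar>\<Sum>l = 1..?n. choice_cost I v u l (f l)\<bar> \<le> (\<Sum>l = 1..?n. \<bar>choice_cost I v u l (f l)\<bar>)"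
        by (rule sum_abs)
      also have "\<dots> \<le> (\<Sum>l = 1..?n. ?X)" by (rule sum_mono) (use X 2(1) in blast)
      also have "\<dots> = int ?n * ?X" by simp
      finally show ?thesis unfolding eq by linarith
    qed
  qed blast
qed

text \<open>Strictness separates genuine totals from the penalised values and thereby excludes the
  first alternative of \<open>fraction_value_attained\<close>.\<close>

lemma total_cost_less:
  assumes "v \<le> num_items I" "u \<le> num_items I" "admissible_choice I v f"
  shows "total_cost I v u f < penalty I - int (num_items I) * (3 * cost_bound I * (int (num_items
      I) + 1))"
proof -
  let ?n = "num_items I" and ?X = "3 * cost_bound I * (int (num_items I) + 1)"
  have "\<bar>\<Sum>l = 1..?n. choice_cost I v u l (f l)\<bar> \<le> (\<Sum>l = 1..?n. \<bar>choice_cost I v u l (f l)\<bar>)"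
    by (rule sum_abs)
  also have "\<dots> \<le> (\<Sum>l = 1..?n. ?X)"
  proof (rule sum_mono)
    fix l assume "l \<in> {1..?n}"
    then show "\<bar>choice_cost I v u l (f l)\<bar> \<le> ?X"
      using assms(1,3) by (intro choice_cost_le) (auto simp: admissible_choice_def)
  qed
  also have "\<dots> = int ?n * ?X" by simp
  finally have "\<bar>\<Sum>l = 1..?n. choice_cost I v u l (f l)\<bar> \<le> int ?n * ?X" .
  moreover have "\<bar>masked I 0 * int u div int v\<bar> \<le> cost_bound I * int ?n"
    by (rule budget_value_le) fact
  moreover have "2 * int ?n * ?X + cost_bound I * int ?n < penalty I"
  proof -
    have "0 < cost_bound I"
      using power_num_items_le[of I] zero_less_power[of "2::int" ?n] by linarith
    moreover have "0 < 2 * int ?n * int ?n + 9 * int ?n + 8"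
      by (intro add_nonneg_pos add_nonneg_nonneg mult_nonneg_nonneg) auto
    ultimately have "0 < cost_bound I * (2 * int ?n * int ?n + 9 * int ?n + 8)"
      by (rule mult_pos_pos)
    then show ?thesis by (simp add: penalty_def algebra_simps)
  qed
  moreover have "2 * int ?n * ?X = int ?n * ?X + int ?n * ?X" by simp
  ultimately show ?thesis unfolding total_cost_def by linarith
qed

section \<open>The minimum over all fractions\<close>

lemma search_min_le:
  assumes "q < m"
  shows "search_min I m \<le> fraction_value I (q div (num_items I + 1) + 1) (q mod (num_items I + 1))"
  using assms
proof (induction m)
  case (Suc m)
  then show ?case by (cases "q = m") (auto simp: min_le_iff_disj)
qed simp

lemma search_min_attained:
  "search_min I m = penalty I \<or> (\<exists>q < m. search_min I m =
     fraction_value I (q div (num_items I + 1) + 1) (q mod (num_items I + 1)))"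
proof (induction m)
  case (Suc m)
  show ?case
  proof (cases "search_min I m \<le> fraction_value I (m div (num_items I + 1) + 1) (m mod (num_items
      I + 1))")
    case True
    then have "search_min I (Suc m) = search_min I m" by simp
    then show ?thesis using Suc less_SucI by metis
  next
    case False
    then have "search_min I (Suc m) = fraction_value I (m div (num_items I + 1) + 1) (m mod
        (num_items I + 1))"
      by simp
    then show ?thesis by blast
  qed
qed simp

lemma optimum_le:
  assumes "I \<in> rrec_instances" "1 \<le> v" "v \<le> num_items I" "u \<le> num_items I" "admissible_choice I v f"
  shows "optimum I \<le> total_cost I v u f"
proof -
  \<comment> \<open>The search round that decodes to (v, u); the shift is due to starting at v =
    1.\<close>
  let ?n = "num_items I" and ?q = "(v - 1) * (num_items I + 1) + u"
  have "?q < v * (?n + 1)" using assms(2,4) by (cases v) auto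
  also have "\<dots> \<le> ?n * (?n + 1)" using assms(3) by (rule mult_le_mono1)
  finally have "optimum I \<le> fraction_value I (?q div (?n + 1) + 1) (?q mod (?n + 1))"
    by (rule search_min_le)
  moreover have "?q div (?n + 1) + 1 = v" "?q mod (?n + 1) = u"
  proof -
    have u: "u < ?n + 1" using assms(4) by simp
    have "?q div (?n + 1) = v - 1" using u by (subst div_mult_self3) auto
    then show "?q div (?n + 1) + 1 = v" using assms(2) by simp
    show "?q mod (?n + 1) = u" using u by (subst mod_mult_self3) auto
  qed
  ultimately have "optimum I \<le> fraction_value I v u" by (simp only:)
  also have "\<dots> \<le> total_cost I v u f" by (rule fraction_value_le) fact+
  finally show ?thesis .
qed

text \<open>A single admissible choice already pushes the optimum below all penalised values, so the
  minimum must come from a genuine choice.\<close>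

lemma optimum_attained:
  assumes I: "I \<in> rrec_instances" and ex: "1 \<le> v" "v \<le> num_items I" "u \<le> num_items I"
      "admissible_choice I v f"
  obtains v' u' f' where "1 \<le> v'" "v' \<le> num_items I" "u' \<le> num_items I" "admissible_choice I v' f'"
    "optimum I = total_cost I v' u' f'"
proof -
  let ?n = "num_items I" and ?X = "3 * cost_bound I * (int (num_items I) + 1)"
  have less: "optimum I < penalty I - int ?n * ?X"
    using optimum_le[OF I ex] total_cost_less[OF ex(2-4)] by linarith
  moreover have "0 \<le> int ?n * ?X"
    by (intro mult_nonneg_nonneg cost_bound_nonneg) auto
  ultimately obtain q where q: "q < search_count I"
    "optimum I = fraction_value I (q div (?n + 1) + 1) (q mod (?n + 1))"
    using search_min_attained[of I "search_count I"] by fastforce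
  have v: "q div (?n + 1) + 1 \<le> ?n"
    using less_mult_imp_div_less[OF q(1)] by simp
  have u: "q mod (?n + 1) \<le> ?n" using mod_less_divisor[of "?n + 1" q] by linarith
  obtain f' where "admissible_choice I (q div (?n + 1) + 1) f'"
    "optimum I = total_cost I (q div (?n + 1) + 1) (q mod (?n + 1)) f'"
    using fraction_value_attained[OF I v, of "q mod (?n + 1)"] less unfolding q(2) by fastforce
  with v u show thesis by (intro that) auto
qed


section \<open>Integer totals and exact robust costs\<close>

abbreviation instance_cost :: "rrec_instance \<Rightarrow> (nat \<Rightarrow> nat) \<Rightarrow> real" where
  "instance_cost I x \<equiv> rrec_cost (num_items I) (num_selected I) (recovery I)
     (\<lambda>i. real_of_rat (first_cost I i)) (\<lambda>i. real_of_rat (lower_cost I i))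
     (\<lambda>i. real_of_rat (upper_cost I i)) (real_of_rat (budget I)) x"

abbreviation selection_cost :: "rrec_instance \<Rightarrow> (nat \<Rightarrow> nat) \<Rightarrow> real" where
  "selection_cost I x \<equiv> item_cost (num_items I) (\<lambda>i. real_of_rat (first_cost I i)) x"

abbreviation adversary_value :: "rrec_instance \<Rightarrow> nat \<Rightarrow> (nat \<Rightarrow> nat) \<Rightarrow> real" where
  "adversary_value I u j \<equiv> robust_value (num_items I) (\<lambda>i. real_of_rat (lower_cost I i))
     (\<lambda>i. real_of_rat (upper_cost I i)) (real_of_rat (budget I)) u j"

abbreviation choice_value :: "rrec_instance \<Rightarrow> nat \<Rightarrow> nat \<Rightarrow> (nat \<Rightarrow> nat) \<Rightarrow> real" where
  "choice_value I v u f \<equiv>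
     selection_cost I (\<lambda>i. f i mod 2) + adversary_value I u (\<lambda>i. f i div 2) / real v"

text \<open>All scaled data are multiples of v * 2^n, so the divisions by v are exact and the true
  cost occupies the part above bit n. The added powers of two contribute exactly the binary number
  with the selection as digits.\<close>

lemma total_cost_eq:
  fixes I :: rrec_instance and f :: "nat \<Rightarrow> nat"
  assumes v: "1 \<le> v" "v \<le> num_items I"
  defines "digits \<equiv> \<Sum>i<num_items I. int (f (Suc i) mod 2) * 2 ^ i"
  obtains a where "total_cost I v u f = 2 ^ num_items I * a + digits"
    "real_of_int (2 ^ num_items I * a) = real_of_int (scale I) *
       choice_value I v u f"
proof -
  let ?n = "num_items I"
  \<comment> \<open>Here v divides the factorial and 2^n the power of two; as these are separate
    factors of the scaled value, their product divides it.\<close>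
  have "int v * 2 ^ ?n dvd scaled I l" if l: "l < value_count I" for l
  proof -
    obtain r where r: "scaled I l = r * fact (value_count I) * 2 ^ value_count I"
      using scaled_factor[OF l] .
    have "int v dvd fact (value_count I)"
      using v dvd_fact[of v "value_count I"] by (metis add_leD1 int_dvd_int_iff le_add1
          mult_le_mono1 mult_1 of_nat_fact one_le_numeral order.trans)
    moreover have "(2::int) ^ ?n dvd 2 ^ value_count I" by (rule le_imp_power_dvd) simp
    ultimately show ?thesis unfolding r mult.assoc by (intro dvd_mult mult_dvd_mono)
  qed
  then obtain t where t: "\<And>l. l < value_count I \<Longrightarrow> scaled I l = int v * 2 ^ ?n * t l"
    unfolding dvd_def by metis
  let ?x = "\<lambda>i. int (f i mod 2)" and ?j = "\<lambda>i. int (f i div 2)"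
  let ?m = "\<lambda>i. max 0 (?j i - int u)"
  define a where "a = t 0 * int u + (\<Sum>i = 1..?n. ?x i * (int v * t i) +
     (t (?n + i) * ?j i + (t (2 * ?n + i) - t (?n + i)) * ?m i))"
  have v0: "int v \<noteq> 0" using v by simp
  have div: "(int v * c) div int v = c" for c using v0 by simp
  have budget: "masked I 0 * int u div int v = 2 ^ ?n * (t 0 * int u)"
    using div[of "2 ^ ?n * (t 0 * int u)"] t[of 0] by (simp add: masked_upto_def mult_ac)
  have choice: "choice_cost I v u i (f i) = 2 ^ ?n * (?x i * (int v * t i) +
     (t (?n + i) * ?j i + (t (2 * ?n + i) - t (?n + i)) * ?m i)) + ?x i * 2 ^ (i - 1)"
    if i: "i \<in> {1..?n}" for i
  proof -
    have m: "masked I i = int v * 2 ^ ?n * t i + 2 ^ (i - 1)" "masked I (?n + i) = int v * 2 ^ ?n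
        * t (?n + i)"
      "masked I (2 * ?n + i) = int v * 2 ^ ?n * t (2 * ?n + i)"
      using i t[of i] t[of "?n + i"] t[of "2 * ?n + i"] by (auto simp: masked_upto_def)
    have "masked I (?n + i) * ?j i + (masked I (2 * ?n + i) - masked I (?n + i)) * ?m i =
        int v * (2 ^ ?n * (t (?n + i) * ?j i + (t (2 * ?n + i) - t (?n + i)) * ?m i))"
      unfolding m(2,3) by (simp only: algebra_simps)
    then show ?thesis
      unfolding choice_cost_def m(1) by (simp only: div) (simp only: algebra_simps)
  qed
  have "(\<Sum>i = 1..?n. ?x i * 2 ^ (i - 1)) = digits"
    unfolding digits_def by (rule sum.reindex_bij_witness[of _ Suc "\<lambda>i. i - 1"]) auto
  then have "total_cost I v u f = 2 ^ ?n * a + digits"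
    unfolding total_cost_def budget a_def
    by (simp add: choice sum.distrib sum_distrib_left distrib_left)
  moreover have "real_of_int (2 ^ ?n * a) = real_of_int (scale I) *
       choice_value I v u f"
  proof -
    let ?D = "real_of_int (scale I)"
    let ?P = "2 ^ ?n :: real"
    have T: "?P * real_of_int (t l) = ?D * real_of_rat (instance_value I l) / real v" if "l <
        value_count I" for l
    proof -
      have "real v * ?P * real_of_int (t l) = real_of_int (scaled I l)"
        unfolding t[OF that] by simp
      also have "\<dots> = real_of_rat (instance_value I l) * ?D" by (rule scaled_eq[OF that])
      finally show ?thesis using v by (simp add: field_simps)
    qed
    have item: "?P * real_of_int (?x i * (int v * t i) +
          (t (?n + i) * ?j i + (t (2 * ?n + i) - t (?n + i)) * ?m i)) =
        ?D * (real_of_rat (first_cost I i) * real (f i mod 2)) + ?D / real v * (real_of_rat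
            (lower_cost I i) * real (f i div 2) +
          (real_of_rat (upper_cost I i) - real_of_rat (lower_cost I i)) * max 0 (real (f i div 2)
              - real u))"
      if i: "i \<in> {1..?n}" for i
    proof -
      define t1 t2 t3 where "t1 = real_of_int (t i)" and "t2 = real_of_int (t (?n + i))"
        and "t3 = real_of_int (t (2 * ?n + i))"
      define c1 c2 c3 where "c1 = real_of_rat (first_cost I i)" and "c2 = real_of_rat (lower_cost
          I i)"
        and "c3 = real_of_rat (upper_cost I i)"
      define x j m where "x = real (f i mod 2)" and "j = real (f i div 2)"
        and "m = max 0 (real (f i div 2) - real u)"
      have inst: "instance_value I i = first_cost I i" "instance_value I (?n + i) = lower_cost I i"
        "instance_value I (2 * ?n + i) = upper_cost I i"
        using i by (auto simp: instance_value_def)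
      have tt: "?P * t1 = ?D * c1 / real v" "?P * t2 = ?D * c2 / real v" "?P * t3 = ?D * c3 / real
          v"
        using T[of i] T[of "?n + i"] T[of "2 * ?n + i"] i
        by (simp_all add: t1_def t2_def t3_def c1_def c2_def c3_def inst)
      have mm: "real_of_int (?m i) = m" by (simp add: m_def max_def)
      have "?P * real_of_int (?x i * (int v * t i) +
          (t (?n + i) * ?j i + (t (2 * ?n + i) - t (?n + i)) * ?m i)) =
          x * real v * (?P * t1) + ((?P * t2) * j + (?P * t3 - ?P * t2) * m)"
        unfolding of_int_add of_int_mult of_int_diff mm
        by (simp only: t1_def t2_def t3_def x_def j_def of_int_of_nat_eq algebra_simps)
      also have "\<dots> = ?D * (c1 * x) + ?D / real v * (c2 * j + (c3 - c2) * m)"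
        unfolding tt using v by (simp add: field_simps)
      finally show ?thesis by (simp only: c1_def c2_def c3_def x_def j_def m_def)
    qed
    have "real_of_int (2 ^ ?n * a) = ?P * real_of_int (t 0) * real u +
        (\<Sum>i = 1..?n. ?P * real_of_int (?x i * (int v * t i) +
          (t (?n + i) * ?j i + (t (2 * ?n + i) - t (?n + i)) * ?m i)))"
      unfolding a_def by (simp only: of_int_mult of_int_add of_int_sum of_int_power of_int_numeral
          distrib_left sum_distrib_left of_int_of_nat_eq mult.assoc)
    also have "\<dots> = ?D * real_of_rat (budget I) / real v * real u +
        (\<Sum>i = 1..?n. ?D * (real_of_rat (first_cost I i) * real (f i mod 2)) + ?D / real v *
            (real_of_rat (lower_cost I i) * real (f i div 2) +
          (real_of_rat (upper_cost I i) - real_of_rat (lower_cost I i)) * max 0 (real (f i div 2)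
              - real u)))"
    proof -
      have "instance_value I 0 = budget I" by (simp add: instance_value_def)
      then have t0: "?P * real_of_int (t 0) = ?D * real_of_rat (budget I) / real v"
        using T[of 0] by simp
      show ?thesis unfolding t0 by (intro arg_cong2[of _ _ _ _ "(+)"] refl sum.cong item)
    qed
    also have "\<dots> = ?D * choice_value I v u f"
    proof -
      have "(\<Sum>i = 1..?n. d * c i + e * r i) = d * sum c {1..?n} + e * sum r {1..?n}" for d e ::
          real and c r
        by (simp only: sum.distrib sum_distrib_left)
      moreover have "d * b / w * r + (d * c + d / w * e) = d * (c + (e + b * r) / w)" for b c d e
          r w :: real
        by (simp add: add_divide_distrib algebra_simps)
      ultimately show ?thesis unfolding item_cost_def robust_value_def by (simp only:)
    qed
    finally show ?thesis .
  qed
  ultimately show thesis by (rule that)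
qed


lemma rrec_cost_admissible:
  assumes I: "I \<in> rrec_instances" and x: "x \<in> selections (num_items I) (num_selected I)"
  obtains v u f where "1 \<le> v" "v \<le> num_items I" "u \<le> num_items I" "admissible_choice I v f"
    "instance_cost I x =
     choice_value I v u f"
proof -
  let ?n = "num_items I"
  note D = rrec_instancesD[OF I]
  have cost: "0 \<le> real_of_rat (lower_cost I i) \<and> real_of_rat (lower_cost I i) \<le> real_of_rat
      (upper_cost I i)"
    if "i \<in> {1..?n}" for i using D(6)[OF that] by (simp add: of_rat_less_eq)
  obtain u v j where uv: "1 \<le> v" "v \<le> ?n" "u \<le> v"
    and j: "j \<in> fractional_recovery ?n (num_selected I) (recovery I) x v"
    and eq: "instance_cost I x =
      selection_cost I x +
      adversary_value I u j / real v"
    by (rule rrec_cost_attained[where C = "\<lambda>i. real_of_rat (first_cost I i)" and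
          \<Gamma> = "real_of_rat (budget I)", OF x D(4,3,1) _ cost]) (use D(5) in auto)
  define f where "f = (\<lambda>i. 2 * j i + x i)"
  have f: "f i mod 2 = x i \<and> f i div 2 = j i" if "i \<in> {1..?n}" for i
    using selectionsD(1)[OF x that] by (auto simp: f_def)
  have "f i \<le> 2 * v + 1" if "i \<in> {1..?n}" for i
  proof -
    have "j i \<le> v" using j that unfolding fractional_recovery_def by blast
    then show ?thesis using selectionsD(1)[OF x that] by (auto simp: f_def)
  qed
  moreover have "(\<Sum>i = 1..?n. f i mod 2) = num_selected I"
    using selectionsD(2)[OF x] f by simp
  moreover have "(\<lambda>i. f i div 2) \<in> fractional_recovery ?n (num_selected I) (recovery I) (\<lambda>i. f i
      mod 2) v"
    using j f by (simp add: fractional_recovery_def)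
  ultimately have "admissible_choice I v f" by (simp add: admissible_choice_def)
  moreover have "selection_cost I (\<lambda>i. f i mod 2) =
      selection_cost I x"
    using f by (simp add: item_cost_def)
  moreover have "adversary_value I u (\<lambda>i. f i div 2) =
      adversary_value I u j"
    using f by (simp add: robust_value_def)
  ultimately show thesis using uv eq by (intro that[of v u f]) auto
qed

text \<open>The optimal choice need not recover the worst case of its own selection a priori. Its
  value is at most the cost of every selection, while \<open>rrec_cost_le\<close> bounds the cost of
  its selection by that value, so all are equal at the optimum.\<close>

lemma rrec_output_correct:
  assumes I: "I \<in> rrec_instances"
  shows "rrec_solution I (rrec_output I)"
proof -
  let ?n = "num_items I" and ?p = "num_selected I" and ?k = "recovery I"
  let ?C = "\<lambda>i. real_of_rat (first_cost I i)" and ?cl = "\<lambda>i. real_of_rat (lower_cost I i)"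
  let ?cu = "\<lambda>i. real_of_rat (upper_cost I i)" and ?G = "real_of_rat (budget I)"
  let ?opt = "rrec_opt ?n ?p ?k ?C ?cl ?cu ?G"
  let ?digits = "\<lambda>f :: nat \<Rightarrow> nat. \<Sum>i<?n. int (f (Suc i) mod 2) * 2 ^ i"
  note D = rrec_instancesD[OF I]
  have D0: "0 < real_of_int (scale I)" using scale_upto_pos[of I] by simp
  have digits: "0 \<le> ?digits f" "?digits f < 2 ^ ?n"
    "\<And>i a. i < ?n \<Longrightarrow> (2 ^ ?n * a + ?digits f) div 2 ^ i mod 2 = int (f (Suc i) mod 2)" for f
    by (rule binary_digit; fastforce)+
  obtain x0 where "x0 \<in> selections ?n ?p" using selections_nonempty[OF D(3)] by blast
  then obtain v0 u0 f0 where ex: "1 \<le> v0" "v0 \<le> ?n" "u0 \<le> ?n" "admissible_choice I v0 f0"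
    using rrec_cost_admissible[OF I] by metis
  obtain v u f where opt: "1 \<le> v" "v \<le> ?n" "u \<le> ?n" "admissible_choice I v f"
    "optimum I = total_cost I v u f"
    using optimum_attained[OF I ex] .
  obtain a where a: "total_cost I v u f = 2 ^ ?n * a + ?digits f"
    "real_of_int (2 ^ ?n * a) = real_of_int (scale I) * choice_value I v u f"
    using total_cost_eq[OF opt(1,2)] .
  define x where "x = (\<lambda>i\<in>{1..?n}. f i mod 2)"
  have x: "x \<in> selections ?n ?p"
    using opt(4) by (auto simp: selections_def x_def admissible_choice_def PiE_def)
  have val_le: "choice_value I v u f \<le> instance_cost I y" if y: "y \<in> selections ?n ?p" for y
  proof -
    obtain v' u' f' where f': "1 \<le> v'" "v' \<le> ?n" "u' \<le> ?n" "admissible_choice I v' f'"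
      "instance_cost I y = choice_value I v' u' f'"
      using rrec_cost_admissible[OF I y] .
    obtain a' where a': "total_cost I v' u' f' = 2 ^ ?n * a' + ?digits f'"
      "real_of_int (2 ^ ?n * a') = real_of_int (scale I) * choice_value I v' u' f'"
      using total_cost_eq[OF f'(1,2)] .
    have "2 ^ ?n * a + ?digits f \<le> 2 ^ ?n * a' + ?digits f'"
      using optimum_le[OF I f'(1-4)] opt(5) a(1) a'(1) by simp
    \<comment> \<open>Both digit sums lie in [0, 2^n), so the recorded bits only break ties and
      cannot reverse the order of the true costs.\<close>
    then have "2 ^ ?n * a < 2 ^ ?n * (a' + 1)"
      using digits(1)[of f] digits(2)[of f'] by (simp add: distrib_left)
    then have "a \<le> a'" by simp
    then have "2 ^ ?n * a \<le> 2 ^ ?n * a'" by simp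
    then have "real_of_int (scale I) * choice_value I v u f \<le> real_of_int (scale I) * choice_value
        I v' u' f'"
      unfolding a(2)[symmetric] a'(2)[symmetric] by (simp only: of_int_le_iff)
    then show ?thesis using D0 f'(5) by simp
  qed
  have cost_le: "instance_cost I x \<le> choice_value I v u f"
  proof -
    have "(\<lambda>i. f i div 2) \<in> fractional_recovery ?n ?p ?k x v"
      using opt(4) by (simp add: admissible_choice_def fractional_recovery_def x_def)
    then have "instance_cost I x \<le> selection_cost I x + adversary_value I u (\<lambda>i. f i div 2) / real
        v"
      by (intro rrec_cost_le x D opt(1)) (use D in \<open>auto simp: of_rat_less_eq\<close>)
    also have "selection_cost I x = selection_cost I (\<lambda>i. f i mod 2)"
      by (simp add: item_cost_def x_def)
    finally show ?thesis .
  qed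
  have cost: "instance_cost I x = choice_value I v u f" using cost_le val_le[OF x] by linarith
  have min: "?opt = choice_value I v u f"
    unfolding rrec_opt_def
  proof (rule Min_eqI)
    show "finite (instance_cost I ` selections ?n ?p)" by (intro finite_imageI finite_selections)
    show "choice_value I v u f \<le> y" if "y \<in> instance_cost I ` selections ?n ?p" for y using that
        val_le by blast
    show "choice_value I v u f \<in> instance_cost I ` selections ?n ?p" using x cost by (metis imageI)
  qed
  define b where "b = scale I div 2 ^ ?n"
  have b: "scale I = b * 2 ^ ?n"
  proof -
    have "(2::int) ^ ?n dvd 2 ^ value_count I" by (rule le_imp_power_dvd) simp
    then have "2 ^ ?n dvd scale I" unfolding scale_factor by (rule dvd_mult)
    then show ?thesis by (simp add: b_def)
  qed
  have b0: "b > 0" using scale_upto_pos[of I "value_count I"] b by (metis zero_less_mult_pos2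
      zero_less_numeral zero_less_power)
  have "optimum I div 2 ^ ?n = a"
    unfolding opt(5) a(1) using digits(1,2)[of f] by simp
  moreover have "map (\<lambda>i. optimum I div 2 ^ (i - 1) mod 2) [1..<?n + 1] = map (\<lambda>i. int (x i))
      [1..<?n + 1]"
  proof (rule map_cong)
    fix i assume "i \<in> set [1..<?n + 1]"
    then have i: "i - 1 < ?n" "Suc (i - 1) = i" "i \<in> {1..?n}" by auto
    show "optimum I div 2 ^ (i - 1) mod 2 = int (x i)"
      unfolding opt(5) a(1) digits(3)[OF i(1)] i(2) using i(3) by (simp add: x_def)
  qed simp
  ultimately have out: "rrec_output I = map (\<lambda>i. int (x i)) [1..<?n + 1] @ [a, b]"
    unfolding rrec_output_def b_def[symmetric] by (simp only:)
  have "real_of_int a / real_of_int b = choice_value I v u f"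
  proof -
    have "2 ^ ?n * real_of_int a = 2 ^ ?n * (choice_value I v u f * real_of_int b)"
      using a(2) unfolding b of_int_mult of_int_power of_int_numeral by (simp only: mult_ac)
    then have "real_of_int a = choice_value I v u f * real_of_int b"
      by (rule mult_left_cancel[THEN iffD1, rotated]) simp
    then show ?thesis using b0 by simp
  qed
  then show ?thesis
    unfolding rrec_solution_def Let_def
    using x out cost min b0 by (intro bexI[of _ x] exI[of _ a] exI[of _ b] conjI) simp_all
qed

theorem theorem10:
  shows "solvable_in_polynomial_time rrec_instances encode_rrec rrec_solution"
proof -
  obtain g where g: "poly_bounded g" "\<And>I s. start I s \<Longrightarrow>
      \<exists>t s'. runs rrec_program s t s' \<and> t \<le> g (instance_size I) \<and> output_list s' = rrec_output I"
    using rrec_program_triple unfolding poly_triple_def by blast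
  from g(1) obtain q where q: "\<And>L. g L \<le> poly q L" unfolding poly_bounded_def by blast
  have "\<exists>t s. runs rrec_program (input_memory (encode_rrec I)) t s \<and>
      t \<le> poly q (input_size (encode_rrec I)) \<and> rrec_solution I (output_list s)"
    if "I \<in> rrec_instances" for I
  proof -
    have "start I (input_memory (encode_rrec I))" using that by (simp add: start_def)
    from g(2)[OF this] obtain t s where ts: "runs rrec_program (input_memory (encode_rrec I)) t s"
      "t \<le> g (instance_size I)" "output_list s = rrec_output I" by blast
    then show ?thesis
      using order.trans[OF ts(2) q] rrec_output_correct[OF that] unfolding instance_size_def by
          metis
  qed
  then show ?thesis unfolding solvable_in_polynomial_time_def by blast
qed

end
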